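(* Let $n\ge 1$, $\boldsymbol\mu\in\mathbb C^n$ with $\sum_l\mu_l=0$ and $\boldsymbol m\in\mathbb Z^n$. For $z\in\mathbb C\smallsetminus\{0\}$, $$J_{(\boldsymbol\mu,\boldsymbol m)}(z)=(2\pi^2)^{n-1}\sum_{l=1}^nS_l(\boldsymbol\mu,\boldsymbol m)\,J_l\big(2\pi z^{\frac1n};+,\boldsymbol\mu+\tfrac12\boldsymbol m\big)\,J_l\big(2\pi\overline z^{\frac1n};+,\boldsymbol\mu-\tfrac12\boldsymbol m\big),$$ with $S_l(\boldsymbol\mu,\boldsymbol m)=\prod_{k\ne l}(\pm i)^{m_l-m_k}\big/\sin\big(\pi(\mu_l-\mu_k\pm\frac12(m_l-m_k))\big)$ (either choice of sign gives the same value). Here, for $z=xe^{i\phi}$, $z^{\frac1n}=x^{\frac1n}e^{\frac1ni\phi}$ and $\overline z^{\frac1n}=x^{\frac1n}e^{-\frac1ni\phi}$; the right-hand side is independent of the choice of the argument $\phi$ of $z$ modulo $2\pi$. If $(\boldsymbol\mu,\boldsymbol m)$ is not generic, the right-hand side is understood to be replaced by its limit.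
   Context: $(\boldsymbol\mu,\boldsymbol m)$ is generic if $2(\mu_l-\mu_k)-|m_l-m_k|\notin2\mathbb Z$ for all $l\ne k$; in the non-generic case one takes the limit as $\boldsymbol\mu'\to\boldsymbol\mu$ with $\sum_l\mu'_l=0$ and $(\boldsymbol\mu',\boldsymbol m)$ generic. $\mathbb U$ denotes the universal cover of $\mathbb C\smallsetminus\{0\}$, with elements $\zeta=|\zeta|e^{i\arg\zeta}$, $\arg\zeta\in\mathbb R$, $\zeta^a=e^{a\log\zeta}$. For $\boldsymbol\lambda\in\mathbb C^n$ and $\zeta\in\mathbb U$, $$J_l(\zeta;+,\boldsymbol\lambda)=\sum_{m=0}^\infty\frac{(i^n)^m\zeta^{n(-\lambda_l+m)}}{\prod_{k=1}^n\Gamma(\lambda_k-\lambda_l+m+1)}.$$ Complex Bessel kernel: for $m\in\mathbb Z$ let $G_m(s)=i^{|m|}(2\pi)^{1-2s}\frac{\Gamma(s+\frac12|m|)}{\Gamma(1-s+\frac12|m|)}$ and $G_{(\boldsymbol\mu,\boldsymbol m)}(s)=\prod_{l=1}^nG_{m_l}(s-\mu_l)$. For $x>0$ put $$j_{(\boldsymbol\mu,\boldsymbol m)}(x)=\frac1{2\pi i}\int_{\mathcal C}G_{(\boldsymbol\mu,\boldsymbol m)}(s)x^{-2s}ds,$$ where $\mathcal C$ is any contour going upward from $\sigma-i\infty$ to $\sigma+i\infty$ with $\sigma<\frac12+\frac1n(\mathrm{Re}\sum_l\mu_l-\frac12)$, having all the sets $\mu_l-\frac12|m_l|-\frac12\mathbb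 N$ on its left, and with $\mathrm{Re}\,s=\sigma$ for $|\mathrm{Im}\,s|$ large on $\mathcal C$. With $\boldsymbol e^n=(1,\dots,1)$, $$J_{(\boldsymbol\mu,\boldsymbol m)}(xe^{i\phi})=\frac1{2\pi}\sum_{m\in\mathbb Z}j_{(\boldsymbol\mu,\boldsymbol m+m\boldsymbol e^n)}(x)e^{im\phi},$$ an absolutely convergent series. *)

theory Defs
  imports "HOL-Complex_Analysis.Complex_Analysis"
begin

text \<open>
  Throughout, vectors in $C^n$ and $Z^n$ are indexed by a finite type \<open>'n\<close>, so that
  $n$ is \<open>CARD('n)\<close>.
\<close>

definition generic :: "complex ^ 'n \<Rightarrow> int ^ 'n \<Rightarrow> bool" where
  "generic \<mu> m \<longleftrightarrow>
     (\<forall>l k. l \<noteq> k \<longrightarrow>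
        2 * (\<mu> $ l - \<mu> $ k) - of_int \<bar>m $ l - m $ k\<bar> \<notin> range (\<lambda>q::int. 2 * of_int q))"


subsection \<open>Bessel functions of the first kind on the universal cover\<close>

text \<open>
  A point \<open>\<zeta>\<close> of the universal cover of the punctured plane is given by its modulus
  (assumed positive) and its argument, an arbitrary real number.
\<close>

type_synonym ucover = "real \<times> real"

definition uc_power :: "ucover \<Rightarrow> complex \<Rightarrow> complex" where
  "uc_power \<zeta> a = exp (a * (of_real (ln (fst \<zeta>)) + \<i> * of_real (snd \<zeta>)))"

text \<open>
  Division by \<open>Gamma\<close> at one of its poles gives 0 in the library, which is the intended
  value of the entire function $1/\Gamma$.
\<close>

definition bessel_first :: "'n \<Rightarrow> ucover \<Rightarrow> complex ^ 'n \<Rightarrow> complex" where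
  "bessel_first l \<zeta> lam =
     (\<Sum>j. (\<i> ^ CARD('n)) ^ j * uc_power \<zeta> (of_nat CARD('n) * (- (lam $ l) + of_nat j)) /
           (\<Prod>k\<in>UNIV. Gamma (lam $ k - lam $ l + of_nat j + 1)))"


subsection \<open>The complex Bessel kernel\<close>

definition gamma_factor1 :: "int \<Rightarrow> complex \<Rightarrow> complex" where
  "gamma_factor1 m s =
     \<i> ^ nat \<bar>m\<bar> * of_real (2 * pi) powr (1 - 2 * s) *
     (Gamma (s + of_int \<bar>m\<bar> / 2) / Gamma (1 - s + of_int \<bar>m\<bar> / 2))"

definition gamma_factor :: "complex ^ 'n \<Rightarrow> int ^ 'n \<Rightarrow> complex \<Rightarrow> complex" where
  "gamma_factor \<mu> m s = (\<Prod>l\<in>UNIV. gamma_factor1 (m $ l) (s - \<mu> $ l))"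

text \<open>
  An infinite contour from $\sigma - i\infty$ to $\sigma + i\infty$ which is vertical for
  large imaginary part is given by \<open>\<sigma>\<close>, a height \<open>T\<close> and a piecewise $C^1$ path \<open>p\<close> from
  $\sigma - iT$ to $\sigma + iT$: it consists of the ray from $\sigma - i\infty$ to
  $\sigma - iT$, then \<open>p\<close>, then the ray from $\sigma + iT$ to $\sigma + i\infty$.
  A point lies to the left of it if the contour, cut off at height \<open>R\<close> and
  closed up by the three sides of a rectangle on the left, winds once
  around the point, for all large \<open>R\<close>.
\<close>

definition closed_up :: "real \<Rightarrow> real \<Rightarrow> (real \<Rightarrow> complex) \<Rightarrow> real \<Rightarrow> real \<Rightarrow> complex" where
  "closed_up \<sigma> T p R =
     linepath (Complex \<sigma> (- R)) (Complex \<sigma> (- T)) +++ p +++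
     linepath (Complex \<sigma> T) (Complex \<sigma> R) +++
     linepath (Complex \<sigma> R) (Complex (- R) R) +++
     linepath (Complex (- R) R) (Complex (- R) (- R)) +++
     linepath (Complex (- R) (- R)) (Complex \<sigma> (- R))"

definition left_of_contour :: "real \<Rightarrow> real \<Rightarrow> (real \<Rightarrow> complex) \<Rightarrow> complex \<Rightarrow> bool" where
  "left_of_contour \<sigma> T p w \<longleftrightarrow>
     (\<forall>\<^sub>F R in at_top. w \<notin> path_image (closed_up \<sigma> T p R) \<and>
                       winding_number (closed_up \<sigma> T p R) w = 1)"

definition admissible_contour ::
    "complex ^ 'n \<Rightarrow> int ^ 'n \<Rightarrow> real \<Rightarrow> real \<Rightarrow> (real \<Rightarrow> complex) \<Rightarrow> bool" where
  "admissible_contour \<mu> m \<sigma> T p \<longleftrightarrow>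
     T > 0 \<and> valid_path p \<and> pathstart p = Complex \<sigma> (- T) \<and> pathfinish p = Complex \<sigma> T \<and>
     \<sigma> < 1 / 2 + (Re (\<Sum>l\<in>UNIV. \<mu> $ l) - 1 / 2) / real CARD('n) \<and>
     (\<forall>l. \<forall>a::nat. left_of_contour \<sigma> T p (\<mu> $ l - of_int \<bar>m $ l\<bar> / 2 - of_nat a / 2))"

definition infinite_contour_integral ::
    "real \<Rightarrow> real \<Rightarrow> (real \<Rightarrow> complex) \<Rightarrow> (complex \<Rightarrow> complex) \<Rightarrow> complex" where
  "infinite_contour_integral \<sigma> T p f =
     integral {..- T} (\<lambda>t. f (Complex \<sigma> t) * \<i>) + contour_integral p f +
     integral {T..} (\<lambda>t. f (Complex \<sigma> t) * \<i>)"

text \<open>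
  The integral does not depend on the admissible contour; the kernel is the common value.
\<close>

definition bessel_j :: "complex ^ 'n \<Rightarrow> int ^ 'n \<Rightarrow> real \<Rightarrow> complex" where
  "bessel_j \<mu> m x =
     (THE v. \<forall>\<sigma> T p. admissible_contour \<mu> m \<sigma> T p \<longrightarrow>
        v = 1 / (2 * of_real pi * \<i>) *
            infinite_contour_integral \<sigma> T p
              (\<lambda>s. gamma_factor \<mu> m s * of_real x powr (- 2 * s)))"

definition bessel_kernel :: "complex ^ 'n \<Rightarrow> int ^ 'n \<Rightarrow> complex \<Rightarrow> complex" where
  "bessel_kernel \<mu> m z =
     1 / (2 * of_real pi) *
     (\<Sum>\<^sub>\<infinity>k\<in>UNIV. bessel_j \<mu> (m + vec k) (cmod z) * exp (\<i> * of_int k * of_real (Arg z)))"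


subsection \<open>The combination of Bessel functions of the first kind\<close>

text \<open>The parameter \<open>\<epsilon>\<close> is the choice of sign, 1 or -1.\<close>

definition S_coeff :: "complex \<Rightarrow> complex ^ 'n \<Rightarrow> int ^ 'n \<Rightarrow> 'n \<Rightarrow> complex" where
  "S_coeff \<epsilon> \<mu> m l =
     (\<Prod>k\<in>UNIV - {l}. (\<epsilon> * \<i>) powi (m $ l - m $ k) /
        sin (of_real pi * (\<mu> $ l - \<mu> $ k + \<epsilon> * (of_int (m $ l - m $ k) / 2))))"

text \<open>
  Here \<open>z = x e^(i \<phi>)\<close>, and the two points of the universal cover below are
  $2\pi z^{1/n}$ and $2\pi \bar z^{1/n}$.
\<close>

definition bessel_combination ::
    "complex \<Rightarrow> complex ^ 'n \<Rightarrow> int ^ 'n \<Rightarrow> real \<Rightarrow> real \<Rightarrow> complex" where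
  "bessel_combination \<epsilon> \<mu> m x \<phi> =
     of_real (2 * pi\<^sup>2) ^ (CARD('n) - 1) *
     (\<Sum>l\<in>UNIV. S_coeff \<epsilon> \<mu> m l *
        bessel_first l (2 * pi * x powr (1 / real CARD('n)), \<phi> / real CARD('n))
          (\<chi> k. \<mu> $ k + of_int (m $ k) / 2) *
        bessel_first l (2 * pi * x powr (1 / real CARD('n)), - \<phi> / real CARD('n))
          (\<chi> k. \<mu> $ k - of_int (m $ k) / 2))"

end

theory Submission
  imports Defs
begin

text \<open>
  The quotients of Gamma functions decay like powers along vertical lines, so an admissible contour may be
  replaced by a far left vertical line at the cost of the residues in between; in particular the
  contour integral does not depend on the contour. Since moving the line further to the left by one multiplies the integrand
  by a small factor, the kernel \<open>bessel_j\<close> is the sum of all residues. For generic parameters all poles are simple,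
  and by the reflection formula the residues, summed over the Fourier index as well, are the terms of the product of
  two Bessel series. The non-generic case follows by continuity: near a given parameter the
  kernel is an integral over fixed curves, and on a far left line the integrand is bounded
  by a summable function of the Fourier index, uniformly in the parameter.
\<close>

text \<open>All estimates rest on one observation: complex conjugation turns the denominator Gamma(1
  - u + |M|/2), up to modulus, into Gamma at the argument of the numerator plus the real number 1 -
  2 Re u. So only quotients Gamma(v) / Gamma(v + \<delta>) with real \<delta> have to be bounded,
  and these follow from the limit product without Stirling's formula. Over the n factors the
  exponents of |Im s| add up to 2 n Re s - n, since the entries of \<mu> sum to 0; the condition on
  \<sigma> in \<open>admissible_contour\<close> says that this is below -1 on the rays. The Fourier
  index k translates m and so moves the poles by half-integers. A line serving all k at once has to
  avoid every half-integer translate of \<open>Re (\<mu> $ l)\<close>, with room for \<mu> to vary;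
  this is \<open>clear_line\<close>. The obstacle in the non-generic case is that single summands of
  the combination may blow up where a sine vanishes, although their sum converges. Hence no limit is
  computed on the Bessel side: the kernel itself is continuous, and the combination equals it at
  every generic parameter.\<close>

no_notation fps_nth (infixl \<open>$\<close> 75)

subsection \<open>Quotients of Gamma functions\<close>

text \<open>Both ln |w + \<delta>| - ln |w| and \<delta> (ln |w + 1| - ln |w|) have the linear part
  \<delta> Re w / |w|^2, so their difference is of second order. Only an upper bound can be uniform,
  because w + \<delta> may come close to 0; |w| and |w + 1| are kept away from 0 by \<eta>.\<close>

lemma ln_norm_shift_bound:
  fixes w :: complex and \<delta> \<eta> D :: real
  assumes \<eta>: "\<eta> > 0" "norm w \<ge> \<eta>" "norm (w + 1) \<ge> \<eta>"
    and D: "\<bar>\<delta>\<bar> \<le> D" and nz: "w + of_real \<delta> \<noteq> 0"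
  shows "ln (norm (w + of_real \<delta>)) - ln (norm w) - \<delta> * (ln (norm (w + 1)) - ln (norm w))
    \<le> (D\<^sup>2 + D * (1 + (2 + 1 / \<eta>)\<^sup>2 * (1 + 1 / \<eta>)\<^sup>2)) / 2 / (norm w)\<^sup>2"
proof -
  \<comment> \<open>For real d, |w + d|^2 / |w|^2 = 1 + 2 d r + d^2 q; \<open>X\<close> is this
    minus 1 at d = 1, and \<open>H * q\<close> will dominate X^2 / (1 + X).\<close>
  define r where "r = Re w / (norm w)\<^sup>2"
  define q where "q = 1 / (norm w)\<^sup>2"
  define X where "X = 2 * r + q"
  define H where "H = (2 + 1 / \<eta>)\<^sup>2 * (1 + 1 / \<eta>)\<^sup>2"
  define L where "L = 2 * (ln (norm (w + 1)) - ln (norm w))"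
  have w0: "norm w > 0" and w1: "norm (w + 1) > 0" using \<eta> by linarith+
  have q0: "q > 0" unfolding q_def using w0 by simp
  have Hq: "H \<ge> 0" unfolding H_def by simp
  have sq: "(norm (w + of_real d))\<^sup>2 = (norm w)\<^sup>2 * (1 + 2 * d * r + d\<^sup>2 * q)" for d :: real
  proof -
    have "(norm (w + of_real d))\<^sup>2 = (norm w)\<^sup>2 + 2 * d * Re w + d\<^sup>2"
      unfolding cmod_power2 by (simp add: power2_eq_square algebra_simps)
    also have "\<dots> = (norm w)\<^sup>2 * (1 + 2 * d * r + d\<^sup>2 * q)"
      using w0 by (simp add: r_def q_def field_simps)
    finally show ?thesis .
  qed
  have lnsq: "2 * (ln (norm (w + of_real d)) - ln (norm w)) = ln (1 + 2 * d * r + d\<^sup>2 * q)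
      \<and> 1 + 2 * d * r + d\<^sup>2 * q > 0" if "w + of_real d \<noteq> 0" for d :: real
  proof -
    have p: "norm (w + of_real d) > 0" using that by simp
    have pos: "1 + 2 * d * r + d\<^sup>2 * q > 0"
      using sq[of d] p w0 by (metis zero_less_mult_pos zero_less_power)
    have "ln ((norm (w + of_real d))\<^sup>2) = ln ((norm w)\<^sup>2) + ln (1 + 2 * d * r + d\<^sup>2 * q)"
      unfolding sq using w0 pos by (subst ln_mult) auto
    then show ?thesis using p w0 pos by (simp add: ln_realpow)
  qed
  have a: "2 * (ln (norm (w + of_real \<delta>)) - ln (norm w)) \<le> 2 * \<delta> * r + \<delta>\<^sup>2 * q"
    using lnsq[OF nz] ln_add_one_self_le_self2[of "2 * \<delta> * r + \<delta>\<^sup>2 * q"] by (simp add: add.assoc)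
  have w1': "w + of_real 1 \<noteq> 0" using w1 by auto
  have LX: "L = ln (1 + X)" and X1: "1 + X > 0"
    using lnsq[OF w1'] by (simp_all add: L_def X_def add.assoc)
  have LleX: "L \<le> X" unfolding LX using X1 ln_add_one_self_le_self2[of X] by simp
  have LgeX: "L \<ge> X - X\<^sup>2 / (1 + X)"
  proof -
    have "1 - 1 / (1 + X) \<le> ln (1 + X)" using ln_le_minus_one[of "1 / (1 + X)"] X1
      by (simp add: ln_div)
    moreover have "X - X\<^sup>2 / (1 + X) = 1 - 1 / (1 + X)" using X1 by (simp add: field_simps power2_eq_square)
    ultimately show ?thesis using LX by simp
  qed
  have X1': "1 + X = (norm (w + 1) / norm w)\<^sup>2"
    using sq[of 1] w0 by (simp add: X_def power_divide field_simps)
  have "norm w / norm (w + 1) \<le> 1 + 1 / \<eta>"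
  proof -
    have "norm w \<le> norm (w + 1) + 1" using norm_triangle_ineq4[of "w + 1" 1] by simp
    also have "\<dots> \<le> norm (w + 1) + norm (w + 1) / \<eta>" using \<eta> by (simp add: field_simps)
    finally show ?thesis using w1 by (simp add: field_simps)
  qed
  then have b1: "1 / (1 + X) \<le> (1 + 1 / \<eta>)\<^sup>2"
    using power_mono[of "norm w / norm (w + 1)" "1 + 1 / \<eta>" 2] w0 w1
    by (simp add: X1' power_divide)
  have "\<bar>X\<bar> \<le> (2 + 1 / \<eta>) / norm w"
  proof -
    have "\<bar>r\<bar> \<le> 1 / norm w" using abs_Re_le_cmod[of w] w0
      by (simp add: r_def power2_eq_square field_simps)
    moreover have "q \<le> 1 / \<eta> / norm w" using \<eta> w0 by (simp add: q_def power2_eq_square field_simps)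
    moreover have "(2 + 1 / \<eta>) / norm w = 2 * (1 / norm w) + 1 / \<eta> / norm w"
      by (simp add: add_divide_distrib)
    ultimately show ?thesis using q0 unfolding X_def by linarith
  qed
  then have b2: "X\<^sup>2 \<le> (2 + 1 / \<eta>)\<^sup>2 * q"
    using power_mono[of "\<bar>X\<bar>" "(2 + 1 / \<eta>) / norm w" 2] by (simp add: q_def power_divide)
  have XX: "X\<^sup>2 / (1 + X) \<le> H * q"
  proof -
    have "X\<^sup>2 * (1 / (1 + X)) \<le> ((2 + 1 / \<eta>)\<^sup>2 * q) * (1 + 1 / \<eta>)\<^sup>2"
      by (intro mult_mono b1 b2) (use q0 X1 in auto)
    then show ?thesis by (simp add: H_def ac_simps)
  qed
  have "\<bar>L - 2 * r\<bar> \<le> (1 + H) * q"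
  proof -
    have "L \<le> 2 * r + q" using LleX X_def by simp
    moreover have "L \<ge> 2 * r + q - H * q" using LgeX X_def XX by linarith
    moreover have "H * q \<ge> 0" using Hq q0 by simp
    ultimately show ?thesis using q0 unfolding distrib_right by linarith
  qed
  then have "\<bar>\<delta>\<bar> * \<bar>L - 2 * r\<bar> \<le> D * ((1 + H) * q)" using D by (intro mult_mono) auto
  then have "- \<delta> * (L - 2 * r) \<le> D * (1 + H) * q"
    by (metis abs_ge_self abs_minus_cancel abs_mult mult.assoc order_trans)
  moreover have "\<delta>\<^sup>2 * q \<le> D\<^sup>2 * q"
    using D q0 by (intro mult_right_mono) (auto simp: abs_le_square_iff[symmetric])
  ultimately have "2 * (ln (norm (w + of_real \<delta>)) - ln (norm w)) - \<delta> * L \<le> (D\<^sup>2 + D * (1 + H)) * q"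
    using a by (simp add: algebra_simps)
  then show ?thesis unfolding H_def[symmetric] L_def q_def by (simp add: field_simps)
qed

text \<open>Terms with k beyond |A| are dominated by the series of inverse squares, the finitely
  many others by 1 / \<eta>^2. The majorant depends only on A and \<eta>, which makes the bound
  uniform in v and n.\<close>

lemma sum_inverse_square_shift_bounded:
  fixes A \<eta> :: real
  assumes "\<eta> > 0"
  obtains B where "B \<ge> 0" and "\<And>v::complex. \<And>n. Re v \<ge> - A \<Longrightarrow> (\<And>k::nat. norm (v + of_nat k) \<ge> \<eta>) \<Longrightarrow>
    (\<Sum>k\<le>n. 1 / (norm (v + of_nat k))\<^sup>2) \<le> B"
proof -
  define N where "N = nat \<lceil>\<bar>A\<bar>\<rceil>"
  have N: "A \<le> real N" unfolding N_def by linarith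
  define b where "b k = (if k \<le> N then 1 / \<eta>\<^sup>2 else 1 / (real (k - N))\<^sup>2)" for k
  have "summable (\<lambda>k. b (k + (N + 1)))"
    using inverse_squares_sums by (simp add: b_def sums_iff add.commute)
  then have sb: "summable b" by (rule summable_iff_shift[THEN iffD1])
  have b0: "b k \<ge> 0" for k by (simp add: b_def)
  show thesis
  proof (rule that[of "suminf b"])
    show "suminf b \<ge> 0" by (intro suminf_nonneg sb b0)
    fix v :: complex and n
    assume v: "Re v \<ge> - A" "\<And>k::nat. norm (v + of_nat k) \<ge> \<eta>"
    have le: "1 / (norm (v + of_nat k))\<^sup>2 \<le> b k" for k
    proof (cases "k \<le> N")
      case True
      have "\<eta>\<^sup>2 \<le> (norm (v + of_nat k))\<^sup>2" using v(2)[of k] assms by (intro power_mono) auto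
      then show ?thesis using True assms frac_le[of 1 1 "\<eta>\<^sup>2"] by (simp add: b_def)
    next
      case False
      have "real (k - N) \<le> Re (v + of_nat k)" using False v(1) N by (simp add: of_nat_diff)
      also have "\<dots> \<le> norm (v + of_nat k)" by (rule complex_Re_le_cmod)
      finally have "(real (k - N))\<^sup>2 \<le> (norm (v + of_nat k))\<^sup>2" by (intro power_mono) auto
      moreover have "0 < (real (k - N))\<^sup>2" using False by simp
      ultimately show ?thesis
        using False frac_le[of 1 1 "(real (k - N))\<^sup>2"] by (simp add: b_def del: of_nat_diff)
    qed
    have "(\<Sum>k\<le>n. 1 / (norm (v + of_nat k))\<^sup>2) \<le> (\<Sum>k\<le>n. b k)" by (intro sum_mono le)
    also have "\<dots> \<le> suminf b" by (intro sum_le_suminf sb) (auto simp: b0)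
    finally show "(\<Sum>k\<le>n. 1 / (norm (v + of_nat k))\<^sup>2) \<le> suminf b" .
  qed
qed

text \<open>
  Each factor of the limit product for the quotient is compared with the telescoping factor
  \<open>(\<bar>v + k + 1\<bar> / \<bar>v + k\<bar>) powr \<delta>\<close>.
\<close>

lemma norm_Gamma_quotient_le:
  fixes \<eta> A D :: real
  assumes \<eta>: "\<eta> > 0" and D: "D \<ge> 0"
  obtains C where "C > 0" and "\<And>v \<delta>. Re v \<ge> - A \<Longrightarrow> (\<And>k::nat. norm (v + of_nat k) \<ge> \<eta>) \<Longrightarrow> \<bar>\<delta>\<bar> \<le> D \<Longrightarrow>
     norm (Gamma v * rGamma (v + complex_of_real \<delta>)) \<le> C * norm v powr (- \<delta>)"
proof -
  define K where "K = (D\<^sup>2 + D * (1 + (2 + 1 / \<eta>)\<^sup>2 * (1 + 1 / \<eta>)\<^sup>2)) / 2"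
  have K0: "K \<ge> 0" using D unfolding K_def by simp
  obtain B where B0: "B \<ge> 0" and B: "\<And>v::complex. \<And>n. Re v \<ge> - A \<Longrightarrow> (\<And>k::nat. norm (v + of_nat k) \<ge> \<eta>) \<Longrightarrow>
    (\<Sum>k\<le>n. 1 / (norm (v + of_nat k))\<^sup>2) \<le> B"
    using sum_inverse_square_shift_bounded[OF \<eta>] by metis
  show thesis
  proof (rule that[of "exp (K * B)"])
    fix v :: complex and \<delta> :: real
    assume v: "Re v \<ge> - A" and vk: "\<And>k::nat. norm (v + of_nat k) \<ge> \<eta>" and \<delta>: "\<bar>\<delta>\<bar> \<le> D"
    have vk0: "norm (v + of_nat k) > 0" for k using vk[of k] \<eta> by linarith
    show "norm (Gamma v * rGamma (v + complex_of_real \<delta>)) \<le> exp (K * B) * norm v powr (- \<delta>)"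
    \<comment> \<open>If v + \<delta> is a pole of Gamma, the left-hand side is 0; otherwise no
      logarithm below is taken at 0.\<close>
    proof (cases "\<exists>k::nat. v + of_real \<delta> + of_nat k = 0")
      case True
      then obtain k :: nat where "v + of_real \<delta> = - of_nat k" by (metis add_eq_0_iff2)
      then have "v + of_real \<delta> \<in> \<int>\<^sub>\<le>\<^sub>0" by simp
      then have "rGamma (v + of_real \<delta>) = 0" by (simp add: rGamma_eq_zero_iff)
      then show ?thesis by simp
    next
      case False
      then have nz: "(v + of_nat k) + of_real \<delta> \<noteq> 0" for k by (simp add: algebra_simps)
      define g where "g k = ln (norm (v + of_nat k))" for k :: nat
      define h where "h k = ln (norm (v + of_nat k + of_real \<delta>))" for k :: nat
      have step: "h k - g k \<le> \<delta> * (g (Suc k) - g k) + K * (1 / (norm (v + of_nat k))\<^sup>2)" for k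
        using ln_norm_shift_bound[OF \<eta> vk[of k] _ \<delta> nz[of k]] vk[of "Suc k"]
        by (simp add: g_def h_def K_def add_ac)
      have sumle: "(\<Sum>k\<le>n. h k - g k) \<le> \<delta> * (g (Suc n) - g 0) + K * B" for n
      proof -
        have "(\<Sum>k\<le>n. h k - g k) \<le> (\<Sum>k\<le>n. \<delta> * (g (Suc k) - g k) + K * (1 / (norm (v + of_nat k))\<^sup>2))"
          by (intro sum_mono step)
        also have "\<dots> = \<delta> * (\<Sum>k\<le>n. g (Suc k) - g k) + K * (\<Sum>k\<le>n. 1 / (norm (v + of_nat k))\<^sup>2)"
          by (simp add: sum.distrib sum_distrib_left)
        also have "(\<Sum>k\<le>n. g (Suc k) - g k) = g (Suc n) - g 0"
          by (induction n) auto
        also have "K * (\<Sum>k\<le>n. 1 / (norm (v + of_nat k))\<^sup>2) \<le> K * B"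
          by (intro mult_left_mono B K0) (use v vk in auto)
        finally show ?thesis by simp
      qed
      \<comment> \<open>Telescoping leaves |v + n + 1|^\<delta> / |v|^\<delta>, and the power
        n^(-\<delta>) from the two Gamma series turns the numerator into a quantity that tends to
        1.\<close>
      have nrm: "norm (Gamma_series v n * rGamma_series (v + of_real \<delta>) n)
          \<le> exp (K * B) * norm v powr (-\<delta>) * (norm (v + of_nat (Suc n)) / real n) powr \<delta>" if n: "n > 0" for n
      proof -
        have e: "Gamma_series v n * rGamma_series (v + of_real \<delta>) n =
           pochhammer (v + of_real \<delta>) (n + 1) / pochhammer v (n + 1) * exp (- of_real (\<delta> * ln (real n)))"
          by (simp add: Gamma_series_def rGamma_series_def ring_distribs exp_add exp_minus field_simps)
        have "norm (pochhammer (v + of_real \<delta>) (n + 1) / pochhammer v (n + 1)) = exp (\<Sum>k\<le>n. h k - g k)"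
        proof -
          have "exp (\<Sum>k\<le>n. h k - g k) = (\<Prod>k\<le>n. norm (v + of_nat k + of_real \<delta>) / norm (v + of_nat k))"
            using vk0 nz by (simp add: exp_sum exp_diff h_def g_def)
          also have "\<dots> = norm (\<Prod>k\<le>n. (v + of_nat k + of_real \<delta>)) / norm (\<Prod>k\<le>n. (v + of_nat k))"
            by (simp add: prod_dividef prod_norm)
          also have "\<dots> = norm (pochhammer (v + of_real \<delta>) (n + 1) / pochhammer v (n + 1))"
            by (simp add: pochhammer_prod norm_divide atLeast0LessThan lessThan_Suc_atMost add_ac)
          finally show ?thesis ..
        qed
        then have "norm (Gamma_series v n * rGamma_series (v + of_real \<delta>) n) =
            exp (\<Sum>k\<le>n. h k - g k) * exp (- \<delta> * ln (real n))"
          unfolding e norm_mult by (simp add: norm_exp_eq_Re)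
        also have "\<dots> \<le> exp (\<delta> * (g (Suc n) - g 0) + K * B) * exp (- \<delta> * ln (real n))"
          using sumle by (intro mult_right_mono) auto
        also have "\<dots> = exp (K * B) * norm v powr (-\<delta>) * (norm (v + of_nat (Suc n)) / real n) powr \<delta>"
          using vk0[of "Suc n"] vk0[of 0] n
          by (simp add: g_def powr_def ln_div exp_add [symmetric] algebra_simps)
        finally show ?thesis .
      qed
      have l1: "(\<lambda>n. norm (Gamma_series v n * rGamma_series (v + of_real \<delta>) n)) \<longlonglongrightarrow>
          norm (Gamma v * rGamma (v + of_real \<delta>))"
        by (intro tendsto_intros)
      have "(\<lambda>n. norm ((v + 1) / of_nat n + 1)) \<longlonglongrightarrow> norm (0 + 1 :: complex)"
        by (intro tendsto_intros lim_const_over_n)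
      moreover have "\<forall>\<^sub>F n in sequentially. norm ((v + 1) / of_nat n + 1) = norm (v + of_nat (Suc n)) / real n"
        using eventually_gt_at_top[of 0]
      proof eventually_elim
        case (elim n)
        have "(v + 1) / of_nat n + 1 = (v + of_nat (Suc n)) / of_nat n" using elim by (simp add: field_simps)
        then show ?case by (simp add: norm_divide)
      qed
      ultimately have l0: "(\<lambda>n. norm (v + of_nat (Suc n)) / real n) \<longlonglongrightarrow> 1"
        by (simp add: tendsto_cong)
      have l2: "(\<lambda>n. exp (K * B) * norm v powr (-\<delta>) * (norm (v + of_nat (Suc n)) / real n) powr \<delta>)
          \<longlonglongrightarrow> exp (K * B) * norm v powr (-\<delta>) * 1 powr \<delta>"
        by (intro tendsto_mult tendsto_const tendsto_powr l0) auto
      show ?thesis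
        using tendsto_le[OF sequentially_bot l2 l1 eventually_mono[OF eventually_gt_at_top[of 0] nrm]]
        by simp
    qed
  qed auto
qed

subsection \<open>The integrand of the kernel\<close>

definition integrand :: "complex ^ 'n \<Rightarrow> int ^ 'n \<Rightarrow> real \<Rightarrow> complex \<Rightarrow> complex" where
  "integrand \<mu> m x s = gamma_factor \<mu> m s * of_real x powr (- 2 * s)"

text \<open>Points where a numerator Gamma has a pole. In the product the orders may add up, or be
  lowered by zeros of other factors; a point that becomes removable contributes the residue
  0.\<close>

definition poles :: "complex ^ 'n \<Rightarrow> int ^ 'n \<Rightarrow> complex set" where
  "poles \<mu> m = {\<mu> $ l - of_int \<bar>m $ l\<bar> / 2 - of_nat a | l a. True}"

lemma divide_Gamma_eq: "a / Gamma b = a * rGamma b"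
  by (simp add: Gamma_def divide_inverse)

text \<open>Conjugation leaves the modulus of \<open>rGamma\<close> unchanged, and 1 - cnj u = u +
  (1 - 2 Re u); this produces the real shift to which \<open>norm_Gamma_quotient_le\<close>
  applies.\<close>

lemma norm_gamma_factor1:
  "norm (gamma_factor1 M u) = (2 * pi) powr (1 - 2 * Re u) *
     norm (Gamma (u + of_int \<bar>M\<bar> / 2) * rGamma (u + of_int \<bar>M\<bar> / 2 + of_real (1 - 2 * Re u)))"
proof -
  have "norm (rGamma (1 - u + of_int \<bar>M\<bar> / 2)) = norm (rGamma (cnj (1 - u + of_int \<bar>M\<bar> / 2)))"
    by (simp only: cnj_rGamma[symmetric] complex_mod_cnj)
  also have "cnj (1 - u + of_int \<bar>M\<bar> / 2) = u + of_int \<bar>M\<bar> / 2 + of_real (1 - 2 * Re u)"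
    by (simp add: complex_eq_iff)
  finally have a: "norm (rGamma (1 - u + of_int \<bar>M\<bar> / 2)) = norm (rGamma (u + of_int \<bar>M\<bar> / 2 + of_real (1 - 2 * Re u)))" .
  have "norm (of_real (2 * pi) powr (1 - 2 * u)) = (2 * pi) powr (1 - 2 * Re u)"
    by (subst norm_powr_real_powr) auto
  then show ?thesis unfolding gamma_factor1_def divide_Gamma_eq
    by (simp only: norm_mult norm_power norm_ii power_one a mult_1)
qed

section \<open>Decay of the integrand on vertical lines and in vertical strips\<close>

lemma norm_integrand:
  assumes "x > 0"
  shows "norm (integrand \<mu> m x s) = (\<Prod>l\<in>UNIV. norm (gamma_factor1 (m $ l) (s - \<mu> $ l))) * x powr (- 2 * Re s)"
  using assms by (simp add: integrand_def gamma_factor_def norm_mult prod_norm norm_powr_real_powr)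

text \<open>At abscissa c every shift is at least 4, even for the perturbed parameter, so each
  factor is O((1 + |v|)^(-4)). For all indices but one only boundedness is used. For the remaining
  index \<open>l0\<close>, |v| controls both |t| and |k| linearly, and the fourth power pays for (1
  + k^2) (1 + t^2).\<close>

lemma integrand_line_bound:
  fixes \<mu> :: "complex ^ 'n" and m :: "int ^ 'n" and x c \<eta> :: real
  assumes x: "x > 0" and \<eta>: "\<eta> > 0" "\<eta> \<le> 1 / 2"
    and clear: "\<And>l. \<And>q::int. \<bar>c - Re (\<mu> $ l) + of_int q / 2\<bar> \<ge> 2 * \<eta>"
    and far: "\<And>l. 1 - 2 * (c - Re (\<mu> $ l)) \<ge> 5"
  obtains C where "C > 0" and "\<And>\<mu>' k t. norm (\<mu>' - \<mu>) \<le> \<eta> \<Longrightarrow>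
     norm (integrand \<mu>' (m + vec k) x (Complex c t)) \<le> C / ((1 + (of_int k)\<^sup>2) * (1 + t\<^sup>2))"
proof -
  \<comment> \<open>The summand 1 is room for \<mu>': moving \<mu> by \<eta> \<le> 1/2 changes the
    shift by at most 1.\<close>
  define D where "D = (\<Sum>l\<in>UNIV. \<bar>1 - 2 * (c - Re (\<mu> $ l))\<bar>) + 1"
  define l0 :: 'n where "l0 = undefined"
  \<comment> \<open>Chosen so that |v| \<ge> \<eta> implies |v| \<ge> \<kappa> (1 + |v|).\<close>
  define \<kappa> where "\<kappa> = \<eta> / (1 + \<eta>)"
  have Dl: "\<bar>1 - 2 * (c - Re (\<mu> $ l))\<bar> \<le> D - 1" for l
    unfolding D_def using member_le_sum[of l UNIV "\<lambda>l. \<bar>1 - 2 * (c - Re (\<mu> $ l))\<bar>"] by simp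
  have D0: "D \<ge> 6" using Dl[of l0] far[of l0] by linarith
  then have D0': "D \<ge> 0" by simp
  have \<kappa>: "\<kappa> > 0" "\<kappa> \<le> 1" using \<eta> by (auto simp: \<kappa>_def)
  obtain C1 where C1: "C1 > 0" and C1b: "\<And>v \<delta>. Re v \<ge> - D \<Longrightarrow> (\<And>k::nat. norm (v + of_nat k) \<ge> \<eta>) \<Longrightarrow> \<bar>\<delta>\<bar> \<le> D \<Longrightarrow>
     norm (Gamma v * rGamma (v + complex_of_real \<delta>)) \<le> C1 * norm v powr (- \<delta>)"
    by (rule norm_Gamma_quotient_le[OF \<eta>(1) D0', of D]) (rule that; blast)
  define C2 where "C2 = (2 * pi) powr D * C1 * \<kappa> powr (- D)"
  define K where "K = (1 + norm (\<mu> $ l0) + \<eta>) * (3 + of_int \<bar>m $ l0\<bar> + 2 * D)"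
  have C2: "C2 > 0" unfolding C2_def using C1 \<kappa> by simp
  have K: "K > 0" unfolding K_def using \<eta> D0 by (intro mult_pos_pos add_pos_nonneg add_nonneg_pos) auto
  show thesis
  proof (rule that[of "(max 1 C2) ^ CARD('n) * K\<^sup>2 * x powr (- 2 * c)"])
    fix \<mu>' :: "complex ^ 'n" and k :: int and t :: real
    assume near: "norm (\<mu>' - \<mu>) \<le> \<eta>"
    have nl: "norm (\<mu>' $ l - \<mu> $ l) \<le> \<eta>" for l
      using Finite_Cartesian_Product.norm_nth_le[of "\<mu>' - \<mu>" l] near by simp
    have rl: "\<bar>Re (\<mu>' $ l) - Re (\<mu> $ l)\<bar> \<le> \<eta>" for l
      using abs_Re_le_cmod[of "\<mu>' $ l - \<mu> $ l"] nl[of l] by simp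
    define v where "v l = Complex c t - \<mu>' $ l + of_int \<bar>m $ l + k\<bar> / 2" for l
    define d where "d l = 1 - 2 * (c - Re (\<mu>' $ l))" for l
    have dl: "d l \<ge> 4" "d l \<le> D" "\<bar>d l\<bar> \<le> D" for l
      using rl[of l] far[of l] Dl[of l] \<eta> by (auto simp: d_def)
    have Rev: "Re (v l) = c - Re (\<mu>' $ l) + of_int \<bar>m $ l + k\<bar> / 2" for l
      by (simp add: v_def)
    have vk: "norm (v l + of_nat j) \<ge> \<eta>" for l and j :: nat
    proof -
      \<comment> \<open>One half-integer absorbs both |m_l + k| / 2 and the index j of the pole, so
        the same line serves all k.\<close>
      have "\<bar>c - Re (\<mu> $ l) + of_int (\<bar>m $ l + k\<bar> + 2 * int j) / 2\<bar> \<ge> 2 * \<eta>" by (rule clear)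
      then have "\<bar>Re (v l + of_nat j)\<bar> \<ge> \<eta>"
        using rl[of l] by (simp add: Rev add_divide_distrib)
      then show ?thesis using abs_Re_le_cmod[of "v l + of_nat j"] by linarith
    qed
    have v0: "norm (v l) \<ge> \<eta>" for l using vk[of l 0] by simp
    have fac: "norm (gamma_factor1 ((m + vec k) $ l) (Complex c t - \<mu>' $ l)) \<le> C2 * (1 + norm (v l)) powr (- 4)" for l
    proof -
      have "0 \<le> real_of_int \<bar>m $ l + k\<bar>" by simp
      then have "Re (v l) \<ge> - D" using abs_le_D1[OF dl(3)[of l]] D0 unfolding Rev d_def by argo
      note g = C1b[OF this vk dl(3)]
      have "norm (v l) powr (- d l) \<le> (\<kappa> * (1 + norm (v l))) powr (- d l)"
      proof (rule powr_mono2')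
        show "\<kappa> * (1 + norm (v l)) \<le> norm (v l)" using v0[of l] \<eta> by (simp add: \<kappa>_def field_simps)
        show "0 < \<kappa> * (1 + norm (v l))" using \<kappa> by (intro mult_pos_pos) (auto intro: add_pos_nonneg)
      qed (use dl[of l] in simp)
      also have "\<dots> = \<kappa> powr (- d l) * (1 + norm (v l)) powr (- d l)"
        using \<kappa> by (simp add: powr_mult)
      also have "\<dots> \<le> \<kappa> powr (- D) * (1 + norm (v l)) powr (- 4)"
        using \<kappa> dl[of l] by (intro mult_mono powr_mono powr_mono') auto
      finally have p: "norm (v l) powr (- d l) \<le> \<kappa> powr (- D) * (1 + norm (v l)) powr (- 4)" .
      have q: "(2 * pi) powr d l \<le> (2 * pi) powr D"
        using dl[of l] pi_gt3 by (intro powr_mono) auto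
      have "norm (gamma_factor1 ((m + vec k) $ l) (Complex c t - \<mu>' $ l)) =
        (2 * pi) powr d l * norm (Gamma (v l) * rGamma (v l + of_real (d l)))"
        unfolding norm_gamma_factor1 by (simp add: v_def d_def)
      also have "\<dots> \<le> (2 * pi) powr D * (C1 * norm (v l) powr (- d l))"
        by (intro mult_mono q g) auto
      also have "\<dots> \<le> (2 * pi) powr D * (C1 * (\<kappa> powr (- D) * (1 + norm (v l)) powr (- 4)))"
        by (intro mult_left_mono p) (use C1 in auto)
      finally show ?thesis by (simp add: C2_def mult_ac)
    qed
    have fac1: "norm (gamma_factor1 ((m + vec k) $ l) (Complex c t - \<mu>' $ l)) \<le> max 1 C2" for l
    proof -
      have "(1 + norm (v l)) powr (- 4) \<le> (1 + norm (v l)) powr 0" by (intro powr_mono) auto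
      then have "(1 + norm (v l)) powr (- 4) \<le> 1" by (simp split: if_splits)
      then have "C2 * (1 + norm (v l)) powr (- 4) \<le> C2 * 1" using C2 by (intro mult_left_mono) auto
      then show ?thesis using fac[of l] by linarith
    qed
    have "(\<Prod>l\<in>UNIV. norm (gamma_factor1 ((m + vec k) $ l) (Complex c t - \<mu>' $ l))) =
       norm (gamma_factor1 ((m + vec k) $ l0) (Complex c t - \<mu>' $ l0)) *
       (\<Prod>l\<in>UNIV - {l0}. norm (gamma_factor1 ((m + vec k) $ l) (Complex c t - \<mu>' $ l)))"
      by (subst prod.remove[of UNIV l0]) auto
    also have "\<dots> \<le> (C2 * (1 + norm (v l0)) powr (- 4)) * (\<Prod>l\<in>UNIV - {l0}. max 1 C2)"
      using fac[of l0] C2 by (intro mult_mono prod_mono prod_nonneg) (auto intro: fac1 simp del: vector_add_component)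
    also have "\<dots> \<le> (max 1 C2 * (1 + norm (v l0)) powr (- 4)) * (\<Prod>l\<in>UNIV - {l0}. max 1 C2)"
      by (intro mult_right_mono prod_nonneg) auto
    also have "\<dots> = (max 1 C2) ^ CARD('n) * (1 + norm (v l0)) powr (- 4)"
      by (simp add: card_Diff_singleton power_eq_if)
    finally have pr: "(\<Prod>l\<in>UNIV. norm (gamma_factor1 ((m + vec k) $ l) (Complex c t - \<mu>' $ l))) \<le>
       (max 1 C2) ^ CARD('n) * (1 + norm (v l0)) powr (- 4)" .
    \<comment> \<open>|t| is controlled through Im v and |k| through Re v; the two constants are the
      factors of \<open>K\<close>.\<close>
    have "(1 + (of_int k)\<^sup>2) * (1 + t\<^sup>2) \<le> K\<^sup>2 * (1 + norm (v l0)) ^ 4"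
    proof -
      let ?V = "1 + norm (v l0)"
      have "\<bar>t\<bar> \<le> norm (v l0) + norm (\<mu>' $ l0)"
        using abs_Im_le_cmod[of "v l0"] abs_Im_le_cmod[of "\<mu>' $ l0"] by (simp add: v_def)
      moreover have "norm (\<mu>' $ l0) \<le> norm (\<mu> $ l0) + \<eta>"
        using nl[of l0] norm_triangle_sub[of "\<mu>' $ l0" "\<mu> $ l0"] by simp
      moreover have "0 \<le> \<eta> * norm (v l0)" "0 \<le> norm (\<mu> $ l0) * norm (v l0)" using \<eta> by auto
      ultimately have "1 + \<bar>t\<bar> \<le> (1 + norm (\<mu> $ l0) + \<eta>) * ?V"
        unfolding distrib_left distrib_right mult_1_left mult_1_right using \<eta> by linarith
      then have "(1 + \<bar>t\<bar>)\<^sup>2 \<le> ((1 + norm (\<mu> $ l0) + \<eta>) * ?V)\<^sup>2" by (intro power_mono) auto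
      moreover have "1 + t\<^sup>2 \<le> (1 + \<bar>t\<bar>)\<^sup>2" by (simp add: power2_sum)
      ultimately have a: "1 + t\<^sup>2 \<le> ((1 + norm (\<mu> $ l0) + \<eta>) * ?V)\<^sup>2" by linarith
      have "of_int \<bar>m $ l0 + k\<bar> \<le> 2 * (norm (v l0) + D)"
        using complex_Re_le_cmod[of "v l0"] abs_le_D1[OF dl(3)[of l0]] D0 unfolding Rev d_def by argo
      moreover have "\<bar>k\<bar> \<le> \<bar>m $ l0\<bar> + \<bar>m $ l0 + k\<bar>" by arith
      then have "real_of_int \<bar>k\<bar> \<le> of_int \<bar>m $ l0\<bar> + of_int \<bar>m $ l0 + k\<bar>"
        by (simp only: of_int_le_iff flip: of_int_add)
      ultimately have "1 + \<bar>real_of_int k\<bar> \<le> 1 + of_int \<bar>m $ l0\<bar> + 2 * norm (v l0) + 2 * D"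
        unfolding of_int_abs by argo
      also have "\<dots> \<le> (3 + of_int \<bar>m $ l0\<bar> + 2 * D) * ?V"
      proof -
        have "0 \<le> (1 + of_int \<bar>m $ l0\<bar> + 2 * D) * norm (v l0)" using D0 by (intro mult_nonneg_nonneg) auto
        then show ?thesis by (simp add: algebra_simps)
      qed
      finally have "(1 + \<bar>of_int k\<bar>)\<^sup>2 \<le> ((3 + of_int \<bar>m $ l0\<bar> + 2 * D) * ?V)\<^sup>2" by (intro power_mono) auto
      moreover have "1 + (of_int k)\<^sup>2 \<le> (1 + \<bar>of_int k :: real\<bar>)\<^sup>2" by (simp add: power2_sum)
      ultimately have b: "1 + (of_int k)\<^sup>2 \<le> ((3 + of_int \<bar>m $ l0\<bar> + 2 * D) * ?V)\<^sup>2" by linarith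
      have "(1 + (of_int k)\<^sup>2) * (1 + t\<^sup>2) \<le> ((3 + of_int \<bar>m $ l0\<bar> + 2 * D) * ?V)\<^sup>2 * ((1 + norm (\<mu> $ l0) + \<eta>) * ?V)\<^sup>2"
        by (intro mult_mono a b) auto
      also have "\<dots> = K\<^sup>2 * ?V ^ 4" unfolding K_def by (simp add: power_mult_distrib power2_eq_square power4_eq_xxxx mult_ac)
      finally show ?thesis .
    qed
    moreover have V: "1 + norm (v l0) > 0" by (auto intro: add_pos_nonneg)
    moreover have "0 < (1 + (of_int k)\<^sup>2) * (1 + t\<^sup>2)" by (intro mult_pos_pos) (auto intro: add_pos_nonneg)
    ultimately have "1 / (1 + norm (v l0)) ^ 4 \<le> K\<^sup>2 / ((1 + (of_int k)\<^sup>2) * (1 + t\<^sup>2))"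
      by (simp add: field_simps)
    moreover have "(1 + norm (v l0)) powr (- 4) = 1 / (1 + norm (v l0)) ^ 4"
      using V by (simp add: powr_minus divide_inverse)
    ultimately have w: "(1 + norm (v l0)) powr (- 4) \<le> K\<^sup>2 / ((1 + (of_int k)\<^sup>2) * (1 + t\<^sup>2))" by simp
    have "norm (integrand \<mu>' (m + vec k) x (Complex c t)) \<le>
       ((max 1 C2) ^ CARD('n) * (1 + norm (v l0)) powr (- 4)) * x powr (- 2 * c)"
      unfolding norm_integrand[OF x] using pr by (simp add: mult_right_mono)
    also have "\<dots> \<le> ((max 1 C2) ^ CARD('n) * (K\<^sup>2 / ((1 + (of_int k)\<^sup>2) * (1 + t\<^sup>2)))) * x powr (- 2 * c)"
      by (intro mult_right_mono mult_left_mono w) auto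
    finally show "norm (integrand \<mu>' (m + vec k) x (Complex c t)) \<le>
      (max 1 C2) ^ CARD('n) * K\<^sup>2 * x powr (- 2 * c) / ((1 + (of_int k)\<^sup>2) * (1 + t\<^sup>2))" by simp
  qed (use K x in \<open>auto intro!: mult_pos_pos\<close>)
qed

text \<open>Large |Im s| alone keeps s away from the poles. The exponents \<open>- d l\<close>, that
  is 2 (Re s - Re \<mu>_l) - 1, add up to 2 n Re s - n because the entries of \<mu> sum to
  0.\<close>

lemma integrand_strip_bound:
  fixes \<mu> :: "complex ^ 'n" and m :: "int ^ 'n" and x a b :: real
  assumes x: "x > 0" and sum0: "(\<Sum>l\<in>UNIV. \<mu> $ l) = 0"
  obtains C T where "C > 0" "T \<ge> 1" and "\<And>s. a \<le> Re s \<Longrightarrow> Re s \<le> b \<Longrightarrow> \<bar>Im s\<bar> \<ge> T \<Longrightarrow>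
     norm (integrand \<mu> m x s) \<le> C * \<bar>Im s\<bar> powr (2 * real CARD('n) * Re s - real CARD('n))"
proof -
  define N where "N = (\<Sum>l\<in>UNIV. norm (\<mu> $ l))"
  have Nl: "norm (\<mu> $ l) \<le> N" for l
    unfolding N_def using member_le_sum[of l UNIV "\<lambda>l. norm (\<mu> $ l)"] by simp
  have N0: "N \<ge> 0" unfolding N_def by (intro sum_nonneg) auto
  define N' where "N' = (\<Sum>l\<in>UNIV. of_int \<bar>m $ l\<bar> :: real)"
  have N'l: "of_int \<bar>m $ l\<bar> \<le> N'" for l
    unfolding N'_def using member_le_sum[of l UNIV "\<lambda>l. of_int \<bar>m $ l\<bar> :: real"] by simp
  have N'0: "N' \<ge> 0" unfolding N'_def by (intro sum_nonneg) auto
  define D where "D = 1 + 2 * (\<bar>a\<bar> + \<bar>b\<bar> + N)"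
  have D0: "D \<ge> 1" unfolding D_def using N0 by simp
  then have D0': "D \<ge> 0" by simp
  \<comment> \<open>Makes |Im \<mu>_l| at most half of |Im s|, so that |v| is comparable to |Im
    s|.\<close>
  define T where "T = 2 * (N + 1)"
  define K where "K = D + 2 + N' + N"
  have K1: "K \<ge> 2" using D0 N'0 N0 by (simp add: K_def)
  obtain C1 where C1: "C1 > 0" and C1b: "\<And>v \<delta>. Re v \<ge> - D \<Longrightarrow> (\<And>k::nat. norm (v + of_nat k) \<ge> 1) \<Longrightarrow> \<bar>\<delta>\<bar> \<le> D \<Longrightarrow>
     norm (Gamma v * rGamma (v + complex_of_real \<delta>)) \<le> C1 * norm v powr (- \<delta>)"
    by (rule norm_Gamma_quotient_le[OF zero_less_one D0', of D]) (rule that; blast)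
  define C2 where "C2 = (2 * pi) powr D * C1 * K powr D"
  \<comment> \<open>Majorant of x^(-2 Re s) on the strip, whether x is below or above 1.\<close>
  define X where "X = exp (2 * (\<bar>a\<bar> + \<bar>b\<bar>) * \<bar>ln x\<bar>)"
  have C2: "C2 > 0" unfolding C2_def using C1 K1 by simp
  show thesis
  proof (rule that[of "C2 ^ CARD('n) * X" T])
    fix s assume s: "a \<le> Re s" "Re s \<le> b" "\<bar>Im s\<bar> \<ge> T"
    have Ims: "\<bar>Im s\<bar> \<ge> 2" using s(3) N0 by (simp add: T_def)
    have Res: "\<bar>Re s\<bar> \<le> \<bar>a\<bar> + \<bar>b\<bar>" using s by linarith
    define v where "v l = s - \<mu> $ l + of_int \<bar>m $ l\<bar> / 2" for l
    define d where "d l = 1 - 2 * (Re s - Re (\<mu> $ l))" for l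
    have Rem: "\<bar>Re (\<mu> $ l)\<bar> \<le> N" "\<bar>Im (\<mu> $ l)\<bar> \<le> N" for l
      using abs_Re_le_cmod[of "\<mu> $ l"] abs_Im_le_cmod[of "\<mu> $ l"] Nl[of l] by auto
    have dl: "\<bar>d l\<bar> \<le> D" for l using abs_le_D1[OF Res] abs_le_D2[OF Res] abs_le_D1[OF Rem(1)[of l]] abs_le_D2[OF Rem(1)[of l]]
    unfolding d_def D_def by (intro abs_leI) (simp_all add: algebra_simps)
    have Imv: "\<bar>Im (v l)\<bar> \<ge> \<bar>Im s\<bar> / 2" for l
    proof -
    have "\<bar>Im s\<bar> \<le> \<bar>Im s - Im (\<mu> $ l)\<bar> + \<bar>Im (\<mu> $ l)\<bar>" by linarith
    then show ?thesis using s(3) Rem(2)[of l] N0 by (simp add: v_def T_def)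
  qed
    have vk: "norm (v l + of_nat j) \<ge> 1" for l and j :: nat
      using Imv[of l] Ims abs_Im_le_cmod[of "v l + of_nat j"] by simp
    have Rev: "\<bar>Re (v l)\<bar> \<le> D + N'" for l
      using Res Rem(1)[of l] N'l[of l] N0 by (simp add: v_def D_def)
    have Rev2: "Re (v l) \<ge> - D" for l
    proof -
      have "Re (v l) = Re s - Re (\<mu> $ l) + of_int \<bar>m $ l\<bar> / 2" by (simp add: v_def)
      moreover have "0 \<le> real_of_int \<bar>m $ l\<bar>" by simp
      ultimately show ?thesis using abs_le_D2[OF Res] abs_le_D1[OF Rem(1)[of l]] N0 unfolding D_def by argo
    qed
    have vs: "norm (v l) \<le> K * \<bar>Im s\<bar>" "\<bar>Im s\<bar> \<le> K * norm (v l)" for l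
    proof -
      have "norm (v l) \<le> \<bar>Re (v l)\<bar> + \<bar>Im (v l)\<bar>" by (rule cmod_le)
      also have "\<dots> \<le> (D + N' + N) * 1 + \<bar>Im s\<bar>" using Rev[of l] Rem(2)[of l] by (simp add: v_def)
      also have "\<dots> \<le> (D + N' + N) * \<bar>Im s\<bar> + \<bar>Im s\<bar>" using Ims D0 N0 N'0
        by (intro add_right_mono mult_left_mono) auto
      finally show "norm (v l) \<le> K * \<bar>Im s\<bar>" unfolding K_def by (simp add: algebra_simps)
      have "\<bar>Im s\<bar> \<le> 2 * norm (v l)" using Imv[of l] abs_Im_le_cmod[of "v l"] by linarith
      also have "\<dots> \<le> K * norm (v l)" using K1 by (intro mult_right_mono) auto
      finally show "\<bar>Im s\<bar> \<le> K * norm (v l)" .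
    qed
    have fac: "norm (gamma_factor1 (m $ l) (s - \<mu> $ l)) \<le> C2 * \<bar>Im s\<bar> powr (- d l)" for l
    proof -
      note g = C1b[OF Rev2 vk dl]
      have v0: "norm (v l) > 0" using vk[of l 0] by (metis add.right_neutral of_nat_0 less_le_trans zero_less_one)
      have "norm (v l) powr (- d l) \<le> K powr D * \<bar>Im s\<bar> powr (- d l)"
      \<comment> \<open>|v| and |Im s| agree up to the factor \<open>K\<close>; the sign of the
        exponent decides which of the two comparisons is used.\<close>
      proof (cases "d l \<ge> 0")
        case True
        have "norm (v l) powr (- d l) \<le> (\<bar>Im s\<bar> / K) powr (- d l)"
          using True vs(2)[of l] K1 Ims by (intro powr_mono2') (auto simp: field_simps)
        also have "\<dots> = K powr (d l) * \<bar>Im s\<bar> powr (- d l)"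
          using K1 Ims by (simp add: powr_divide powr_minus field_simps)
        also have "\<dots> \<le> K powr D * \<bar>Im s\<bar> powr (- d l)"
          using dl[of l] K1 by (intro mult_right_mono powr_mono) auto
        finally show ?thesis .
      next
        case False
        have "norm (v l) powr (- d l) \<le> (K * \<bar>Im s\<bar>) powr (- d l)"
          using False vs(1)[of l] by (intro powr_mono2) auto
        also have "\<dots> = K powr (- d l) * \<bar>Im s\<bar> powr (- d l)"
          using K1 by (simp add: powr_mult)
        also have "\<dots> \<le> K powr D * \<bar>Im s\<bar> powr (- d l)"
          using dl[of l] K1 by (intro mult_right_mono powr_mono) auto
        finally show ?thesis .
      qed
      note p = this
      have q: "(2 * pi) powr d l \<le> (2 * pi) powr D"
        using dl[of l] pi_gt3 by (intro powr_mono) auto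
      have "norm (gamma_factor1 (m $ l) (s - \<mu> $ l)) =
        (2 * pi) powr d l * norm (Gamma (v l) * rGamma (v l + of_real (d l)))"
        unfolding norm_gamma_factor1 by (simp add: v_def d_def)
      also have "\<dots> \<le> (2 * pi) powr D * (C1 * norm (v l) powr (- d l))"
        by (intro mult_mono q g) auto
      also have "\<dots> \<le> (2 * pi) powr D * (C1 * (K powr D * \<bar>Im s\<bar> powr (- d l)))"
        by (intro mult_left_mono p) (use C1 in auto)
      finally show ?thesis by (simp add: C2_def mult_ac)
    qed
    have "(\<Prod>l\<in>UNIV. norm (gamma_factor1 (m $ l) (s - \<mu> $ l))) \<le> (\<Prod>l\<in>UNIV. C2 * \<bar>Im s\<bar> powr (- d l))"
      by (intro prod_mono) (auto intro: fac)
    also have "\<dots> = C2 ^ CARD('n) * \<bar>Im s\<bar> powr (\<Sum>l\<in>UNIV. - d l)"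
      using Ims by (subst powr_sum) (auto simp: prod.distrib)
    also have "(\<Sum>l\<in>UNIV. - d l) = 2 * real CARD('n) * Re s - real CARD('n)"
    proof -
      have "(\<Sum>l\<in>UNIV. Re (\<mu> $ l)) = 0" using sum0 by (simp flip: Re_sum)
      then show ?thesis by (simp add: d_def sum_subtractf flip: sum_distrib_left)
    qed
    finally have pr: "(\<Prod>l\<in>UNIV. norm (gamma_factor1 (m $ l) (s - \<mu> $ l))) \<le>
      C2 ^ CARD('n) * \<bar>Im s\<bar> powr (2 * real CARD('n) * Re s - real CARD('n))" .
    have "x powr (- 2 * Re s) \<le> X"
    proof -
      have "(- 2 * Re s) * ln x \<le> \<bar>(- 2 * Re s) * ln x\<bar>" by simp
      also have "\<dots> = 2 * \<bar>Re s\<bar> * \<bar>ln x\<bar>" by (simp add: abs_mult)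
      also have "\<dots> \<le> 2 * (\<bar>a\<bar> + \<bar>b\<bar>) * \<bar>ln x\<bar>" using Res by (intro mult_right_mono mult_left_mono) auto
      finally show ?thesis using x by (simp add: X_def powr_def)
    qed
    then have "norm (integrand \<mu> m x s) \<le>
      (C2 ^ CARD('n) * \<bar>Im s\<bar> powr (2 * real CARD('n) * Re s - real CARD('n))) * X"
      unfolding norm_integrand[OF x] using C2 by (intro mult_mono pr) auto
    then show "norm (integrand \<mu> m x s) \<le>
      C2 ^ CARD('n) * X * \<bar>Im s\<bar> powr (2 * real CARD('n) * Re s - real CARD('n))" by (simp add: mult_ac)
  qed (use C2 N0 in \<open>auto simp: X_def T_def\<close>)
qed

section \<open>Poles, holomorphy and the unit shift of the integrand\<close>

lemma poles_iff: "s \<in> poles \<mu> m \<longleftrightarrow> (\<exists>l. s - \<mu> $ l + of_int \<bar>m $ l\<bar> / 2 \<in> \<int>\<^sub>\<le>\<^sub>0)"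
proof
  assume "s \<in> poles \<mu> m"
  then obtain l a where "s = \<mu> $ l - of_int \<bar>m $ l\<bar> / 2 - of_nat a" by (auto simp: poles_def)
  then have "s - \<mu> $ l + of_int \<bar>m $ l\<bar> / 2 = - of_nat a" by simp
  then show "\<exists>l. s - \<mu> $ l + of_int \<bar>m $ l\<bar> / 2 \<in> \<int>\<^sub>\<le>\<^sub>0" by (metis minus_of_nat_in_nonpos_Ints)
next
  assume "\<exists>l. s - \<mu> $ l + of_int \<bar>m $ l\<bar> / 2 \<in> \<int>\<^sub>\<le>\<^sub>0"
  then obtain l a where "s - \<mu> $ l + of_int \<bar>m $ l\<bar> / 2 = - of_nat a" by (auto elim: nonpos_Ints_cases')
  then have "s = \<mu> $ l - of_int \<bar>m $ l\<bar> / 2 - of_nat a" by (simp add: algebra_simps)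
  then show "s \<in> poles \<mu> m" by (auto simp: poles_def)
qed

text \<open>With powers written as \<open>exp\<close> and division by Gamma as
  \<open>rGamma\<close>, every factor except the numerator Gamma is visibly entire in s and \<mu>;
  holomorphy and joint continuity are read off from this form.\<close>

lemma integrand_eq:
  assumes "x > 0"
  shows "integrand \<mu> m x s = (\<Prod>l\<in>UNIV. \<i> ^ nat \<bar>m $ l\<bar> * exp ((1 - 2 * (s - \<mu> $ l)) * of_real (ln (2 * pi))) *
     (Gamma (s - \<mu> $ l + of_int \<bar>m $ l\<bar> / 2) * rGamma (1 - (s - \<mu> $ l) + of_int \<bar>m $ l\<bar> / 2))) *
     exp (- 2 * s * of_real (ln x))"
  using assms pi_gt_zero
  by (simp add: integrand_def gamma_factor_def gamma_factor1_def divide_Gamma_eq powr_def Ln_of_real' del: of_real_mult)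

lemma integrand_holomorphic:
  assumes "x > 0"
  shows "integrand \<mu> m x holomorphic_on - poles \<mu> m"
  unfolding integrand_eq[OF assms] by (intro holomorphic_intros) (auto simp: poles_iff)

lemma integrand_tendsto:
  fixes f :: "'a \<Rightarrow> complex ^ 'n"
  assumes "x > 0" "(f \<longlongrightarrow> \<mu>) F" "(g \<longlongrightarrow> s) F" "s \<notin> poles \<mu> m"
  shows "((\<lambda>y. integrand (f y) m x (g y)) \<longlongrightarrow> integrand \<mu> m x s) F"
proof -
  have rG: "((\<lambda>y. rGamma (1 - (g y - f y $ l) + of_int \<bar>m $ l\<bar> / 2)) \<longlongrightarrow>
      rGamma (1 - (s - \<mu> $ l) + of_int \<bar>m $ l\<bar> / 2)) F" for l
    by (rule isCont_tendsto_compose[OF isCont_rGamma[OF continuous_ident]]) (intro tendsto_intros assms)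
  show ?thesis unfolding integrand_eq[OF assms(1)]
    by (intro tendsto_intros rG assms) (use assms(4) in \<open>auto simp: poles_iff\<close>)
qed

text \<open>The functional equation of Gamma, used once in the numerator and once in the denominator
  of each factor. Each index gains a quadratic polynomial in s in the denominator, which is why the
  integrand shrinks towards the left.\<close>

lemma integrand_shift:
  fixes \<mu> :: "complex ^ 'n"
  assumes "x > 0" "s - 1 \<notin> poles \<mu> m" "\<And>l. 1 - (s - \<mu> $ l) + of_int \<bar>m $ l\<bar> / 2 \<noteq> 0"
  shows "integrand \<mu> m x (s - 1) = integrand \<mu> m x s * of_real x ^ 2 *
     (\<Prod>l\<in>UNIV. of_real (2 * pi) ^ 2 /
        ((s - \<mu> $ l + of_int \<bar>m $ l\<bar> / 2 - 1) * (1 - (s - \<mu> $ l) + of_int \<bar>m $ l\<bar> / 2)))"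
proof -
  have G: "Gamma (s - 1 - \<mu> $ l + of_int \<bar>m $ l\<bar> / 2) =
     Gamma (s - \<mu> $ l + of_int \<bar>m $ l\<bar> / 2) / (s - \<mu> $ l + of_int \<bar>m $ l\<bar> / 2 - 1)" for l
  proof -
    have n: "s - 1 - \<mu> $ l + of_int \<bar>m $ l\<bar> / 2 \<notin> \<int>\<^sub>\<le>\<^sub>0" using assms(2) by (auto simp: poles_iff)
    then have "s - 1 - \<mu> $ l + of_int \<bar>m $ l\<bar> / 2 \<noteq> 0" by auto
    moreover have "s - \<mu> $ l + of_int \<bar>m $ l\<bar> / 2 = (s - 1 - \<mu> $ l + of_int \<bar>m $ l\<bar> / 2) + 1" by simp
    ultimately show ?thesis using Gamma_plus1[OF n] by (metis add_diff_cancel_right' nonzero_mult_div_cancel_left)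
  qed
  have r: "rGamma (1 - (s - 1 - \<mu> $ l) + of_int \<bar>m $ l\<bar> / 2) =
     rGamma (1 - (s - \<mu> $ l) + of_int \<bar>m $ l\<bar> / 2) / (1 - (s - \<mu> $ l) + of_int \<bar>m $ l\<bar> / 2)" for l
  proof -
    have "1 - (s - 1 - \<mu> $ l) + of_int \<bar>m $ l\<bar> / 2 = (1 - (s - \<mu> $ l) + of_int \<bar>m $ l\<bar> / 2) + 1" by simp
    then show ?thesis
      using rGamma_plus1[of "1 - (s - \<mu> $ l) + of_int \<bar>m $ l\<bar> / 2"] assms(3)[of l]
      by (metis nonzero_mult_div_cancel_left)
  qed
  have e: "exp ((1 - 2 * (s - 1 - \<mu> $ l)) * of_real (ln (2 * pi))) =
     exp ((1 - 2 * (s - \<mu> $ l)) * of_real (ln (2 * pi))) * of_real (2 * pi) ^ 2" for l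
  proof -
    have "exp (2 * complex_of_real (ln (2 * pi))) = of_real (2 * pi) ^ 2"
      unfolding exp_double exp_of_real by simp
    moreover have "(1 - 2 * (s - 1 - \<mu> $ l)) * of_real (ln (2 * pi)) =
      (1 - 2 * (s - \<mu> $ l)) * of_real (ln (2 * pi)) + 2 * of_real (ln (2 * pi))" by (simp add: algebra_simps)
    ultimately show ?thesis by (simp only: exp_add)
  qed
  have ex: "exp (- 2 * (s - 1) * of_real (ln x)) = exp (- 2 * s * of_real (ln x)) * of_real x ^ 2"
  proof -
    have "exp (2 * complex_of_real (ln x)) = of_real x ^ 2"
      using assms(1) unfolding exp_double exp_of_real by simp
    moreover have "- 2 * (s - 1) * of_real (ln x) = - 2 * s * of_real (ln x) + 2 * of_real (ln x)" by (simp add: algebra_simps)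
    ultimately show ?thesis by (simp only: exp_add)
  qed
  show ?thesis unfolding integrand_eq[OF assms(1)] ex G r e
    by (simp add: prod.distrib prod_dividef mult_ac)
qed

lemma finite_poles_right: "finite (poles \<mu> m \<inter> {s. Re s > c})" for \<mu> :: "complex ^ 'n"
proof -
  have "poles \<mu> m \<inter> {s. Re s > c} \<subseteq>
    (\<Union>l. (\<lambda>a. \<mu> $ l - of_int \<bar>m $ l\<bar> / 2 - of_nat a) ` {..nat \<lceil>Re (\<mu> $ l) - of_int \<bar>m $ l\<bar> / 2 - c\<rceil>})"
  proof
    fix s assume "s \<in> poles \<mu> m \<inter> {s. Re s > c}"
    then obtain l a where s: "s = \<mu> $ l - of_int \<bar>m $ l\<bar> / 2 - of_nat a" "Re s > c" by (auto simp: poles_def)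
    then have "real a < Re (\<mu> $ l) - of_int \<bar>m $ l\<bar> / 2 - c" by simp
    then have "a \<le> nat \<lceil>Re (\<mu> $ l) - of_int \<bar>m $ l\<bar> / 2 - c\<rceil>" by linarith
    then show "s \<in> (\<Union>l. (\<lambda>a. \<mu> $ l - of_int \<bar>m $ l\<bar> / 2 - of_nat a) ` {..nat \<lceil>Re (\<mu> $ l) - of_int \<bar>m $ l\<bar> / 2 - c\<rceil>})"
      using s by auto
  qed
  then show ?thesis by (rule finite_subset) auto
qed

subsection \<open>Infinite contours\<close>

text \<open>Dominated convergence for truncations to [-n, n]; it leads from the closed curves of the
  residue theorem to infinite contours.\<close>

lemma integral_truncate_tendsto:
  fixes f :: "real \<Rightarrow> complex"
  assumes "f absolutely_integrable_on S" "S \<in> sets lebesgue"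
  shows "(\<lambda>n. integral (S \<inter> {- real n..real n}) f) \<longlonglongrightarrow> integral S f"
proof -
  have fn: "(\<lambda>x. norm (f x)) integrable_on S" using assms(1) by (simp add: absolutely_integrable_on_def)
  have i: "f absolutely_integrable_on (S \<inter> {- real n..real n})" for n
    by (rule set_integrable_subset[OF assms(1)]) (use assms(2) in auto)
  define g where "g n x = (if x \<in> {- real n..real n} then f x else 0)" for n x
  have gi: "g n integrable_on S" for n
    using i[of n] unfolding g_def integrable_restrict_Int by (simp add: absolutely_integrable_on_def Int_commute)
  have "(\<lambda>n. integral S (g n)) \<longlonglongrightarrow> integral S f"
  proof (rule dominated_convergence(2)[OF gi fn])
    show "norm (g n x) \<le> norm (f x)" for n x by (simp add: g_def)
    fix x
    have "\<forall>\<^sub>F n in sequentially. g n x = f x"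
      using eventually_ge_at_top[of "nat \<lceil>\<bar>x\<bar>\<rceil>"]
    proof eventually_elim
      case (elim n)
      then have "\<bar>x\<bar> \<le> real n" by linarith
      then show ?case by (auto simp: g_def)
    qed
    then show "(\<lambda>n. g n x) \<longlonglongrightarrow> f x" by (rule tendsto_eventually)
  qed
  moreover have "integral S (g n) = integral (S \<inter> {- real n..real n}) f" for n
    unfolding g_def integral_restrict_Int by (simp add: Int_commute)
  ultimately show ?thesis by simp
qed

section \<open>Winding numbers of closed-up contours and the contour shift\<close>

lemma closed_segment_horizontal:
  "z \<in> closed_segment (Complex a y) (Complex b y) \<longleftrightarrow> Im z = y \<and> Re z \<in> closed_segment a b"
  by (subst closed_segment_same_Im) auto

lemma closed_segment_vertical:
  "z \<in> closed_segment (Complex x a) (Complex x b) \<longleftrightarrow> Re z = x \<and> Im z \<in> closed_segment a b"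
  by (subst closed_segment_same_Re) auto

text \<open>The left edge of the rectangle in \<open>closed_up\<close> is moved to a fixed abscissa \<open>c\<close>.\<close>

definition cut_off :: "real \<Rightarrow> real \<Rightarrow> (real \<Rightarrow> complex) \<Rightarrow> real \<Rightarrow> real \<Rightarrow> real \<Rightarrow> complex" where
  "cut_off \<sigma> T p c R =
     linepath (Complex \<sigma> (- R)) (Complex \<sigma> (- T)) +++ p +++
     linepath (Complex \<sigma> T) (Complex \<sigma> R) +++
     linepath (Complex \<sigma> R) (Complex c R) +++
     linepath (Complex c R) (Complex c (- R)) +++
     linepath (Complex c (- R)) (Complex \<sigma> (- R))"

text \<open>The two closed curves differ by the boundary of the rectangle between the abscissas -R
  and c. It lies in the half-plane Re \<le> c, so it does not wind around w. The left edge has to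
  stay at c for its integral to converge to one over a fixed line.\<close>

lemma winding_number_cut_off:
  assumes p: "valid_path p" "pathstart p = Complex \<sigma> (- T)" "pathfinish p = Complex \<sigma> T"
    and c: "c < \<sigma>" "c < Re w" and R: "R > T" "T > 0" "- R < c"
    and w: "w \<notin> path_image (closed_up \<sigma> T p R)"
  shows "w \<notin> path_image (cut_off \<sigma> T p c R)"
    and "winding_number (cut_off \<sigma> T p c R) w = winding_number (closed_up \<sigma> T p R) w"
proof -
  note pp = valid_path_imp_path[OF p(1)]
  have im: "path_image (closed_up \<sigma> T p R) =
     closed_segment (Complex \<sigma> (- R)) (Complex \<sigma> (- T)) \<union> path_image p \<union>
     closed_segment (Complex \<sigma> T) (Complex \<sigma> R) \<union>
     closed_segment (Complex \<sigma> R) (Complex (- R) R) \<union>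
     closed_segment (Complex (- R) R) (Complex (- R) (- R)) \<union>
     closed_segment (Complex (- R) (- R)) (Complex \<sigma> (- R))"
    unfolding closed_up_def by (simp add: path_image_join p Un_assoc)
  have n1: "w \<notin> closed_segment (Complex \<sigma> (- R)) (Complex \<sigma> (- T))"
    and n2: "w \<notin> path_image p" and n3: "w \<notin> closed_segment (Complex \<sigma> T) (Complex \<sigma> R)"
    and n4: "w \<notin> closed_segment (Complex \<sigma> R) (Complex (- R) R)"
    and n5: "w \<notin> closed_segment (Complex (- R) R) (Complex (- R) (- R))"
    and n6: "w \<notin> closed_segment (Complex (- R) (- R)) (Complex \<sigma> (- R))"
    using w unfolding im by auto
  have m4: "Complex c R \<in> closed_segment (Complex \<sigma> R) (Complex (- R) R)"
    and m6: "Complex c (- R) \<in> closed_segment (Complex (- R) (- R)) (Complex \<sigma> (- R))"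
    using c R by (auto simp: closed_segment_horizontal closed_segment_eq_real_ivl)
  have s4: "closed_segment (Complex \<sigma> R) (Complex c R) \<subseteq> closed_segment (Complex \<sigma> R) (Complex (- R) R)"
     "closed_segment (Complex c R) (Complex (- R) R) \<subseteq> closed_segment (Complex \<sigma> R) (Complex (- R) R)"
    and s6: "closed_segment (Complex (- R) (- R)) (Complex c (- R)) \<subseteq> closed_segment (Complex (- R) (- R)) (Complex \<sigma> (- R))"
    "closed_segment (Complex c (- R)) (Complex \<sigma> (- R)) \<subseteq> closed_segment (Complex (- R) (- R)) (Complex \<sigma> (- R))"
    using m4 m6 by (auto simp: subset_closed_segment)
  have n7: "w \<notin> closed_segment (Complex c R) (Complex c (- R))"
    using c by (auto simp: closed_segment_vertical)
  have n8: "w \<notin> closed_segment (Complex \<sigma> R) (Complex c R)" "w \<notin> closed_segment (Complex c R) (Complex (- R) R)"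
    "w \<notin> closed_segment (Complex (- R) (- R)) (Complex c (- R))" "w \<notin> closed_segment (Complex c (- R)) (Complex \<sigma> (- R))"
    using n4 n6 s4 s6 by auto
  show "w \<notin> path_image (cut_off \<sigma> T p c R)"
    unfolding cut_off_def using n1 n2 n3 n7 n8 by (simp add: path_image_join p)
  \<comment> \<open>Counterclockwise boundary of the removed rectangle; its right edge cancels the
    left edge of \<open>cut_off\<close>.\<close>
  let ?Q = "linepath (Complex c R) (Complex (- R) R) +++ linepath (Complex (- R) R) (Complex (- R) (- R)) +++
     linepath (Complex (- R) (- R)) (Complex c (- R)) +++ linepath (Complex c (- R)) (Complex c R)"
  have "winding_number ?Q w = 0"
  proof (rule winding_number_zero_outside[of _ "{z. Re z \<le> c}"])
    show "path_image ?Q \<subseteq> {z. Re z \<le> c}"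
      using R by (auto simp: path_image_join closed_segment_horizontal closed_segment_vertical closed_segment_eq_real_ivl)
  qed (use c in \<open>auto simp: convex_halfspace_Re_le closed_halfspace_Re_le\<close>)
  moreover have "winding_number ?Q w = winding_number (linepath (Complex c R) (Complex (- R) R)) w +
     winding_number (linepath (Complex (- R) R) (Complex (- R) (- R))) w +
     winding_number (linepath (Complex (- R) (- R)) (Complex c (- R))) w +
     winding_number (linepath (Complex c (- R)) (Complex c R)) w"
    using n5 n7 n8 by (simp add: winding_number_join path_image_join closed_segment_commute)
  moreover have "winding_number (linepath (Complex c (- R)) (Complex c R)) w =
      - winding_number (linepath (Complex c R) (Complex c (- R))) w"
    using winding_number_reversepath[of "linepath (Complex c R) (Complex c (- R))" w] n7 by simp
  moreover have "winding_number (linepath (Complex \<sigma> R) (Complex (- R) R)) w =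
     winding_number (linepath (Complex \<sigma> R) (Complex c R)) w + winding_number (linepath (Complex c R) (Complex (- R) R)) w"
    by (rule winding_number_split_linepath[OF m4 n4])
  moreover have "winding_number (linepath (Complex (- R) (- R)) (Complex \<sigma> (- R))) w =
     winding_number (linepath (Complex (- R) (- R)) (Complex c (- R))) w + winding_number (linepath (Complex c (- R)) (Complex \<sigma> (- R))) w"
    by (rule winding_number_split_linepath[OF m6 n6])
  moreover have "winding_number (closed_up \<sigma> T p R) w =
     winding_number (linepath (Complex \<sigma> (- R)) (Complex \<sigma> (- T))) w + winding_number p w +
     winding_number (linepath (Complex \<sigma> T) (Complex \<sigma> R)) w +
     winding_number (linepath (Complex \<sigma> R) (Complex (- R) R)) w +
     winding_number (linepath (Complex (- R) R) (Complex (- R) (- R))) w +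
     winding_number (linepath (Complex (- R) (- R)) (Complex \<sigma> (- R))) w"
    unfolding closed_up_def using n1 n2 n3 n4 n5 n6 pp p by (simp add: winding_number_join path_image_join)
  moreover have "winding_number (cut_off \<sigma> T p c R) w =
     winding_number (linepath (Complex \<sigma> (- R)) (Complex \<sigma> (- T))) w + winding_number p w +
     winding_number (linepath (Complex \<sigma> T) (Complex \<sigma> R)) w +
     winding_number (linepath (Complex \<sigma> R) (Complex c R)) w +
     winding_number (linepath (Complex c R) (Complex c (- R))) w +
     winding_number (linepath (Complex c (- R)) (Complex \<sigma> (- R))) w"
    unfolding cut_off_def using n1 n2 n3 n7 n8 pp p by (simp add: winding_number_join path_image_join)
  ultimately show "winding_number (cut_off \<sigma> T p c R) w = winding_number (closed_up \<sigma> T p R) w"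
    by (simp add: algebra_simps)
qed

text \<open>The residue theorem on \<open>cut_off\<close> with R tending to infinity: the horizontal
  edges disappear by \<open>hor\<close>, the vertical pieces become integrals over the rays and the
  line. The edge at c is traversed downwards, so the line integral changes sign when it is moved to
  the right-hand side. The half-plane Re > c' provides an open convex domain around the
  curve.\<close>

lemma infinite_contour_integral_eq_residues:
  fixes f :: "complex \<Rightarrow> complex"
  assumes holo: "f holomorphic_on {s. Re s > c'} - A" and A: "finite A" "\<And>w. w \<in> A \<Longrightarrow> Re w > c"
    and c: "c' < c" "c < \<sigma>" and T: "T > 0"
    and p: "valid_path p" "pathstart p = Complex \<sigma> (- T)" "pathfinish p = Complex \<sigma> T"
    and pc: "\<And>s. s \<in> path_image p \<Longrightarrow> Re s > c'"
    and left: "\<And>w. w \<in> A \<Longrightarrow> left_of_contour \<sigma> T p w"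
    and rays: "(\<lambda>t. f (Complex \<sigma> t)) absolutely_integrable_on {..- T}"
      "(\<lambda>t. f (Complex \<sigma> t)) absolutely_integrable_on {T..}"
    and line: "(\<lambda>t. f (Complex c t)) absolutely_integrable_on UNIV"
    and hor: "\<And>\<epsilon>. \<epsilon> > 0 \<Longrightarrow> \<forall>\<^sub>F R in at_top. \<forall>r\<in>{c..\<sigma>}. norm (f (Complex r R)) \<le> \<epsilon> \<and> norm (f (Complex r (- R))) \<le> \<epsilon>"
  shows "infinite_contour_integral \<sigma> T p f =
     2 * pi * \<i> * (\<Sum>w\<in>A. residue f w) + \<i> * integral UNIV (\<lambda>t. f (Complex c t))"
proof -
  define S where "S = {s. Re s > c'} - A"
  have oS: "open S" unfolding S_def using A(1) by (intro open_Diff finite_imp_closed open_halfspace_Re_gt)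
  have hS: "f holomorphic_on S" using holo by (simp add: S_def)
  define h1 where "h1 R = contour_integral (linepath (Complex \<sigma> R) (Complex c R)) f" for R
  define h2 where "h2 R = contour_integral (linepath (Complex c (- R)) (Complex \<sigma> (- R))) f" for R
  define good where "good R \<longleftrightarrow> R > T \<and> - R < c \<and>
    (\<forall>w\<in>A. w \<notin> path_image (closed_up \<sigma> T p R) \<and> winding_number (closed_up \<sigma> T p R) w = 1)" for R
  have evgood: "\<forall>\<^sub>F R in at_top. good R"
  proof -
    have "\<forall>\<^sub>F R in at_top. \<forall>w\<in>A. w \<notin> path_image (closed_up \<sigma> T p R) \<and> winding_number (closed_up \<sigma> T p R) w = 1"
      using left A(1) by (intro eventually_ball_finite) (auto simp: left_of_contour_def)
    then show ?thesis unfolding good_def using eventually_gt_at_top[of T] eventually_gt_at_top[of "- c"]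
      by eventually_elim auto
  qed
  have main: "2 * pi * \<i> * (\<Sum>w\<in>A. residue f w) =
      \<i> * integral {- R..- T} (\<lambda>t. f (Complex \<sigma> t)) + contour_integral p f +
      \<i> * integral {T..R} (\<lambda>t. f (Complex \<sigma> t)) + h1 R + h2 R -
      \<i> * integral {- R..R} (\<lambda>t. f (Complex c t))
      \<and> closed_segment (Complex \<sigma> R) (Complex c R) \<subseteq> S \<and> closed_segment (Complex c (- R)) (Complex \<sigma> (- R)) \<subseteq> S"
    if "good R" for R
  proof -
    have R: "R > T" "- R < c" using that by (auto simp: good_def)
    have w: "w \<notin> path_image (cut_off \<sigma> T p c R)" "winding_number (cut_off \<sigma> T p c R) w = 1" if "w \<in> A" for w
      using winding_number_cut_off[OF p c(2) A(2)[OF that] R(1) T R(2)] \<open>good R\<close> that by (auto simp: good_def)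
    have im: "path_image (cut_off \<sigma> T p c R) =
       closed_segment (Complex \<sigma> (- R)) (Complex \<sigma> (- T)) \<union> path_image p \<union>
       closed_segment (Complex \<sigma> T) (Complex \<sigma> R) \<union>
       closed_segment (Complex \<sigma> R) (Complex c R) \<union>
       closed_segment (Complex c R) (Complex c (- R)) \<union>
       closed_segment (Complex c (- R)) (Complex \<sigma> (- R))"
      unfolding cut_off_def by (simp add: path_image_join p Un_assoc)
    have "path_image (cut_off \<sigma> T p c R) \<subseteq> {s. Re s > c'}"
      unfolding im using c pc
      by (auto simp: closed_segment_horizontal closed_segment_vertical closed_segment_eq_real_ivl)
    then have sub: "path_image (cut_off \<sigma> T p c R) \<subseteq> S" unfolding S_def using w by auto
    have vp: "valid_path (cut_off \<sigma> T p c R)" unfolding cut_off_def using p by (simp add: valid_path_join)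
    have "contour_integral (cut_off \<sigma> T p c R) f =
        2 * pi * \<i> * (\<Sum>w\<in>A. winding_number (cut_off \<sigma> T p c R) w * residue f w)"
    proof (rule Residue_theorem[of "{s. Re s > c'}"])
      show "\<forall>z. z \<notin> {s. c' < Re s} \<longrightarrow> winding_number (cut_off \<sigma> T p c R) z = 0"
      proof (intro allI impI winding_number_zero_outside)
        show "convex {s. c' < Re s}" by (rule convex_halfspace_Re_gt)
      qed (use vp sub in \<open>auto simp: S_def valid_path_imp_path cut_off_def\<close>)
    qed (use A vp sub holo in \<open>auto simp: S_def open_halfspace_Re_gt cut_off_def
           intro!: convex_connected convex_halfspace_Re_gt\<close>)
    also have "(\<Sum>w\<in>A. winding_number (cut_off \<sigma> T p c R) w * residue f w) = (\<Sum>w\<in>A. residue f w)"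
      using w by simp
    finally have r: "contour_integral (cut_off \<sigma> T p c R) f = 2 * pi * \<i> * (\<Sum>w\<in>A. residue f w)" .
    have ci: "f contour_integrable_on g" if "valid_path g" "path_image g \<subseteq> S" for g
      using contour_integrable_holomorphic_simple[OF hS oS that] .
    have sub': "closed_segment (Complex \<sigma> (- R)) (Complex \<sigma> (- T)) \<subseteq> S" "path_image p \<subseteq> S"
       "closed_segment (Complex \<sigma> T) (Complex \<sigma> R) \<subseteq> S"
       "closed_segment (Complex \<sigma> R) (Complex c R) \<subseteq> S"
       "closed_segment (Complex c R) (Complex c (- R)) \<subseteq> S"
       "closed_segment (Complex c (- R)) (Complex \<sigma> (- R)) \<subseteq> S"
      using sub unfolding im by auto
    have "contour_integral (cut_off \<sigma> T p c R) f =
       contour_integral (linepath (Complex \<sigma> (- R)) (Complex \<sigma> (- T))) f + contour_integral p f +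
       contour_integral (linepath (Complex \<sigma> T) (Complex \<sigma> R)) f + h1 R +
       contour_integral (linepath (Complex c R) (Complex c (- R))) f + h2 R"
      unfolding cut_off_def h1_def h2_def using sub' p
      by (simp add: ci contour_integrable_join valid_path_join)
    moreover have "contour_integral (linepath (Complex c R) (Complex c (- R))) f =
       - contour_integral (linepath (Complex c (- R)) (Complex c R)) f"
      using contour_integral_reversepath[of "linepath (Complex c (- R)) (Complex c R)" f] by simp
    moreover have "contour_integral (linepath (Complex c (- R)) (Complex c R)) f = \<i> * integral {- R..R} (\<lambda>t. f (Complex c t))"
      "contour_integral (linepath (Complex \<sigma> (- R)) (Complex \<sigma> (- T))) f = \<i> * integral {- R..- T} (\<lambda>t. f (Complex \<sigma> t))"
      "contour_integral (linepath (Complex \<sigma> T) (Complex \<sigma> R)) f = \<i> * integral {T..R} (\<lambda>t. f (Complex \<sigma> t))"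
      using R T by (auto intro!: contour_integral_linepath_same_Re)
    ultimately show ?thesis using r sub' by simp
  qed
  have h: "norm (h1 R) \<le> \<epsilon> * (\<sigma> - c) \<and> norm (h2 R) \<le> \<epsilon> * (\<sigma> - c)"
    if g: "good R" and hb: "\<forall>r\<in>{c..\<sigma>}. norm (f (Complex r R)) \<le> \<epsilon> \<and> norm (f (Complex r (- R))) \<le> \<epsilon>" and \<epsilon>: "\<epsilon> > 0" for R \<epsilon>
  proof
    have ci: "f contour_integrable_on g" if "valid_path g" "path_image g \<subseteq> S" for g
      using contour_integrable_holomorphic_simple[OF hS oS that] .
    have "norm (Complex c R - Complex \<sigma> R) = \<sigma> - c" "norm (Complex \<sigma> (- R) - Complex c (- R)) = \<sigma> - c"
      using c by (auto simp: cmod_eq_Re)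
    note n = this
    show "norm (h1 R) \<le> \<epsilon> * (\<sigma> - c)" unfolding h1_def n(1)[symmetric]
    proof (rule contour_integral_bound_linepath)
      show "f contour_integrable_on linepath (Complex \<sigma> R) (Complex c R)" using main[OF g] by (intro ci) auto
      show "norm (f z) \<le> \<epsilon>" if "z \<in> closed_segment (Complex \<sigma> R) (Complex c R)" for z
        using hb that c by (cases z) (auto simp: closed_segment_horizontal closed_segment_eq_real_ivl)
    qed (use \<epsilon> in auto)
    show "norm (h2 R) \<le> \<epsilon> * (\<sigma> - c)" unfolding h2_def n(2)[symmetric]
    proof (rule contour_integral_bound_linepath)
      show "f contour_integrable_on linepath (Complex c (- R)) (Complex \<sigma> (- R))" using main[OF g] by (intro ci) auto
      show "norm (f z) \<le> \<epsilon>" if "z \<in> closed_segment (Complex c (- R)) (Complex \<sigma> (- R))" for z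
        using hb that c by (cases z) (auto simp: closed_segment_horizontal closed_segment_eq_real_ivl)
    qed (use \<epsilon> in auto)
  qed
  have hlim: "(h1 \<longlongrightarrow> 0) at_top" "(h2 \<longlongrightarrow> 0) at_top"
  proof -
    have e: "\<forall>\<^sub>F R in at_top. norm (h1 R) < e \<and> norm (h2 R) < e" if "e > 0" for e :: real
    proof -
      define \<epsilon> where "\<epsilon> = e / (2 * (\<sigma> - c))"
      have \<epsilon>: "\<epsilon> > 0" "\<epsilon> * (\<sigma> - c) < e" using c that by (auto simp: \<epsilon>_def field_simps)
      show ?thesis using hor[OF \<epsilon>(1)] evgood
        by eventually_elim (use h[OF _ _ \<epsilon>(1)] \<epsilon>(2) in \<open>meson le_less_trans\<close>)
    qed
    show "(h1 \<longlongrightarrow> 0) at_top" "(h2 \<longlongrightarrow> 0) at_top"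
      by (auto simp: tendsto_iff elim!: eventually_mono dest!: e)
  qed
  have l1: "(\<lambda>n. integral {- real n..- T} (\<lambda>t. f (Complex \<sigma> t))) \<longlonglongrightarrow> integral {..- T} (\<lambda>t. f (Complex \<sigma> t))"
  proof -
    have "{..- T} \<inter> {- real n..real n} = {- real n..- T}" for n using T by auto
    moreover have "{..- T} \<in> sets lebesgue" by simp
    ultimately show ?thesis using integral_truncate_tendsto[OF rays(1)] by (simp only:)
  qed
  have l2: "(\<lambda>n. integral {T..real n} (\<lambda>t. f (Complex \<sigma> t))) \<longlonglongrightarrow> integral {T..} (\<lambda>t. f (Complex \<sigma> t))"
  proof -
    have "{T..} \<inter> {- real n..real n} = {T..real n}" for n using T by auto
    moreover have "{T..} \<in> sets lebesgue" by simp
    ultimately show ?thesis using integral_truncate_tendsto[OF rays(2)] by (simp only:)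
  qed
  have l3: "(\<lambda>n. integral {- real n..real n} (\<lambda>t. f (Complex c t))) \<longlonglongrightarrow> integral UNIV (\<lambda>t. f (Complex c t))"
    using integral_truncate_tendsto[OF line] by simp
  have lh: "(\<lambda>n. h1 (real n)) \<longlonglongrightarrow> 0" "(\<lambda>n. h2 (real n)) \<longlonglongrightarrow> 0"
    using hlim by (auto intro: filterlim_compose filterlim_real_sequentially)
  \<comment> \<open>Along R = n this expression is eventually the constant residue sum, so its limit
    is an equation between constants.\<close>
  have "(\<lambda>n. \<i> * integral {- real n..- T} (\<lambda>t. f (Complex \<sigma> t)) + contour_integral p f +
      \<i> * integral {T..real n} (\<lambda>t. f (Complex \<sigma> t)) + h1 (real n) + h2 (real n) -
      \<i> * integral {- real n..real n} (\<lambda>t. f (Complex c t))) \<longlonglongrightarrow>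
     \<i> * integral {..- T} (\<lambda>t. f (Complex \<sigma> t)) + contour_integral p f +
      \<i> * integral {T..} (\<lambda>t. f (Complex \<sigma> t)) + 0 + 0 - \<i> * integral UNIV (\<lambda>t. f (Complex c t))"
    by (intro tendsto_intros l1 l2 l3 lh)
  moreover have "\<forall>\<^sub>F n in sequentially. \<i> * integral {- real n..- T} (\<lambda>t. f (Complex \<sigma> t)) + contour_integral p f +
      \<i> * integral {T..real n} (\<lambda>t. f (Complex \<sigma> t)) + h1 (real n) + h2 (real n) -
      \<i> * integral {- real n..real n} (\<lambda>t. f (Complex c t)) = 2 * pi * \<i> * (\<Sum>w\<in>A. residue f w)"
    using eventually_compose_filterlim[OF evgood filterlim_real_sequentially]
    by eventually_elim (use main in simp)
  ultimately have "(\<lambda>n::nat. 2 * pi * \<i> * (\<Sum>w\<in>A. residue f w)) \<longlonglongrightarrow>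
     \<i> * integral {..- T} (\<lambda>t. f (Complex \<sigma> t)) + contour_integral p f +
      \<i> * integral {T..} (\<lambda>t. f (Complex \<sigma> t)) + 0 + 0 - \<i> * integral UNIV (\<lambda>t. f (Complex c t))"
    by (rule Lim_transform_eventually)
  then have "2 * pi * \<i> * (\<Sum>w\<in>A. residue f w) = \<i> * integral {..- T} (\<lambda>t. f (Complex \<sigma> t)) + contour_integral p f +
      \<i> * integral {T..} (\<lambda>t. f (Complex \<sigma> t)) - \<i> * integral UNIV (\<lambda>t. f (Complex c t))"
    by (simp add: LIMSEQ_const_iff)
  then show ?thesis
    unfolding infinite_contour_integral_def by (simp add: algebra_simps)
qed

text \<open>
  Up to cancelling edges, a closed-up contour with a rectangular bump is the sum of two rectangles.
\<close>

lemma left_of_bump: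
  fixes \<sigma> T B :: real
  assumes T: "T > 0" and B: "\<sigma> < B" and w: "Re w < B" "Re w \<noteq> \<sigma>" "\<bar>Im w\<bar> < T"
  defines "p \<equiv> linepath (Complex \<sigma> (- T)) (Complex B (- T)) +++ linepath (Complex B (- T)) (Complex B T) +++
      linepath (Complex B T) (Complex \<sigma> T)"
  shows "left_of_contour \<sigma> T p w"
  unfolding left_of_contour_def
  using eventually_gt_at_top[of T] eventually_gt_at_top[of "- \<sigma>"] eventually_gt_at_top[of "- Re w"]
proof eventually_elim
  case (elim R)
  have s1: "valid_path p" "pathstart p = Complex \<sigma> (- T)" "pathfinish p = Complex \<sigma> T"
    unfolding p_def by (simp_all add: valid_path_join)
  have edges: "w \<notin> closed_segment (Complex \<sigma> a) (Complex \<sigma> b)" "w \<notin> closed_segment (Complex B a) (Complex B b)"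
     "w \<notin> closed_segment (Complex (- R) a) (Complex (- R) b)"
     "w \<notin> closed_segment (Complex a T) (Complex b T)" "w \<notin> closed_segment (Complex a (- T)) (Complex b (- T))"
     "w \<notin> closed_segment (Complex a R) (Complex b R)" "w \<notin> closed_segment (Complex a (- R)) (Complex b (- R))" for a b
    using w elim T by (auto simp: closed_segment_vertical closed_segment_horizontal)
  have np: "w \<notin> path_image p" unfolding p_def by (simp add: path_image_join edges)
  have not_in: "w \<notin> path_image (closed_up \<sigma> T p R)"
    unfolding closed_up_def by (simp add: path_image_join s1 edges np)
  define W where "W a b = winding_number (linepath a b) w" for a b
  have wp: "winding_number p w = W (Complex \<sigma> (- T)) (Complex B (- T)) + W (Complex B (- T)) (Complex B T) +
      W (Complex B T) (Complex \<sigma> T)"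
    unfolding p_def W_def by (simp add: winding_number_join path_image_join edges)
  have cu: "winding_number (closed_up \<sigma> T p R) w =
     W (Complex \<sigma> (- R)) (Complex \<sigma> (- T)) + winding_number p w +
     W (Complex \<sigma> T) (Complex \<sigma> R) + W (Complex \<sigma> R) (Complex (- R) R) +
     W (Complex (- R) R) (Complex (- R) (- R)) + W (Complex (- R) (- R)) (Complex \<sigma> (- R))"
    unfolding closed_up_def W_def using valid_path_imp_path[OF s1(1)] s1
    by (simp add: winding_number_join path_image_join edges np)
  have r1: "winding_number (rectpath (Complex (- R) (- R)) (Complex \<sigma> R)) w =
     W (Complex (- R) (- R)) (Complex \<sigma> (- R)) + W (Complex \<sigma> (- R)) (Complex \<sigma> R) +
     W (Complex \<sigma> R) (Complex (- R) R) + W (Complex (- R) R) (Complex (- R) (- R))"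
    unfolding rectpath_def W_def Let_def by (simp add: winding_number_join path_image_join edges)
  have r2: "winding_number (rectpath (Complex \<sigma> (- T)) (Complex B T)) w =
     W (Complex \<sigma> (- T)) (Complex B (- T)) + W (Complex B (- T)) (Complex B T) +
     W (Complex B T) (Complex \<sigma> T) + W (Complex \<sigma> T) (Complex \<sigma> (- T))"
    unfolding rectpath_def W_def Let_def by (simp add: winding_number_join path_image_join edges)
  have "W (Complex \<sigma> (- R)) (Complex \<sigma> R) = W (Complex \<sigma> (- R)) (Complex \<sigma> (- T)) + W (Complex \<sigma> (- T)) (Complex \<sigma> R)"
    unfolding W_def using elim T
    by (intro winding_number_split_linepath edges) (auto simp: closed_segment_vertical closed_segment_eq_real_ivl)
  moreover have "W (Complex \<sigma> (- T)) (Complex \<sigma> R) = W (Complex \<sigma> (- T)) (Complex \<sigma> T) + W (Complex \<sigma> T) (Complex \<sigma> R)"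
    unfolding W_def using elim T
    by (intro winding_number_split_linepath edges) (auto simp: closed_segment_vertical closed_segment_eq_real_ivl)
  moreover have "W (Complex \<sigma> T) (Complex \<sigma> (- T)) = - W (Complex \<sigma> (- T)) (Complex \<sigma> T)"
    unfolding W_def using winding_number_reversepath[of "linepath (Complex \<sigma> (- T)) (Complex \<sigma> T)" w] edges by simp
  ultimately have "winding_number (closed_up \<sigma> T p R) w =
     winding_number (rectpath (Complex (- R) (- R)) (Complex \<sigma> R)) w + winding_number (rectpath (Complex \<sigma> (- T)) (Complex B T)) w"
    unfolding cu wp r1 r2 by simp
  \<comment> \<open>Exactly one of the two rectangles contains w, according to its side of the line
    Re = \<sigma>.\<close>
  moreover have "winding_number (rectpath (Complex (- R) (- R)) (Complex \<sigma> R)) w = (if Re w < \<sigma> then 1 else 0)"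
  proof (cases "Re w < \<sigma>")
    case True
    then have "w \<in> box (Complex (- R) (- R)) (Complex \<sigma> R)" using w elim by (simp add: in_box_complex_iff) linarith
    then show ?thesis using True winding_number_rectpath by simp
  next
    case False
    then have "w \<notin> cbox (Complex (- R) (- R)) (Complex \<sigma> R)" using w by (simp add: in_cbox_complex_iff)
    then show ?thesis using False winding_number_rectpath_outside elim T by simp
  qed
  moreover have "winding_number (rectpath (Complex \<sigma> (- T)) (Complex B T)) w = (if Re w < \<sigma> then 0 else 1)"
  proof (cases "Re w < \<sigma>")
    case False
    then have "w \<in> box (Complex \<sigma> (- T)) (Complex B T)" using w by (simp add: in_box_complex_iff) linarith
    then show ?thesis using False winding_number_rectpath by simp
  next
    case True
    then have "w \<notin> cbox (Complex \<sigma> (- T)) (Complex B T)" by (simp add: in_cbox_complex_iff)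
    then show ?thesis using True winding_number_rectpath_outside B T by simp
  qed
  ultimately show ?case using not_in by simp
qed

text \<open>Without a contour the condition that defines \<open>bessel_j\<close> would hold for
  every value. A vertical line with a rectangular bump to the right works once \<sigma> avoids the
  real parts of all points that must lie on the left.\<close>

lemma exists_admissible_contour:
  fixes \<mu> :: "complex ^ 'n"
  assumes c: "c < 1 / 2 + (Re (\<Sum>l\<in>UNIV. \<mu> $ l) - 1 / 2) / real CARD('n)"
  obtains \<sigma> T p where "c < \<sigma>" "admissible_contour \<mu> m \<sigma> T p" "\<And>s. s \<in> path_image p \<Longrightarrow> c < Re s"
proof -
  define P where "P = (\<Union>l. range (\<lambda>a::nat. \<mu> $ l - of_int \<bar>m $ l\<bar> / 2 - of_nat a / 2))"
  \<comment> \<open>Only countably many abscissas are forbidden, so an open interval contains an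
    allowed one.\<close>
  have "uncountable ({c<..<1 / 2 + (Re (\<Sum>l\<in>UNIV. \<mu> $ l) - 1 / 2) / real CARD('n)} - Re ` P)"
    using c by (intro uncountable_minus_countable) (auto simp: P_def uncountable_open_interval)
  then obtain \<sigma> where \<sigma>: "c < \<sigma>" "\<sigma> < 1 / 2 + (Re (\<Sum>l\<in>UNIV. \<mu> $ l) - 1 / 2) / real CARD('n)" "\<sigma> \<notin> Re ` P"
    by (metis DiffE all_not_in_conv countable_empty greaterThanLessThan_iff)
  define N where "N = (\<Sum>l\<in>UNIV. norm (\<mu> $ l))"
  have Nl: "norm (\<mu> $ l) \<le> N" for l
    unfolding N_def using member_le_sum[of l UNIV "\<lambda>l. norm (\<mu> $ l)"] by simp
  have N0: "N \<ge> 0" unfolding N_def by (intro sum_nonneg) auto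
  \<comment> \<open>With all |\<mu>_l| \<le> N, a bump of half-height \<open>T\<close> and right
    edge \<open>B\<close> encloses every point of \<open>P\<close> to the right of \<sigma>.\<close>
  define T where "T = N + 1"
  define B where "B = N + \<bar>\<sigma>\<bar> + 1"
  define p where "p = linepath (Complex \<sigma> (- T)) (Complex B (- T)) +++ linepath (Complex B (- T)) (Complex B T) +++
      linepath (Complex B T) (Complex \<sigma> T)"
  have TB: "T > 0" "\<sigma> < B" using N0 by (auto simp: T_def B_def)
  show thesis
  proof (rule that[OF \<sigma>(1)])
    show "admissible_contour \<mu> m \<sigma> T p" unfolding admissible_contour_def
    proof (intro conjI allI)
      fix l and a :: nat
      let ?w = "\<mu> $ l - of_int \<bar>m $ l\<bar> / 2 - of_nat a / 2"
      have "?w \<in> P" by (auto simp: P_def)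
      then have "Re ?w \<noteq> \<sigma>" using \<sigma>(3) by (metis imageI)
      moreover have "\<bar>Im ?w\<bar> < T" using abs_Im_le_cmod[of "\<mu> $ l"] Nl[of l] by (simp add: T_def)
      moreover have "Re ?w < B"
      proof -
        have "Re ?w = Re (\<mu> $ l) - of_int \<bar>m $ l\<bar> / 2 - of_nat a / 2" by simp
        moreover have "0 \<le> real_of_int \<bar>m $ l\<bar>" by simp
        ultimately have "Re ?w \<le> Re (\<mu> $ l)" by linarith
        also have "\<dots> \<le> N" using complex_Re_le_cmod[of "\<mu> $ l"] Nl[of l] by linarith
        finally show ?thesis by (simp add: B_def)
      qed
      ultimately show "left_of_contour \<sigma> T p ?w" unfolding p_def using TB by (intro left_of_bump)
    qed (use TB \<sigma> in \<open>auto simp: p_def valid_path_join\<close>)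
    show "c < Re s" if "s \<in> path_image p" for s
      using that TB \<sigma>(1) unfolding p_def
      by (auto simp: path_image_join closed_segment_horizontal closed_segment_vertical closed_segment_eq_real_ivl split: if_splits)
  qed
qed

subsection \<open>The kernel as residues and a line integral\<close>

lemma integrable_abs_powr_to_inf:
  fixes e a :: real
  assumes "e < -1" "a > 0"
  shows "(\<lambda>t. \<bar>t\<bar> powr e) integrable_on {a..}" "(\<lambda>t. \<bar>t\<bar> powr e) integrable_on {..- a}"
proof -
  have a: "(\<lambda>t. \<bar>t\<bar> powr e) absolutely_integrable_on {a..}"
  proof (rule nonnegative_absolutely_integrable_1)
    have "(\<lambda>t. t powr e) integrable_on {a..}"
      using has_integral_powr_to_inf[OF assms] by (auto simp: integrable_on_def)
    then show "(\<lambda>t. \<bar>t\<bar> powr e) integrable_on {a..}"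
      by (rule integrable_eq) (use assms in auto)
  qed auto
  have "(\<lambda>t. \<bar>t\<bar> powr e) absolutely_integrable_on {..- a}"
    using has_absolute_integral_reflect_real[of "{a..}" "{..- a}" "\<lambda>t. \<bar>t\<bar> powr e"] a
    by (auto simp: image_iff)
  with a show "(\<lambda>t. \<bar>t\<bar> powr e) integrable_on {a..}" "(\<lambda>t. \<bar>t\<bar> powr e) integrable_on {..- a}"
    by (auto simp: absolutely_integrable_on_def)
qed

text \<open>The power bound serves beyond max T T0; on the compact piece before it continuity is
  enough.\<close>

lemma absolutely_integrable_rays:
  fixes f :: "real \<Rightarrow> complex" and T e C :: real
  assumes e: "e < -1" and T: "T > 0" "T0 > 0"
    and bound: "\<And>t. \<bar>t\<bar> \<ge> T0 \<Longrightarrow> norm (f t) \<le> C * \<bar>t\<bar> powr e"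
  shows "continuous_on {T..} f \<Longrightarrow> f absolutely_integrable_on {T..}"
    and "continuous_on {..- T} f \<Longrightarrow> f absolutely_integrable_on {..- T}"
proof -
  define U where "U = max T T0"
  have U: "U > 0" "T \<le> U" "T0 \<le> U" using T by (auto simp: U_def)
  show "f absolutely_integrable_on {T..}" if c: "continuous_on {T..} f"
  proof -
    have "f absolutely_integrable_on {U..}"
    proof (rule measurable_bounded_by_integrable_imp_absolutely_integrable)
      show "f \<in> borel_measurable (lebesgue_on {U..})"
        by (intro continuous_imp_measurable_on_sets_lebesgue continuous_on_subset[OF c]) (use U in auto)
      show "(\<lambda>t. C * \<bar>t\<bar> powr e) integrable_on {U..}"
        using integrable_abs_powr_to_inf(1)[OF e U(1)] by (rule integrable_on_mult_right)
      show "norm (f t) \<le> C * \<bar>t\<bar> powr e" if "t \<in> {U..}" for t using that U by (intro bound) auto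
    qed auto
    moreover have "f absolutely_integrable_on {T..U}"
      by (intro absolutely_integrable_continuous_real continuous_on_subset[OF c]) auto
    moreover have "{T..} = {T..U} \<union> {U..}" using U by auto
    ultimately show ?thesis by (simp only: absolutely_integrable_Un)
  qed
  show "f absolutely_integrable_on {..- T}" if c: "continuous_on {..- T} f"
  proof -
    have "f absolutely_integrable_on {..- U}"
    proof (rule measurable_bounded_by_integrable_imp_absolutely_integrable)
      show "f \<in> borel_measurable (lebesgue_on {..- U})"
        by (intro continuous_imp_measurable_on_sets_lebesgue continuous_on_subset[OF c]) (use U in auto)
      show "(\<lambda>t. C * \<bar>t\<bar> powr e) integrable_on {..- U}"
        using integrable_abs_powr_to_inf(2)[OF e U(1)] by (rule integrable_on_mult_right)
      show "norm (f t) \<le> C * \<bar>t\<bar> powr e" if "t \<in> {..- U}" for t using that U by (intro bound) auto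
    qed auto
    moreover have "f absolutely_integrable_on {- U..- T}"
      by (intro absolutely_integrable_continuous_real continuous_on_subset[OF c]) auto
    moreover have "{..- T} = {- U..- T} \<union> {..- U}" using U by auto
    ultimately show ?thesis by (simp only: absolutely_integrable_Un)
  qed
qed

lemma integrable_inverse_one_plus_square:
  "(\<lambda>t::real. 1 / (1 + t\<^sup>2)) integrable_on UNIV"
proof -
  have pos: "1 + t\<^sup>2 > 0" for t :: real by (intro add_pos_nonneg) auto
  have c: "continuous_on UNIV (\<lambda>t. complex_of_real (1 / (1 + t\<^sup>2)))"
    using pos by (intro continuous_intros) (auto simp: less_imp_neq[symmetric])
  have b: "norm (complex_of_real (1 / (1 + t\<^sup>2))) \<le> 1 * \<bar>t\<bar> powr (- 2)" if "\<bar>t\<bar> \<ge> 1" for t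
  proof -
    have "\<bar>t\<bar> powr (- 2) = 1 / t\<^sup>2" using that by (simp add: powr_minus divide_inverse)
    moreover have "1 / (1 + t\<^sup>2) \<le> 1 / t\<^sup>2" using that by (intro divide_left_mono) (auto intro!: mult_pos_pos pos)
    ultimately show ?thesis using pos[of t] by (simp add: norm_divide del: of_real_add)
  qed
  have "(\<lambda>t. complex_of_real (1 / (1 + t\<^sup>2))) absolutely_integrable_on {1..}"
     "(\<lambda>t. complex_of_real (1 / (1 + t\<^sup>2))) absolutely_integrable_on {..- 1}"
    by (rule absolutely_integrable_rays[of "- 2" 1 1 _ 1]; use b continuous_on_subset[OF c] in auto)+
  moreover have "(\<lambda>t. complex_of_real (1 / (1 + t\<^sup>2))) absolutely_integrable_on {- 1..1}"
    by (intro absolutely_integrable_continuous_real continuous_on_subset[OF c]) auto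
  ultimately have "(\<lambda>t. complex_of_real (1 / (1 + t\<^sup>2))) absolutely_integrable_on ({1..} \<union> {..- 1} \<union> {- 1..1})"
    by (intro absolutely_integrable_Un)
  moreover have "{1..} \<union> {..- 1} \<union> {- 1..1} = (UNIV :: real set)" by auto
  ultimately have "(\<lambda>t. norm (complex_of_real (1 / (1 + t\<^sup>2)))) integrable_on UNIV"
    by (simp only: absolutely_integrable_on_def)
  moreover have "norm (complex_of_real (1 / (1 + t\<^sup>2))) = 1 / (1 + t\<^sup>2)" for t :: real
    unfolding norm_of_real using pos[of t] by simp
  ultimately show ?thesis by (simp only:)
qed

section \<open>Vertical lines that avoid the poles for all Fourier indices\<close>

text \<open>
  The abscissa \<open>c\<close> is far to the left and keeps a distance from all the poles, uniformly under
  translations of \<open>m\<close> by multiples of the vector of ones.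
\<close>

definition clear_line :: "complex ^ 'n \<Rightarrow> real \<Rightarrow> real \<Rightarrow> bool" where
  "clear_line \<mu> \<eta> c \<longleftrightarrow> \<eta> > 0 \<and> \<eta> \<le> 1 / 2 \<and> (\<forall>l. \<forall>q::int. \<bar>c - Re (\<mu> $ l) + of_int q / 2\<bar> \<ge> 2 * \<eta>) \<and>
     (\<forall>l. c \<le> Re (\<mu> $ l) - 2)"

text \<open>The distance from 2 r to the integers is the smaller of frac (2 r) and 1 - frac (2 r),
  and half of it is the distance from r to the half-integers.\<close>

lemma half_integer_gap:
  fixes r :: real
  assumes "\<And>q::int. r + of_int q / 2 \<noteq> 0"
  obtains \<eta> where "\<eta> > 0" "\<And>q::int. \<bar>r + of_int q / 2\<bar> \<ge> \<eta>"
proof -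
  define \<eta> where "\<eta> = min (frac (2 * r)) (1 - frac (2 * r)) / 2"
  have "frac (2 * r) \<noteq> 0"
  proof
    assume "frac (2 * r) = 0"
    then have "2 * r = of_int \<lfloor>2 * r\<rfloor>" by (simp add: frac_def)
    then show False using assms[of "- \<lfloor>2 * r\<rfloor>"] by simp
  qed
  then have "\<eta> > 0" using frac_ge_0[of "2 * r"] frac_lt_1[of "2 * r"] by (simp add: \<eta>_def)
  moreover have "\<bar>r + of_int q / 2\<bar> \<ge> \<eta>" for q :: int
  proof -
    have h: "2 * \<eta> \<le> frac (2 * r)" "2 * \<eta> \<le> 1 - frac (2 * r)" by (auto simp: \<eta>_def)
    define k where "k = \<lfloor>2 * r\<rfloor> + q"
    define y where "y = frac (2 * r)"
    have e: "2 * (r + of_int q / 2) = y + of_int k" by (simp add: frac_def k_def y_def)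
    have h': "2 * \<eta> \<le> y" "2 * \<eta> \<le> 1 - y" using h by (auto simp: y_def)
    show ?thesis
    proof (cases "k \<ge> 0")
      case True
      then have "real_of_int k \<ge> 0" by simp
      then have "\<eta> \<le> r + of_int q / 2" using e h' by argo
      then show ?thesis by (rule order_trans[OF _ abs_ge_self])
    next
      case False
      then have "k \<le> - 1" by linarith
      then have "real_of_int k \<le> real_of_int (- 1)" by (rule of_int_le_iff[THEN iffD2])
      then have "\<eta> \<le> - (r + of_int q / 2)" using e h' by simp
      then show ?thesis by (rule order_trans[OF _ abs_ge_minus_self])
    qed
  qed
  ultimately show thesis by (rule that)
qed

text \<open>The half-integer translates of the numbers \<open>Re (\<mu> $ l)\<close> are countably
  many, so an abscissa off all of them exists below any bound; the gap is the minimum over the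
  finitely many l.\<close>

lemma exists_clear_line:
  fixes \<mu> :: "complex ^ 'n"
  obtains c \<eta> where "c < B" "clear_line \<mu> \<eta> c"
proof -
  define P where "P = (\<Union>l. range (\<lambda>q::int. Re (\<mu> $ l) - of_int q / 2))"
  define N where "N = (\<Sum>l\<in>UNIV. norm (\<mu> $ l))"
  have Nl: "norm (\<mu> $ l) \<le> N" for l
    unfolding N_def using member_le_sum[of l UNIV "\<lambda>l. norm (\<mu> $ l)"] by simp
  define B' where "B' = min B (- N - 2)"
  have "uncountable ({B' - 1<..<B'} - P)"
    by (intro uncountable_minus_countable) (auto simp: P_def uncountable_open_interval)
  then obtain c where c: "c < B'" "c \<notin> P"
    by (metis DiffE all_not_in_conv countable_empty greaterThanLessThan_iff)
  have "\<exists>\<eta>>0. \<forall>q::int. \<bar>c - Re (\<mu> $ l) + of_int q / 2\<bar> \<ge> \<eta>" for l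
  proof -
    have "c - Re (\<mu> $ l) + of_int q / 2 \<noteq> 0" for q :: int
    proof
      assume "c - Re (\<mu> $ l) + of_int q / 2 = 0"
      then have "c = Re (\<mu> $ l) - of_int q / 2" by simp
      then show False using c(2) by (auto simp: P_def)
    qed
    then show ?thesis using half_integer_gap[of "c - Re (\<mu> $ l)"] by metis
  qed
  then obtain h where h: "\<And>l. h l > 0" "\<And>l. \<And>q::int. \<bar>c - Re (\<mu> $ l) + of_int q / 2\<bar> \<ge> h l" by metis
  define \<eta> where "\<eta> = min (1 / 2) (Min (range h) / 2)"
  have m: "Min (range h) \<le> h l" for l by (intro Min_le) auto
  have "Min (range h) > 0" using h(1) by (subst Min_gr_iff) auto
  then have \<eta>0: "\<eta> > 0" "\<eta> \<le> 1 / 2" by (auto simp: \<eta>_def)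
  have "\<bar>c - Re (\<mu> $ l) + of_int q / 2\<bar> \<ge> 2 * \<eta>" for l and q :: int
    using h(2)[of l q] m[of l] unfolding \<eta>_def by linarith
  moreover have "c \<le> Re (\<mu> $ l) - 2" for l
    using c(1) Nl[of l] abs_Re_le_cmod[of "\<mu> $ l"] unfolding B'_def by linarith
  ultimately have "clear_line \<mu> \<eta> c" using \<eta>0 by (auto simp: clear_line_def)
  then show thesis using c by (intro that[of c \<eta>]) (auto simp: B'_def)
qed

lemma clear_line_bound:
  assumes c: "clear_line \<mu> \<eta> c" and x: "x > 0"
  obtains C where "C > 0" and "\<And>\<mu>' k t. norm (\<mu>' - \<mu>) \<le> \<eta> \<Longrightarrow>
     norm (integrand \<mu>' (m + vec k) x (Complex c t)) \<le> C / ((1 + (of_int k)\<^sup>2) * (1 + t\<^sup>2))"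
proof -
  have \<eta>: "\<eta> > 0" "\<eta> \<le> 1 / 2" using c by (auto simp: clear_line_def)
  have cl: "\<bar>c - Re (\<mu> $ l) + of_int q / 2\<bar> \<ge> 2 * \<eta>" for l and q :: int
    using c unfolding clear_line_def by blast
  \<comment> \<open>The 2 in \<open>clear_line\<close> is made for this: 1 + 2 * 2 = 5, of which 4
    remains after a perturbation of \<mu>.\<close>
  have "c \<le> Re (\<mu> $ l) - 2" for l using c unfolding clear_line_def by blast
  then have far: "1 - 2 * (c - Re (\<mu> $ l)) \<ge> 5" for l by (smt (verit))
  show thesis by (rule integrand_line_bound[OF x \<eta> cl far, of m]) (rule that; blast)
qed

text \<open>Of the distance 2 \<eta> between c and the half-integer translates of the real parts, a
  perturbation of \<mu> uses up at most \<eta>.\<close>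

lemma clear_line_near:
  assumes "clear_line \<mu> \<eta> c" "norm (\<mu>' - \<mu>) \<le> \<eta>" "s \<in> poles \<mu>' m"
  shows "\<bar>c - Re s\<bar> \<ge> \<eta>"
proof -
  obtain l a where s: "s = \<mu>' $ l - of_int \<bar>m $ l\<bar> / 2 - of_nat a" using assms(3) by (auto simp: poles_def)
  have "norm (\<mu>' $ l - \<mu> $ l) \<le> \<eta>"
    using Finite_Cartesian_Product.norm_nth_le[of "\<mu>' - \<mu>" l] assms(2) by simp
  then have "\<bar>Re (\<mu>' $ l) - Re (\<mu> $ l)\<bar> \<le> \<eta>"
    using abs_Re_le_cmod[of "\<mu>' $ l - \<mu> $ l"] by simp
  moreover have "\<bar>c - Re (\<mu> $ l) + of_int (\<bar>m $ l\<bar> + 2 * int a) / 2\<bar> \<ge> 2 * \<eta>"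
    using assms(1) unfolding clear_line_def by blast
  ultimately show ?thesis unfolding s by (simp add: add_divide_distrib)
qed

lemma integrand_continuous_on:
  assumes "x > 0" "continuous_on S g" "\<And>y. y \<in> S \<Longrightarrow> g y \<notin> poles \<mu> m"
  shows "continuous_on S (\<lambda>y. integrand \<mu> m x (g y))"
  using assms continuous_on_compose2[OF holomorphic_on_imp_continuous_on[OF integrand_holomorphic[OF assms(1)]]]
  by (metis ComplI image_subsetI)

lemma clear_line_integrable:
  assumes c: "clear_line \<mu> \<eta> c" and x: "x > 0" and near: "norm (\<mu>' - \<mu>) \<le> \<eta>"
  shows "(\<lambda>t. integrand \<mu>' m x (Complex c t)) absolutely_integrable_on UNIV"
proof -
  have \<eta>: "\<eta> > 0" using c by (simp add: clear_line_def)
  obtain C where C: "\<And>\<mu>' k t. norm (\<mu>' - \<mu>) \<le> \<eta> \<Longrightarrow>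
     norm (integrand \<mu>' (m + vec k) x (Complex c t)) \<le> C / ((1 + (of_int k)\<^sup>2) * (1 + t\<^sup>2))"
    by (rule clear_line_bound[OF c x, of m]) (rule that; blast)
  show ?thesis
  proof (rule measurable_bounded_by_integrable_imp_absolutely_integrable)
    show "(\<lambda>t. C * (1 / (1 + t\<^sup>2))) integrable_on UNIV"
      using integrable_inverse_one_plus_square by (rule integrable_on_mult_right)
    show "norm (integrand \<mu>' m x (Complex c t)) \<le> C * (1 / (1 + t\<^sup>2))" for t
      using C[OF near, of 0 t] by (simp add: vec_0)
    have "continuous_on UNIV (\<lambda>t. integrand \<mu>' m x (Complex c t))"
    proof (rule integrand_continuous_on[OF x])
      show "continuous_on UNIV (Complex c)" by (intro continuous_intros continuous_on_Complex)
      show "Complex c t \<notin> poles \<mu>' m" for t using clear_line_near[OF c near, of "Complex c t" m] \<eta> by auto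
    qed
    then show "(\<lambda>t. integrand \<mu>' m x (Complex c t)) \<in> borel_measurable (lebesgue_on UNIV)"
      by (rule continuous_imp_measurable_on_sets_lebesgue) auto
  qed auto
qed

section \<open>The contour shift and the value of the kernel\<close>

lemma powr_at_top_small:
  fixes e C \<epsilon> :: real
  assumes "e < 0" "\<epsilon> > 0"
  shows "\<forall>\<^sub>F R in at_top. C * R powr e < \<epsilon>"
proof -
  have "((\<lambda>R. C * R powr e) \<longlongrightarrow> C * 0) at_top"
    using assms by (intro tendsto_intros tendsto_neg_powr filterlim_ident)
  then show ?thesis using assms(2) by (intro order_tendstoD(2)[of _ "C * 0"]) auto
qed

text \<open>The kernel after its contour has been shifted to Re s = c. The \<i> in ds = \<i> dt
  cancels against 2 pi \<i>, which leaves 1 / (2 pi) before the line integral.\<close>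

definition kernel_value :: "complex ^ 'n \<Rightarrow> int ^ 'n \<Rightarrow> real \<Rightarrow> real \<Rightarrow> complex" where
  "kernel_value \<mu> m x c = (\<Sum>w\<in>poles \<mu> m \<inter> {s. Re s > c}. residue (integrand \<mu> m x) w) +
     1 / (2 * of_real pi) * integral UNIV (\<lambda>t. integrand \<mu> m x (Complex c t))"

text \<open>For large R the closed-up curve contains any given point of the rays, and a point to the
  left is off that curve. Hence the integrand is continuous on the rays.\<close>

lemma left_of_contour_not_on_ray:
  assumes "left_of_contour \<sigma> T p w" "\<bar>t\<bar> \<ge> T" "T > 0" "pathstart p = Complex \<sigma> (- T)" "pathfinish p = Complex \<sigma> T"
  shows "w \<noteq> Complex \<sigma> t"
proof
  assume w: "w = Complex \<sigma> t"
  have "\<forall>\<^sub>F R in at_top. R > \<bar>t\<bar> \<and> w \<notin> path_image (closed_up \<sigma> T p R)"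
    using assms(1) eventually_gt_at_top[of "\<bar>t\<bar>"] unfolding left_of_contour_def by eventually_elim auto
  then obtain R where R: "R > \<bar>t\<bar>" "w \<notin> path_image (closed_up \<sigma> T p R)"
    using eventually_happens trivial_limit_at_top_linorder by blast
  have "w \<in> closed_segment (Complex \<sigma> (- R)) (Complex \<sigma> (- T)) \<union> closed_segment (Complex \<sigma> T) (Complex \<sigma> R)"
    using w R(1) assms(2,3) by (auto simp: closed_segment_vertical closed_segment_eq_real_ivl)
  then show False using R(2) assms(4,5) unfolding closed_up_def by (auto simp: path_image_join)
qed

text \<open>The bound on \<sigma> in \<open>admissible_contour\<close> amounts to 2 n \<sigma> - n <
  -1 when the entries of \<mu> sum to 0. The strip bound then gives integrability on the rays and
  small horizontal edges.\<close>

lemma admissible_contour_value: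
  fixes \<mu> :: "complex ^ 'n" and m :: "int ^ 'n"
  assumes sum0: "(\<Sum>l\<in>UNIV. \<mu> $ l) = 0" and x: "x > 0" and adm: "admissible_contour \<mu> m \<sigma> T p"
    and c: "clear_line \<mu> \<eta> c" "c < \<sigma>" and pc: "\<And>s. s \<in> path_image p \<Longrightarrow> c < Re s"
  shows "1 / (2 * of_real pi * \<i>) * infinite_contour_integral \<sigma> T p (integrand \<mu> m x) = kernel_value \<mu> m x c"
proof -
  let ?n = "real CARD('n)"
  have n: "?n > 0" by simp
  have \<eta>: "\<eta> > 0" using c by (simp add: clear_line_def)
  have T: "T > 0" and p: "valid_path p" "pathstart p = Complex \<sigma> (- T)" "pathfinish p = Complex \<sigma> T"
    and sig: "\<sigma> < 1 / 2 + (- 1 / 2) / ?n"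
    using adm sum0 by (auto simp: admissible_contour_def)
  have left: "left_of_contour \<sigma> T p w" if wp: "w \<in> poles \<mu> m" for w
  proof -
    obtain l a where w: "w = \<mu> $ l - of_int \<bar>m $ l\<bar> / 2 - of_nat a" using wp by (auto simp: poles_def)
    \<comment> \<open>The actual poles have integer spacing; they are the points with even index 2 a
      of the half-integer set in \<open>admissible_contour\<close>.\<close>
    have "left_of_contour \<sigma> T p (\<mu> $ l - of_int \<bar>m $ l\<bar> / 2 - of_nat (2 * a) / 2)"
      using adm unfolding admissible_contour_def by blast
    then show ?thesis unfolding w by simp
  qed
  define e where "e = 2 * ?n * \<sigma> - ?n"
  have "?n * \<sigma> < ?n * (1 / 2 + (- 1 / 2) / ?n)" using sig n by (intro mult_strict_left_mono) auto
  then have e: "e < - 1" using n by (simp add: e_def algebra_simps)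
  obtain C T0 where CT: "C > 0" "T0 \<ge> 1" and Cb: "\<And>s. c \<le> Re s \<Longrightarrow> Re s \<le> \<sigma> \<Longrightarrow> \<bar>Im s\<bar> \<ge> T0 \<Longrightarrow>
     norm (integrand \<mu> m x s) \<le> C * \<bar>Im s\<bar> powr (2 * ?n * Re s - ?n)"
    by (rule integrand_strip_bound[OF x sum0, of c \<sigma> m]) (rule that; blast)
  have ray: "continuous_on S (\<lambda>t. integrand \<mu> m x (Complex \<sigma> t))" if "\<And>t. t \<in> S \<Longrightarrow> \<bar>t\<bar> \<ge> T" for S
  proof (rule integrand_continuous_on[OF x])
    show "continuous_on S (Complex \<sigma>)" by (intro continuous_intros continuous_on_Complex)
    show "Complex \<sigma> t \<notin> poles \<mu> m" if "t \<in> S" for t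
      using left_of_contour_not_on_ray[OF left _ T p(2,3)] \<open>\<And>t. t \<in> S \<Longrightarrow> \<bar>t\<bar> \<ge> T\<close>[OF that] by blast
  qed
  have Cb': "norm (integrand \<mu> m x (Complex \<sigma> t)) \<le> C * \<bar>t\<bar> powr e" if "\<bar>t\<bar> \<ge> T0" for t
    using Cb[of "Complex \<sigma> t"] that c by (simp add: e_def)
  have T0: "T0 > 0" using CT by simp
  have "infinite_contour_integral \<sigma> T p (integrand \<mu> m x) =
     2 * pi * \<i> * (\<Sum>w\<in>poles \<mu> m \<inter> {s. Re s > c}. residue (integrand \<mu> m x) w) +
     \<i> * integral UNIV (\<lambda>t. integrand \<mu> m x (Complex c t))"
  proof (rule infinite_contour_integral_eq_residues[where c' = "c - \<eta>", OF _ finite_poles_right _ _ c(2) T p])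
    show "integrand \<mu> m x holomorphic_on {s. c - \<eta> < Re s} - poles \<mu> m \<inter> {s. c < Re s}"
    proof (rule holomorphic_on_subset[OF integrand_holomorphic[OF x, of \<mu> m]], safe)
      fix s assume s: "c - \<eta> < Re s" "s \<in> poles \<mu> m"
      have "\<eta> \<le> \<bar>c - Re s\<bar>" using clear_line_near[OF c(1) _ s(2)] \<eta> by simp
      then show "c < Re s" using s(1) by linarith
    qed
    show "(\<lambda>t. integrand \<mu> m x (Complex \<sigma> t)) absolutely_integrable_on {..- T}"
      by (rule absolutely_integrable_rays(2)[OF e T T0 Cb' ray]) auto
    show "(\<lambda>t. integrand \<mu> m x (Complex \<sigma> t)) absolutely_integrable_on {T..}"
      by (rule absolutely_integrable_rays(1)[OF e T T0 Cb' ray]) auto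
    show "(\<lambda>t. integrand \<mu> m x (Complex c t)) absolutely_integrable_on UNIV"
      by (rule clear_line_integrable[OF c(1) x]) (use \<eta> in simp)
    fix \<epsilon> :: real assume "\<epsilon> > 0"
    then have "\<forall>\<^sub>F R in at_top. C * R powr e < \<epsilon>" using e by (intro powr_at_top_small) auto
    then show "\<forall>\<^sub>F R in at_top. \<forall>r\<in>{c..\<sigma>}. norm (integrand \<mu> m x (Complex r R)) \<le> \<epsilon> \<and>
        norm (integrand \<mu> m x (Complex r (- R))) \<le> \<epsilon>"
      using eventually_ge_at_top[of T0]
    proof eventually_elim
      case (elim R)
      have R: "R \<ge> T0" "R \<ge> 1" using elim CT by auto
      have "norm (integrand \<mu> m x (Complex r t)) \<le> \<epsilon>" if r: "r \<in> {c..\<sigma>}" and t: "\<bar>t\<bar> = R" for r t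
      proof -
        have "norm (integrand \<mu> m x (Complex r t)) \<le> C * R powr (2 * ?n * r - ?n)"
          using Cb[of "Complex r t"] r R t by simp
        \<comment> \<open>The exponent increases with r and R \<ge> 1, so r = \<sigma> is the worst
          case.\<close>
        also have "\<dots> \<le> C * R powr e"
          using r R CT n by (intro mult_left_mono powr_mono) (auto simp: e_def)
        finally show ?thesis using elim by simp
      qed
      then show ?case using R by auto
    qed
  qed (use \<eta> pc left in \<open>fastforce+\<close>)
  moreover have "1 / (2 * of_real pi * \<i>) * (2 * pi * \<i> * u + \<i> * v) = u + 1 / (2 * of_real pi) * v" for u v :: complex
    by (simp add: field_simps)
  ultimately show ?thesis unfolding kernel_value_def by simp
qed

text \<open>The given c may fail to lie to the left of an arbitrary admissible contour. The contour
  is therefore compared with one fixed contour to the right of c by means of a third line, to the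
  left of both.\<close>

lemma bessel_j_eq:
  fixes \<mu> :: "complex ^ 'n" and m :: "int ^ 'n"
  assumes sum0: "(\<Sum>l\<in>UNIV. \<mu> $ l) = 0" and x: "x > 0" and c: "clear_line \<mu> \<eta> c"
  shows "bessel_j \<mu> m x = kernel_value \<mu> m x c"
proof -
  have cb: "c < 1 / 2 + (Re (\<Sum>l\<in>UNIV. \<mu> $ l) - 1 / 2) / real CARD('n)"
  proof -
    \<comment> \<open>Averaging c \<le> Re \<mu>_l - 2 over l gives c \<le> -2, whereas the bound
      for abscissas, 1/2 - 1/(2 n), is at least 0.\<close>
    have "(\<Sum>l\<in>(UNIV :: 'n set). c) \<le> (\<Sum>l\<in>UNIV. Re (\<mu> $ l) - 2)"
      using c by (intro sum_mono) (auto simp: clear_line_def)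
    also have "\<dots> = - 2 * real CARD('n)" using sum0 by (simp add: sum_subtractf flip: Re_sum)
    finally have "real CARD('n) * c \<le> real CARD('n) * (- 2)" by simp
    then have "c \<le> - 2" by (subst (asm) mult_le_cancel_left_pos) auto
    moreover have "1 / (2 * real CARD('n)) \<le> 1 / 2" by (simp add: divide_le_eq)
    ultimately have "c < 1 / 2 - 1 / (2 * real CARD('n))" by linarith
    then show ?thesis unfolding sum0 by simp
  qed
  obtain \<sigma> T p where a: "c < \<sigma>" "admissible_contour \<mu> m \<sigma> T p" "\<And>s. s \<in> path_image p \<Longrightarrow> c < Re s"
    by (rule exists_admissible_contour[OF cb, of m]) (rule that; blast)
  have v: "kernel_value \<mu> m x c = 1 / (2 * of_real pi * \<i>) * infinite_contour_integral \<sigma>' T' p' (integrand \<mu> m x)"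
    if a': "admissible_contour \<mu> m \<sigma>' T' p'" for \<sigma>' T' p'
  proof -
    have "bounded (path_image p')" using a' unfolding admissible_contour_def
      by (meson bounded_path_image valid_path_imp_path)
    then obtain b where b: "\<And>s. s \<in> path_image p' \<Longrightarrow> norm s \<le> b" unfolding bounded_iff by blast
    \<comment> \<open>The path is bounded, so a clear line lies to the left of it, of \<sigma>' and
      of c.\<close>
    obtain c' \<eta>' where c': "c' < min c (min \<sigma>' (- b))" "clear_line \<mu> \<eta>' c'" by (rule exists_clear_line)
    have "c' < Re s" if "s \<in> path_image p'" for s
      using c' b[OF that] abs_le_D2[OF abs_Re_le_cmod[of s]] by simp
    then have "kernel_value \<mu> m x c' = 1 / (2 * of_real pi * \<i>) * infinite_contour_integral \<sigma>' T' p' (integrand \<mu> m x)"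
      using admissible_contour_value[OF sum0 x a' c'(2)] c'(1) by simp
    moreover have "c' < Re s" if "s \<in> path_image p" for s
      using c' a(3)[OF that] by simp
    then have "kernel_value \<mu> m x c' = 1 / (2 * of_real pi * \<i>) * infinite_contour_integral \<sigma> T p (integrand \<mu> m x)"
      using admissible_contour_value[OF sum0 x a(2) c'(2)] c'(1) a(1) by simp
    moreover have "kernel_value \<mu> m x c = 1 / (2 * of_real pi * \<i>) * infinite_contour_integral \<sigma> T p (integrand \<mu> m x)"
      using admissible_contour_value[OF sum0 x a(2) c a(1,3)] by simp
    ultimately show ?thesis by simp
  qed
  show ?thesis unfolding bessel_j_def integrand_def[symmetric]
    by (rule the_equality) (use v a(2) in \<open>auto simp: integrand_def [abs_def]\<close>)
qed

subsection \<open>Continuity in the parameter\<close>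

text \<open>Halving \<eta> and the slack between 3 and 2 absorb the perturbation.\<close>

lemma clear_line_perturb:
  fixes \<mu> :: "complex ^ 'n"
  assumes "clear_line \<mu> \<eta> c" "\<And>l. c \<le> Re (\<mu> $ l) - 3" "norm (\<mu>' - \<mu>) \<le> \<eta>"
  shows "clear_line \<mu>' (\<eta> / 2) c"
proof -
  have "norm (\<mu>' $ l - \<mu> $ l) \<le> \<eta>" for l
    using Finite_Cartesian_Product.norm_nth_le[of "\<mu>' - \<mu>" l] assms(3) by simp
  then have r: "\<bar>Re (\<mu>' $ l) - Re (\<mu> $ l)\<bar> \<le> \<eta>" for l
    using abs_Re_le_cmod[of "\<mu>' $ l - \<mu> $ l"] order_trans by fastforce
  have a: "\<eta> > 0" "\<eta> \<le> 1 / 2" using assms(1) by (auto simp: clear_line_def)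
  have "2 * (\<eta> / 2) \<le> \<bar>c - Re (\<mu>' $ l) + of_int q / 2\<bar>" for l and q :: int
  proof -
    have "2 * \<eta> \<le> \<bar>c - Re (\<mu> $ l) + of_int q / 2\<bar>" using assms(1) unfolding clear_line_def by blast
    then show ?thesis using r[of l] by linarith
  qed
  moreover have "c \<le> Re (\<mu>' $ l) - 2" for l using assms(2)[of l] r[of l] a by linarith
  ultimately show ?thesis using a unfolding clear_line_def by simp
qed

text \<open>Individual residues need not depend continuously on \<mu> when poles collide. Their sum
  is an integral over a rectangle that encloses all poles to the right of c, and the rectangle
  depends only on c and N.\<close>

lemma kernel_value_rectpath:
  fixes \<mu> :: "complex ^ 'n"
  assumes x: "x > 0" and c: "clear_line \<mu> \<eta> c" and N: "\<And>l. norm (\<mu> $ l) < N" "c < N"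
  shows "kernel_value \<mu> m x c = 1 / (2 * of_real pi * \<i>) *
      contour_integral (rectpath (Complex c (- N)) (Complex N N)) (integrand \<mu> m x) +
      1 / (2 * of_real pi) * integral UNIV (\<lambda>t. integrand \<mu> m x (Complex c t))"
    and "path_image (rectpath (Complex c (- N)) (Complex N N)) \<inter> poles \<mu> m = {}"
proof -
  let ?r = "rectpath (Complex c (- N)) (Complex N N)"
  let ?A = "poles \<mu> m \<inter> {s. Re s > c}"
  have \<eta>: "\<eta> > 0" using c by (simp add: clear_line_def)
  have N0: "N > 0" using N(1)[of undefined] norm_ge_zero[of "\<mu> $ undefined"] by linarith
  \<comment> \<open>No pole has real part between c - \<eta> and c, so the half-plane Re > c -
    \<eta> contains the closed rectangle but no further poles.\<close>
  have gap: "Re s > c" if "s \<in> poles \<mu> m" "Re s > c - \<eta>" for s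
  proof -
    have "\<eta> \<le> \<bar>c - Re s\<bar>" using clear_line_near[OF c _ that(1)] \<eta> by simp
    then show ?thesis using that(2) by linarith
  qed
  have inb: "s \<in> box (Complex c (- N)) (Complex N N)" if sp: "s \<in> poles \<mu> m" "Re s > c" for s
  proof -
    obtain l a where s: "s = \<mu> $ l - of_int \<bar>m $ l\<bar> / 2 - of_nat a" using sp by (auto simp: poles_def)
    have n: "\<bar>Re (\<mu> $ l)\<bar> < N" "\<bar>Im (\<mu> $ l)\<bar> < N"
      using N(1)[of l] abs_Re_le_cmod[of "\<mu> $ l"] abs_Im_le_cmod[of "\<mu> $ l"] by linarith+
    have im: "Im s = Im (\<mu> $ l)" by (simp add: s)
    have re: "Re s \<le> Re (\<mu> $ l)" by (simp add: s)
    have "- N < Im s" "Im s < N" "Re s < N" using n re unfolding im by linarith+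
    then show ?thesis using sp by (simp add: in_box_complex_iff)
  qed
  have pim: "path_image ?r = cbox (Complex c (- N)) (Complex N N) - box (Complex c (- N)) (Complex N N)"
    using N0 N(2) by (intro path_image_rectpath_cbox_minus_box) auto
  have sub: "path_image ?r \<subseteq> {s. c - \<eta> < Re s}"
    unfolding pim using \<eta> by (auto simp: in_cbox_complex_iff)
  show d: "path_image ?r \<inter> poles \<mu> m = {}"
    using sub gap inb unfolding pim by blast
  have "contour_integral ?r (integrand \<mu> m x) = 2 * pi * \<i> * (\<Sum>w\<in>?A. winding_number ?r w * residue (integrand \<mu> m x) w)"
  proof (rule Residue_theorem[of "{s. c - \<eta> < Re s}"])
    show "integrand \<mu> m x holomorphic_on {s. c - \<eta> < Re s} - ?A"
      by (rule holomorphic_on_subset[OF integrand_holomorphic[OF x, of \<mu> m]]) (use gap in auto)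
    show "\<forall>z. z \<notin> {s. c - \<eta> < Re s} \<longrightarrow> winding_number ?r z = 0"
    proof (intro allI impI winding_number_zero_outside)
      show "convex {s. c - \<eta> < Re s}" by (rule convex_halfspace_Re_gt)
    qed (use sub in auto)
  qed (use sub d finite_poles_right[of \<mu> m c] in \<open>auto simp: open_halfspace_Re_gt
         intro!: convex_connected convex_halfspace_Re_gt\<close>)
  also have "(\<Sum>w\<in>?A. winding_number ?r w * residue (integrand \<mu> m x) w) = (\<Sum>w\<in>?A. residue (integrand \<mu> m x) w)"
    using inb by (intro sum.cong) (auto simp: winding_number_rectpath)
  finally show "kernel_value \<mu> m x c = 1 / (2 * of_real pi * \<i>) * contour_integral ?r (integrand \<mu> m x) +
      1 / (2 * of_real pi) * integral UNIV (\<lambda>t. integrand \<mu> m x (Complex c t))"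
    unfolding kernel_value_def by simp
qed

text \<open>On the compact product the integrand is uniformly continuous, so it converges uniformly
  on the segment as y tends to y0.\<close>

lemma continuous_on_contour_integral_linepath:
  fixes G :: "'a::metric_space \<Rightarrow> complex \<Rightarrow> complex"
  assumes Y: "compact Y" and G: "continuous_on (Y \<times> closed_segment a b) (\<lambda>(y, s). G y s)"
  shows "continuous_on Y (\<lambda>y. contour_integral (linepath a b) (G y))"
  unfolding continuous_on_def
proof
  fix y0 assume y0: "y0 \<in> Y"
  have cont: "continuous_on (closed_segment a b) (G y)" if "y \<in> Y" for y
  proof -
    have "continuous_on (closed_segment a b) (\<lambda>s. case (y, s) of (y, s) \<Rightarrow> G y s)"
      by (rule continuous_on_compose2[OF G]) (use that in \<open>auto intro!: continuous_intros\<close>)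
    then show ?thesis by simp
  qed
  show "((\<lambda>y. contour_integral (linepath a b) (G y)) \<longlongrightarrow> contour_integral (linepath a b) (G y0)) (at y0 within Y)"
  proof (cases "at y0 within Y = bot")
    case False
    have uc: "uniformly_continuous_on (Y \<times> closed_segment a b) (\<lambda>(y, s). G y s)"
      by (intro compact_uniformly_continuous G compact_Times Y compact_segment)
    have ul: "uniform_limit (closed_segment a b) G (G y0) (at y0 within Y)"
    proof (rule uniform_limitI)
      fix e :: real assume "e > 0"
      then obtain d where d: "d > 0" "\<And>u v. u \<in> Y \<times> closed_segment a b \<Longrightarrow> v \<in> Y \<times> closed_segment a b \<Longrightarrow>
          dist v u < d \<Longrightarrow> dist ((\<lambda>(y, s). G y s) v) ((\<lambda>(y, s). G y s) u) < e"
        using uc unfolding uniformly_continuous_on_def by metis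
      have "\<forall>\<^sub>F y in at y0 within Y. y \<in> Y \<and> dist y y0 < d"
        using d(1) by (auto simp: eventually_at)
      then show "\<forall>\<^sub>F y in at y0 within Y. \<forall>s\<in>closed_segment a b. dist (G y s) (G y0 s) < e"
      proof eventually_elim
        case (elim y)
        then show ?case using d(2)[of "(y0, _)" "(y, _)"] y0 by (auto simp: dist_Pair_Pair)
      qed
    qed
    show ?thesis
    proof (rule contour_integral_uniform_limit(2)[where B = "norm (b - a)"])
      show "\<forall>\<^sub>F y in at y0 within Y. G y contour_integrable_on linepath a b"
        using cont by (auto simp: eventually_at_filter intro!: contour_integrable_continuous_linepath always_eventually)
    qed (use ul False in auto)
  qed auto
qed

text \<open>
  Near \<open>\<mu>\<close> the kernel is given by integrals over fixed curves which avoid the poles.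
\<close>

lemma continuous_on_bessel_j:
  fixes \<mu> :: "complex ^ 'n"
  assumes x: "x > 0" and c: "clear_line \<mu> \<eta> c" "\<And>l. c \<le> Re (\<mu> $ l) - 3"
  shows "continuous_on (cball \<mu> \<eta> \<inter> {\<mu>'. (\<Sum>l\<in>UNIV. \<mu>' $ l) = 0}) (\<lambda>\<mu>'. bessel_j \<mu>' m x)"
proof -
  have \<eta>: "\<eta> > 0" "\<eta> \<le> 1 / 2" using c(1) by (auto simp: clear_line_def)
  \<comment> \<open>Exceeds c and the norms of all entries of every \<mu>' in the ball, whose radius
    is at most 1/2.\<close>
  define N where "N = norm \<mu> + \<bar>c\<bar> + 1"
  define r where "r = rectpath (Complex c (- N)) (Complex N N)"
  have near: "norm (\<mu>' - \<mu>) \<le> \<eta>" if "\<mu>' \<in> cball \<mu> \<eta>" for \<mu>'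
    using that by (simp add: dist_norm norm_minus_commute)
  have NN: "norm (\<mu>' $ l) < N" if "\<mu>' \<in> cball \<mu> \<eta>" for \<mu>' :: "complex ^ 'n" and l
    using near[OF that] Finite_Cartesian_Product.norm_nth_le[of \<mu>' l] norm_triangle_sub[of \<mu>' \<mu>] \<eta>
    unfolding N_def by linarith
  have cN: "c < N" unfolding N_def by (smt (verit) norm_ge_zero)
  note cl = clear_line_perturb[OF c near]
  have pim: "path_image r \<inter> poles \<mu>' m = {}" if "\<mu>' \<in> cball \<mu> \<eta>" for \<mu>'
    unfolding r_def by (rule kernel_value_rectpath(2)[OF x cl[OF that] NN[OF that] cN])
  define I where "I \<mu>' = 1 / (2 * of_real pi * \<i>) * contour_integral r (integrand \<mu>' m x) +
      1 / (2 * of_real pi) * integral UNIV (\<lambda>t. integrand \<mu>' m x (Complex c t))" for \<mu>' :: "complex ^ 'n"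
  have joint: "continuous_on (cball \<mu> \<eta> \<times> K) (\<lambda>(\<mu>', s). integrand \<mu>' m x s)"
    if K: "\<And>\<mu>'. \<mu>' \<in> cball \<mu> \<eta> \<Longrightarrow> K \<inter> poles \<mu>' m = {}" for K
    unfolding continuous_on_def split_def
  proof
    fix u assume u: "u \<in> cball \<mu> \<eta> \<times> K"
    then have "snd u \<notin> poles (fst u) m" using K[of "fst u"] by auto
    then show "((\<lambda>p. integrand (fst p) m x (snd p)) \<longlongrightarrow> integrand (fst u) m x (snd u)) (at u within cball \<mu> \<eta> \<times> K)"
      by (intro integrand_tendsto[OF x] tendsto_intros)
  qed
  have c1: "continuous_on (cball \<mu> \<eta>) (\<lambda>\<mu>'. contour_integral r (integrand \<mu>' m x))"
  proof -
    let ?a1 = "Complex c (- N)" and ?a2 = "Complex N (- N)" and ?a3 = "Complex N N" and ?a4 = "Complex c N"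
    have im: "path_image r = closed_segment ?a1 ?a2 \<union> closed_segment ?a2 ?a3 \<union> closed_segment ?a3 ?a4 \<union> closed_segment ?a4 ?a1"
      unfolding r_def rectpath_def Let_def by (simp add: path_image_join Un_assoc)
    have seg: "continuous_on (cball \<mu> \<eta>) (\<lambda>\<mu>'. contour_integral (linepath a b) (integrand \<mu>' m x))"
      "\<And>\<mu>'. \<mu>' \<in> cball \<mu> \<eta> \<Longrightarrow> integrand \<mu>' m x contour_integrable_on linepath a b"
      if "closed_segment a b \<subseteq> path_image r" for a b
    proof -
      show "continuous_on (cball \<mu> \<eta>) (\<lambda>\<mu>'. contour_integral (linepath a b) (integrand \<mu>' m x))"
        by (intro continuous_on_contour_integral_linepath compact_cball joint) (use pim that in blast)
      show "integrand \<mu>' m x contour_integrable_on linepath a b" if m: "\<mu>' \<in> cball \<mu> \<eta>" for \<mu>'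
        by (intro contour_integrable_continuous_linepath integrand_continuous_on[OF x] continuous_intros)
          (use pim[OF m] \<open>closed_segment a b \<subseteq> path_image r\<close> in blast)
    qed
    have segs: "closed_segment ?a1 ?a2 \<subseteq> path_image r" "closed_segment ?a2 ?a3 \<subseteq> path_image r"
      "closed_segment ?a3 ?a4 \<subseteq> path_image r" "closed_segment ?a4 ?a1 \<subseteq> path_image r" unfolding im by auto
    have "continuous_on (cball \<mu> \<eta>) (\<lambda>\<mu>'. contour_integral (linepath ?a1 ?a2) (integrand \<mu>' m x) +
       (contour_integral (linepath ?a2 ?a3) (integrand \<mu>' m x) +
       (contour_integral (linepath ?a3 ?a4) (integrand \<mu>' m x) + contour_integral (linepath ?a4 ?a1) (integrand \<mu>' m x))))"
      by (intro continuous_on_add seg segs)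
    moreover have "contour_integral r (integrand \<mu>' m x) = contour_integral (linepath ?a1 ?a2) (integrand \<mu>' m x) +
       (contour_integral (linepath ?a2 ?a3) (integrand \<mu>' m x) +
       (contour_integral (linepath ?a3 ?a4) (integrand \<mu>' m x) + contour_integral (linepath ?a4 ?a1) (integrand \<mu>' m x)))"
      if "\<mu>' \<in> cball \<mu> \<eta>" for \<mu>'
      using seg(2)[OF segs(1) that] seg(2)[OF segs(2) that] seg(2)[OF segs(3) that] seg(2)[OF segs(4) that]
      unfolding r_def rectpath_def Let_def
      by (simp add: contour_integrable_join valid_path_join)
    ultimately show ?thesis by (subst continuous_on_cong[OF refl]) auto
  qed
  obtain C where C: "\<And>\<mu>' k t. norm (\<mu>' - \<mu>) \<le> \<eta> \<Longrightarrow>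
     norm (integrand \<mu>' (m + vec k) x (Complex c t)) \<le> C / ((1 + (of_int k)\<^sup>2) * (1 + t\<^sup>2))"
    by (rule clear_line_bound[OF c(1) x, of m]) (rule that; blast)
  have c2: "continuous_on (cball \<mu> \<eta>) (\<lambda>\<mu>'. integral UNIV (\<lambda>t. integrand \<mu>' m x (Complex c t)))"
    unfolding continuous_on_def tendsto_at_iff_sequentially o_def
  proof (intro ballI allI impI)
    fix \<mu>1 X assume m1: "\<mu>1 \<in> cball \<mu> \<eta>" and X: "\<forall>i. X i \<in> cball \<mu> \<eta> - {\<mu>1}" "X \<longlonglongrightarrow> \<mu>1"
    show "(\<lambda>i. integral UNIV (\<lambda>t. integrand (X i) m x (Complex c t))) \<longlonglongrightarrow> integral UNIV (\<lambda>t. integrand \<mu>1 m x (Complex c t))"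
    \<comment> \<open>The bound on the clear line holds throughout the ball, which yields a majorant
      independent of the parameter.\<close>
    proof (rule dominated_convergence(2))
      show "(\<lambda>t. C * (1 / (1 + t\<^sup>2))) integrable_on UNIV"
        using integrable_inverse_one_plus_square by (rule integrable_on_mult_right)
      fix i
      have ni: "norm (X i - \<mu>) \<le> \<eta>" using near X(1) by blast
      show "(\<lambda>t. integrand (X i) m x (Complex c t)) integrable_on UNIV"
        using clear_line_integrable[OF c(1) x ni] by (auto simp: absolutely_integrable_on_def)
      show "norm (integrand (X i) m x (Complex c t)) \<le> C * (1 / (1 + t\<^sup>2))" for t
        using C[OF ni, of 0 t] by (simp add: vec_0)
    next
      fix t :: real
      have "Complex c t \<notin> poles \<mu>1 m" using clear_line_near[OF c(1) near[OF m1], of "Complex c t" m] \<eta> by auto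
      then show "(\<lambda>i. integrand (X i) m x (Complex c t)) \<longlonglongrightarrow> integrand \<mu>1 m x (Complex c t)"
        by (intro integrand_tendsto[OF x] X tendsto_intros)
    qed
  qed
  have "continuous_on (cball \<mu> \<eta>) I" unfolding I_def by (intro continuous_intros c1 c2)
  then have "continuous_on (cball \<mu> \<eta> \<inter> {\<mu>'. (\<Sum>l\<in>UNIV. \<mu>' $ l) = 0}) I"
    by (rule continuous_on_subset) auto
  moreover have "bessel_j \<mu>' m x = I \<mu>'" if "\<mu>' \<in> cball \<mu> \<eta>" "(\<Sum>l\<in>UNIV. \<mu>' $ l) = 0" for \<mu>' :: "complex ^ 'n"
    unfolding bessel_j_eq[OF that(2) x cl[OF that(1)]] I_def r_def
    by (rule kernel_value_rectpath(1)[OF x cl[OF that(1)] NN[OF that(1)] cN])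
  ultimately show ?thesis by (subst continuous_on_cong[OF refl]) auto
qed

section \<open>Uniform convergence of the Fourier series\<close>

text \<open>For large |k| the term |m_l + k| / 2 pushes every pole to the left of c. The residue sum
  is then empty, and the line integral alone is O(1 / (1 + k^2)), uniformly in the ball.\<close>

lemma bessel_j_large_bound:
  fixes \<mu> :: "complex ^ 'n"
  assumes x: "x > 0" and c: "clear_line \<mu> \<eta> c" "\<And>l. c \<le> Re (\<mu> $ l) - 3"
  obtains C K where "\<And>(\<mu>' :: complex ^ 'n) k. \<mu>' \<in> cball \<mu> \<eta> \<Longrightarrow> (\<Sum>l\<in>UNIV. \<mu>' $ l) = 0 \<Longrightarrow> \<bar>k\<bar> \<ge> K \<Longrightarrow>
     norm (bessel_j \<mu>' (m + vec k) x) \<le> C * (1 / (1 + (of_int k)\<^sup>2))"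
proof -
  have \<eta>: "\<eta> > 0" "\<eta> \<le> 1 / 2" using c(1) by (auto simp: clear_line_def)
  have near: "norm (\<mu>' - \<mu>) \<le> \<eta>" if "\<mu>' \<in> cball \<mu> \<eta>" for \<mu>'
    using that by (simp add: dist_norm norm_minus_commute)
  note cl = clear_line_perturb[OF c near]
  obtain C where C: "\<And>\<mu>' k t. norm (\<mu>' - \<mu>) \<le> \<eta> \<Longrightarrow>
     norm (integrand \<mu>' (m + vec k) x (Complex c t)) \<le> C / ((1 + (of_int k)\<^sup>2) * (1 + t\<^sup>2))"
    by (rule clear_line_bound[OF c(1) x, of m]) (rule that; blast)
  define J where "J = integral UNIV (\<lambda>t::real. 1 / (1 + t\<^sup>2))"
  define K where "K = (\<Sum>l\<in>UNIV. \<bar>m $ l\<bar>) + 2 * \<lceil>norm \<mu> + 1 + \<bar>c\<bar>\<rceil>"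
  show thesis
  proof (rule that[of K "1 / (2 * pi) * (C * J)"])
    fix \<mu>' :: "complex ^ 'n" and k :: int
    assume m': "\<mu>' \<in> cball \<mu> \<eta>" and s0: "(\<Sum>l\<in>UNIV. \<mu>' $ l) = 0" and k: "\<bar>k\<bar> \<ge> K"
    have empty: "poles \<mu>' (m + vec k) \<inter> {s. c < Re s} = {}"
    proof -
      have "Re s \<le> c" if sp: "s \<in> poles \<mu>' (m + vec k)" for s
      proof -
        obtain l a where s: "s = \<mu>' $ l - of_int \<bar>(m + vec k) $ l\<bar> / 2 - of_nat a" using sp by (auto simp: poles_def)
        have "\<bar>m $ l\<bar> \<le> (\<Sum>l\<in>UNIV. \<bar>m $ l\<bar>)" by (rule member_le_sum) auto
        then have "2 * \<lceil>norm \<mu> + 1 + \<bar>c\<bar>\<rceil> \<le> \<bar>m $ l + k\<bar>" using k unfolding K_def by linarith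
        then have "real_of_int (2 * \<lceil>norm \<mu> + 1 + \<bar>c\<bar>\<rceil>) \<le> of_int \<bar>m $ l + k\<bar>" by (rule of_int_le_iff[THEN iffD2])
        then have a: "norm \<mu> + 1 + \<bar>c\<bar> \<le> of_int \<bar>m $ l + k\<bar> / 2"
          using le_of_int_ceiling[of "norm \<mu> + 1 + \<bar>c\<bar>"] unfolding of_int_mult of_int_numeral by argo
        have "Re (\<mu>' $ l) \<le> norm \<mu> + 1"
          using near[OF m'] Finite_Cartesian_Product.norm_nth_le[of \<mu>' l] norm_triangle_sub[of \<mu>' \<mu>] \<eta>
            complex_Re_le_cmod[of "\<mu>' $ l"] by linarith
        moreover have "Re s = Re (\<mu>' $ l) - of_int \<bar>m $ l + k\<bar> / 2 - of_nat a" by (simp add: s)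
        ultimately show ?thesis using a abs_ge_minus_self[of c] by linarith
      qed
      then show ?thesis by force
    qed
    have "norm (integral UNIV (\<lambda>t. integrand \<mu>' (m + vec k) x (Complex c t))) \<le>
      integral UNIV (\<lambda>t. C / (1 + (of_int k)\<^sup>2) * (1 / (1 + t\<^sup>2)))"
    proof (rule integral_norm_bound_integral)
      show "(\<lambda>t. integrand \<mu>' (m + vec k) x (Complex c t)) integrable_on UNIV"
        using clear_line_integrable[OF c(1) x near[OF m']] by (auto simp: absolutely_integrable_on_def)
      show "(\<lambda>t. C / (1 + (of_int k)\<^sup>2) * (1 / (1 + t\<^sup>2))) integrable_on UNIV"
        using integrable_inverse_one_plus_square by (rule integrable_on_mult_right)
      show "norm (integrand \<mu>' (m + vec k) x (Complex c t)) \<le> C / (1 + (of_int k)\<^sup>2) * (1 / (1 + t\<^sup>2))" for t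
        using C[OF near[OF m'], of k t] by simp
    qed
    also have "\<dots> = C / (1 + (of_int k)\<^sup>2) * J" unfolding J_def by (rule integral_mult_right)
    finally have i: "norm (integral UNIV (\<lambda>t. integrand \<mu>' (m + vec k) x (Complex c t))) \<le> C / (1 + (of_int k)\<^sup>2) * J" .
    have "bessel_j \<mu>' (m + vec k) x = 1 / (2 * of_real pi) * integral UNIV (\<lambda>t. integrand \<mu>' (m + vec k) x (Complex c t))"
      unfolding bessel_j_eq[OF s0 x cl[OF m']] kernel_value_def empty by simp
    then have "norm (bessel_j \<mu>' (m + vec k) x) = 1 / (2 * pi) * norm (integral UNIV (\<lambda>t. integrand \<mu>' (m + vec k) x (Complex c t)))"
      by (simp add: norm_mult norm_divide)
    also have "\<dots> \<le> 1 / (2 * pi) * (C / (1 + (of_int k)\<^sup>2) * J)" by (intro mult_left_mono i) auto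
    finally show "norm (bessel_j \<mu>' (m + vec k) x) \<le> 1 / (2 * pi) * (C * J) * (1 / (1 + (of_int k)\<^sup>2))" by simp
  qed
qed

lemma summable_on_inverse_one_plus_square_int:
  "(\<lambda>k::int. 1 / (1 + (real_of_int k)\<^sup>2)) summable_on UNIV"
proof -
  have "summable (\<lambda>n::nat. norm (1 / (1 + (real n)\<^sup>2)))"
  proof (rule summable_comparison_test'[of "\<lambda>n. 1 / (real n)\<^sup>2" 1])
    show "summable (\<lambda>n. 1 / (real n)\<^sup>2)"
      using inverse_power_summable[of 2, where 'a = real] by (simp add: inverse_eq_divide)
    show "norm (norm (1 / (1 + (real n)\<^sup>2))) \<le> 1 / (real n)\<^sup>2" if "n \<ge> 1" for n
      using that by (auto simp: abs_of_pos add_pos_nonneg intro!: divide_left_mono)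
  qed
  then have s: "(\<lambda>n::nat. 1 / (1 + (real n)\<^sup>2)) summable_on UNIV" by (rule norm_summable_imp_summable_on)
  have 1: "(\<lambda>k::int. 1 / (1 + (real_of_int k)\<^sup>2)) summable_on range int"
    by (subst summable_on_reindex) (use s in \<open>auto simp: o_def\<close>)
  have 2: "(\<lambda>k::int. 1 / (1 + (real_of_int k)\<^sup>2)) summable_on range (\<lambda>n. - int n)"
    by (subst summable_on_reindex) (use s in \<open>auto simp: o_def inj_on_def\<close>)
  have "(\<lambda>k::int. 1 / (1 + (real_of_int k)\<^sup>2)) summable_on (range int \<union> (range (\<lambda>n. - int n) - range int))"
    by (intro summable_on_Un_disjoint 1 summable_on_subset[OF 2]) auto
  moreover have "range int \<union> (range (\<lambda>n. - int n) - range int) = UNIV"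
    by (auto simp: image_iff) (metis int_cases2)
  ultimately show ?thesis by simp
qed

lemma continuous_on_bessel_kernel:
  fixes \<mu> :: "complex ^ 'n"
  assumes z: "z \<noteq> 0" and c: "clear_line \<mu> \<eta> c" "\<And>l. c \<le> Re (\<mu> $ l) - 3"
  shows "continuous_on (cball \<mu> \<eta> \<inter> {\<mu>'. (\<Sum>l\<in>UNIV. \<mu>' $ l) = 0}) (\<lambda>\<mu>'. bessel_kernel \<mu>' m z)"
proof -
  let ?Y = "cball \<mu> \<eta> \<inter> {\<mu>'. (\<Sum>l\<in>UNIV. \<mu>' $ l) = 0}"
  have x: "norm z > 0" using z by simp
  have "closed {\<mu>' :: complex ^ 'n. (\<Sum>l\<in>UNIV. \<mu>' $ l) = 0}"
    by (intro closed_Collect_eq continuous_intros)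
  then have Y: "compact ?Y" by (intro compact_Int_closed compact_cball)
  define f where "f k \<mu>' = bessel_j \<mu>' (m + vec k) (norm z) * exp (\<i> * of_int k * of_real (Arg z))" for k \<mu>'
  have fn: "norm (f k \<mu>') = norm (bessel_j \<mu>' (m + vec k) (norm z))" for k \<mu>'
    by (simp add: f_def norm_mult norm_exp_eq_Re)
  have cf: "continuous_on ?Y (f k)" for k
    unfolding f_def by (intro continuous_intros continuous_on_bessel_j[OF x c])
  obtain C K where CK: "\<And>(\<mu>' :: complex ^ 'n) k. \<mu>' \<in> cball \<mu> \<eta> \<Longrightarrow> (\<Sum>l\<in>UNIV. \<mu>' $ l) = 0 \<Longrightarrow> \<bar>k\<bar> \<ge> K \<Longrightarrow>
     norm (bessel_j \<mu>' (m + vec k) (norm z)) \<le> C * (1 / (1 + (of_int k)\<^sup>2))"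
    by (rule bessel_j_large_bound[OF x c, of m]) (rule that; blast)
  have "\<exists>b. \<forall>\<mu>'\<in>?Y. norm (f k \<mu>') \<le> b" for k
    using compact_imp_bounded[OF compact_continuous_image[OF cf[of k] Y]] unfolding bounded_iff by auto
  then obtain b where b: "\<And>k \<mu>'. \<mu>' \<in> ?Y \<Longrightarrow> norm (f k \<mu>') \<le> b k" by metis
  \<comment> \<open>The second summand covers the indices below the threshold K, where only
    compactness gives a bound.\<close>
  define M where "M k = \<bar>C\<bar> * (1 / (1 + (real_of_int k)\<^sup>2)) + (if k \<in> {- K..K} then \<bar>b k\<bar> else 0)" for k
  have "M summable_on UNIV" unfolding M_def
  proof (intro summable_on_add summable_on_cmult_right summable_on_inverse_one_plus_square_int)
    have "(\<lambda>k. \<bar>b k\<bar>) summable_on {- K..K}" by (rule summable_on_finite) auto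
    then show "(\<lambda>k. if k \<in> {- K..K} then \<bar>b k\<bar> else 0) summable_on UNIV"
      by (rule summable_on_cong_neutral[THEN iffD1, rotated -1]) auto
  qed
  moreover have "norm (f k \<mu>') \<le> M k" if "\<mu>' \<in> ?Y" for k \<mu>'
  proof (cases "k \<in> {- K..K}")
    case True
    have "norm (f k \<mu>') \<le> \<bar>b k\<bar>" using b[OF that, of k] by linarith
    moreover have "0 \<le> \<bar>C\<bar> * (1 / (1 + (real_of_int k)\<^sup>2))" by auto
    ultimately show ?thesis unfolding M_def if_P[OF True] by linarith
  next
    case False
    then have "\<bar>k\<bar> \<ge> K" by auto
    then have "norm (f k \<mu>') \<le> C * (1 / (1 + (of_int k)\<^sup>2))" unfolding fn using that CK by auto
    also have "\<dots> \<le> \<bar>C\<bar> * (1 / (1 + (of_int k)\<^sup>2))" by (intro mult_right_mono) auto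
    finally show ?thesis unfolding M_def if_not_P[OF False] by linarith
  qed
  ultimately have "uniform_limit ?Y (\<lambda>X \<mu>'. \<Sum>k\<in>X. f k \<mu>') (\<lambda>\<mu>'. \<Sum>\<^sub>\<infinity>k\<in>UNIV. f k \<mu>') (finite_subsets_at_top UNIV)"
    by (intro Weierstrass_m_test_general[where M = M]) auto
  then have "continuous_on ?Y (\<lambda>\<mu>'. \<Sum>\<^sub>\<infinity>k\<in>UNIV. f k \<mu>')"
    by (rule uniform_limit_theorem[rotated]) (auto intro!: always_eventually continuous_on_sum cf)
  then show ?thesis unfolding bessel_kernel_def f_def by (intro continuous_intros)
qed

subsection \<open>Residue series for generic parameters\<close>

text \<open>Far to the left both linear factors that each index gains under the shift are large, so
  together they outweigh (2 pi)^2 and x^2.\<close>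

lemma integrand_halving:
  fixes \<mu> :: "complex ^ 'n"
  assumes x: "x > 0"
  obtains c0 where "\<And>s. Re s \<le> c0 \<Longrightarrow> s - 1 \<notin> poles \<mu> m \<Longrightarrow>
    norm (integrand \<mu> m x (s - 1)) \<le> norm (integrand \<mu> m x s) / 2"
proof -
  define N where "N = (\<Sum>l\<in>UNIV. norm (\<mu> $ l) + of_int \<bar>m $ l\<bar>)"
  have Nl: "norm (\<mu> $ l) + of_int \<bar>m $ l\<bar> \<le> N" for l
    unfolding N_def by (rule member_le_sum) auto
  \<comment> \<open>Satisfies 2 x^2 \<le> Q \<le> Q^2, hence x^2 / Q^2 \<le> 1/2; to the left of
    \<open>c0\<close> each linear factor has modulus at least 2 pi Q.\<close>
  define Q where "Q = 1 + 2 * x\<^sup>2"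
  have Q: "Q \<ge> 1" by (simp add: Q_def)
  define c0 where "c0 = - N - 1 - 2 * pi * Q"
  show thesis
  proof (rule that[of c0])
    fix s assume s: "Re s \<le> c0" "s - 1 \<notin> poles \<mu> m"
    have pQ: "2 * pi * Q > 0" using Q pi_gt_zero by (intro mult_pos_pos) auto
    have b: "Re (\<mu> $ l) \<le> N - of_int \<bar>m $ l\<bar>" "- Re (\<mu> $ l) \<le> N - of_int \<bar>m $ l\<bar>" "0 \<le> real_of_int \<bar>m $ l\<bar>" for l
      using Nl[of l] abs_Re_le_cmod[of "\<mu> $ l"] by auto
    have v: "norm (s - \<mu> $ l + of_int \<bar>m $ l\<bar> / 2 - 1) \<ge> 2 * pi * Q" for l
    proof -
      have "- Re (s - \<mu> $ l + of_int \<bar>m $ l\<bar> / 2 - 1) = - Re s + Re (\<mu> $ l) - of_int \<bar>m $ l\<bar> / 2 + 1" by simp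
      then have "2 * pi * Q \<le> - Re (s - \<mu> $ l + of_int \<bar>m $ l\<bar> / 2 - 1)"
        using s(1) b[of l] unfolding c0_def by argo
      then show ?thesis using abs_Re_le_cmod[of "s - \<mu> $ l + of_int \<bar>m $ l\<bar> / 2 - 1"] by linarith
    qed
    have w: "norm (1 - (s - \<mu> $ l) + of_int \<bar>m $ l\<bar> / 2) \<ge> 2 * pi * Q" for l
    proof -
      have "Re (1 - (s - \<mu> $ l) + of_int \<bar>m $ l\<bar> / 2) = 1 - Re s + Re (\<mu> $ l) + of_int \<bar>m $ l\<bar> / 2" by simp
      then have "2 * pi * Q \<le> Re (1 - (s - \<mu> $ l) + of_int \<bar>m $ l\<bar> / 2)"
        using s(1) b[of l] unfolding c0_def by argo
      then show ?thesis using complex_Re_le_cmod[of "1 - (s - \<mu> $ l) + of_int \<bar>m $ l\<bar> / 2"] by linarith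
    qed
    have w0: "1 - (s - \<mu> $ l) + of_int \<bar>m $ l\<bar> / 2 \<noteq> 0" for l using w[of l] pQ by auto
    have fac: "norm (of_real (2 * pi) ^ 2 /
        ((s - \<mu> $ l + of_int \<bar>m $ l\<bar> / 2 - 1) * (1 - (s - \<mu> $ l) + of_int \<bar>m $ l\<bar> / 2))) \<le> 1 / Q\<^sup>2" for l
    proof -
      have "(2 * pi * Q) * (2 * pi * Q) \<le> norm (s - \<mu> $ l + of_int \<bar>m $ l\<bar> / 2 - 1) * norm (1 - (s - \<mu> $ l) + of_int \<bar>m $ l\<bar> / 2)"
        using v[of l] w[of l] pQ by (intro mult_mono) auto
      then have "(2 * pi)\<^sup>2 / (norm (s - \<mu> $ l + of_int \<bar>m $ l\<bar> / 2 - 1) * norm (1 - (s - \<mu> $ l) + of_int \<bar>m $ l\<bar> / 2))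
         \<le> (2 * pi)\<^sup>2 / ((2 * pi * Q) * (2 * pi * Q))"
        by (rule divide_left_mono) (rule zero_le_power2 mult_pos_pos less_le_trans[OF pQ v] less_le_trans[OF pQ w] pQ)+
      also have "\<dots> = 1 / Q\<^sup>2" using Q by (simp add: power2_eq_square)
      finally show ?thesis by (simp add: norm_divide norm_mult norm_power)
    qed
    have "norm (\<Prod>l\<in>UNIV. of_real (2 * pi) ^ 2 /
        ((s - \<mu> $ l + of_int \<bar>m $ l\<bar> / 2 - 1) * (1 - (s - \<mu> $ l) + of_int \<bar>m $ l\<bar> / 2))) \<le> (\<Prod>l\<in>(UNIV :: 'n set). 1 / Q\<^sup>2)"
      unfolding prod_norm[symmetric] by (intro prod_mono conjI fac norm_ge_zero)
    also have "\<dots> = (1 / Q\<^sup>2) ^ CARD('n)" by simp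
    also have "\<dots> \<le> (1 / Q\<^sup>2) ^ 1" using Q by (intro power_decreasing) (auto simp: Suc_le_eq)
    finally have pr: "norm (\<Prod>l\<in>UNIV. of_real (2 * pi) ^ 2 /
        ((s - \<mu> $ l + of_int \<bar>m $ l\<bar> / 2 - 1) * (1 - (s - \<mu> $ l) + of_int \<bar>m $ l\<bar> / 2))) \<le> 1 / Q\<^sup>2" by simp
    have "norm (integrand \<mu> m x (s - 1)) = norm (integrand \<mu> m x s) * (x\<^sup>2 * norm (\<Prod>l\<in>UNIV. of_real (2 * pi) ^ 2 /
        ((s - \<mu> $ l + of_int \<bar>m $ l\<bar> / 2 - 1) * (1 - (s - \<mu> $ l) + of_int \<bar>m $ l\<bar> / 2))))"
      using integrand_shift[OF x s(2) w0] by (simp add: norm_mult norm_power)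
    also have "\<dots> \<le> norm (integrand \<mu> m x s) * (x\<^sup>2 * (1 / Q\<^sup>2))"
      by (intro mult_left_mono pr) auto
    also have "\<dots> \<le> norm (integrand \<mu> m x s) * (1 / 2)"
    proof (intro mult_left_mono)
      have "2 * x\<^sup>2 \<le> Q" by (simp add: Q_def)
      also have "Q \<le> Q\<^sup>2" using Q by (simp add: power2_eq_square)
      finally show "x\<^sup>2 * (1 / Q\<^sup>2) \<le> 1 / 2" using Q by (simp add: field_simps)
    qed auto
    finally show "norm (integrand \<mu> m x (s - 1)) \<le> norm (integrand \<mu> m x s) / 2" by simp
  qed
qed

text \<open>The half-integers are invariant under integer translations: moving by M replaces q by q
  - 2 M.\<close>

lemma clear_line_shift:
  assumes "clear_line \<mu> \<eta> c"
  shows "clear_line \<mu> \<eta> (c - real M)"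
proof -
  have "2 * \<eta> \<le> \<bar>c - real M - Re (\<mu> $ l) + of_int q / 2\<bar>" for l and q :: int
  proof -
    have "2 * \<eta> \<le> \<bar>c - Re (\<mu> $ l) + of_int (q - 2 * int M) / 2\<bar>" using assms unfolding clear_line_def by blast
    moreover have "c - Re (\<mu> $ l) + of_int (q - 2 * int M) / 2 = c - real M - Re (\<mu> $ l) + of_int q / 2"
      by (simp add: field_simps)
    ultimately show ?thesis by (simp only:)
  qed
  moreover have "c - real M \<le> Re (\<mu> $ l) - 2" for l
  proof -
    have "c \<le> Re (\<mu> $ l) - 2" using assms unfolding clear_line_def by blast
    then show ?thesis using of_nat_0_le_iff[of M] by linarith
  qed
  ultimately show ?thesis using assms unfolding clear_line_def by blast
qed

text \<open>\<open>bessel_j\<close> equals \<open>kernel_value\<close> on each of the lines c - M,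
  so the partial residue sums miss it only by a line integral, which is bounded by J / 2^M.
  Convergence is along growing half-planes; nothing is claimed yet about absolute
  summability.\<close>

lemma residue_sums_tendsto:
  fixes \<mu> :: "complex ^ 'n"
  assumes sum0: "(\<Sum>l\<in>UNIV. \<mu> $ l) = 0" and x: "x > 0"
  obtains c where "(\<lambda>M. \<Sum>w\<in>poles \<mu> m \<inter> {s. Re s > c - real M}. residue (integrand \<mu> m x) w) \<longlonglongrightarrow> bessel_j \<mu> m x"
proof -
  obtain c0 where c0: "\<And>s. Re s \<le> c0 \<Longrightarrow> s - 1 \<notin> poles \<mu> m \<Longrightarrow>
    norm (integrand \<mu> m x (s - 1)) \<le> norm (integrand \<mu> m x s) / 2"
    by (rule integrand_halving[OF x, of \<mu> m]) (rule that; blast)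
  obtain c \<eta> where c: "c < c0" "clear_line \<mu> \<eta> c" by (rule exists_clear_line)
  have \<eta>: "\<eta> > 0" using c(2) by (simp add: clear_line_def)
  define L where "L M = integral UNIV (\<lambda>t. integrand \<mu> m x (Complex (c - real M) t))" for M
  define J where "J = integral UNIV (\<lambda>t. norm (integrand \<mu> m x (Complex c t)))"
  have h: "norm (integrand \<mu> m x (Complex (c - real M) t)) \<le> norm (integrand \<mu> m x (Complex c t)) / 2 ^ M" for M t
  proof (induction M)
    case (Suc M)
    have e: "Complex (c - real (Suc M)) t = Complex (c - real M) t - 1" by (simp add: complex_eq_iff)
    have "Complex (c - real M) t - 1 \<notin> poles \<mu> m"
      using clear_line_near[OF clear_line_shift[OF c(2), of "Suc M"], of \<mu> "Complex (c - real M) t - 1" m] \<eta> by auto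
    then have "norm (integrand \<mu> m x (Complex (c - real (Suc M)) t)) \<le> norm (integrand \<mu> m x (Complex (c - real M) t)) / 2"
      unfolding e using c(1) by (intro c0) auto
    then show ?case using Suc by simp
  qed simp
  have ai: "(\<lambda>t. integrand \<mu> m x (Complex (c - real M) t)) absolutely_integrable_on UNIV" for M
    by (rule clear_line_integrable[OF clear_line_shift[OF c(2)] x]) (use \<eta> in simp)
  have Lb: "norm (L M) \<le> J * (1 / 2) ^ M" for M
  proof -
    have "norm (L M) \<le> integral UNIV (\<lambda>t. norm (integrand \<mu> m x (Complex c t)) / 2 ^ M)"
      unfolding L_def
    proof (rule integral_norm_bound_integral)
      show "(\<lambda>t. norm (integrand \<mu> m x (Complex c t)) / 2 ^ M) integrable_on UNIV"
        using ai[of 0] by (intro integrable_on_divide) (auto simp: absolutely_integrable_on_def)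
    qed (use ai[of M] h in \<open>auto simp: absolutely_integrable_on_def\<close>)
    also have "\<dots> = J / 2 ^ M" unfolding J_def by (rule integral_divide)
    finally show ?thesis by (simp add: power_divide)
  qed
  have "L \<longlonglongrightarrow> 0"
  proof (rule Lim_null_comparison[OF always_eventually[OF allI[OF Lb]]])
    have "(\<lambda>M. J * (1 / 2) ^ M) \<longlonglongrightarrow> J * 0" by (intro tendsto_mult tendsto_const LIMSEQ_power_zero) auto
    then show "(\<lambda>M. J * (1 / 2) ^ M) \<longlonglongrightarrow> 0" by simp
  qed
  then have "(\<lambda>M. bessel_j \<mu> m x - 1 / (2 * of_real pi) * L M) \<longlonglongrightarrow> bessel_j \<mu> m x - 1 / (2 * of_real pi) * 0"
    by (intro tendsto_intros)
  moreover have "bessel_j \<mu> m x - 1 / (2 * of_real pi) * L M =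
      (\<Sum>w\<in>poles \<mu> m \<inter> {s. Re s > c - real M}. residue (integrand \<mu> m x) w)" for M
    unfolding bessel_j_eq[OF sum0 x clear_line_shift[OF c(2), of M]] kernel_value_def L_def by simp
  ultimately show thesis by (intro that) simp
qed

section \<open>Enumeration of the poles and genericity\<close>

definition pole_at :: "complex ^ 'n \<Rightarrow> int ^ 'n \<Rightarrow> 'n \<Rightarrow> nat \<Rightarrow> complex" where
  "pole_at \<mu> m l a = \<mu> $ l - of_int \<bar>m $ l\<bar> / 2 - of_nat a"

lemma generic_add_vec: "generic \<mu> (m + vec k) \<longleftrightarrow> generic \<mu> m"
  by (simp add: generic_def)

text \<open>|a - b| and |a| - |b| have the same parity. This relates |m_l - m_k| in
  \<open>generic\<close> to the single |m_l| that locate the poles.\<close>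

lemma abs_int_shift: "\<exists>r::int. of_int \<bar>a - b\<bar> = (of_int \<bar>a\<bar> - of_int \<bar>b\<bar> :: complex) + 2 * of_int r" for a b :: int
proof -
  have "even (\<bar>a - b\<bar> - (\<bar>a\<bar> - \<bar>b\<bar>))" by (auto simp: abs_if)
  then obtain r where "\<bar>a - b\<bar> - (\<bar>a\<bar> - \<bar>b\<bar>) = 2 * r" by (elim evenE)
  then have "\<bar>a - b\<bar> = (\<bar>a\<bar> - \<bar>b\<bar>) + 2 * r" by simp
  then have "(of_int \<bar>a - b\<bar> :: complex) = of_int ((\<bar>a\<bar> - \<bar>b\<bar>) + 2 * r)" by simp
  then show ?thesis by (intro exI[of _ r]) (simp only: of_int_add of_int_diff of_int_mult of_int_numeral)
qed

text \<open>The two forms in which genericity is used: the first keeps the poles of different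
  indices apart, the second keeps the sines in \<open>S_coeff\<close> away from 0.\<close>

lemma generic_not_int:
  fixes \<mu> :: "complex ^ 'n"
  assumes "generic \<mu> m" "l \<noteq> k"
  shows "\<mu> $ l - \<mu> $ k - (of_int \<bar>m $ l\<bar> - of_int \<bar>m $ k\<bar>) / 2 \<notin> \<int>"
    and "\<mu> $ l - \<mu> $ k - of_int (m $ l - m $ k) / 2 \<notin> \<int>"
proof -
  have g: "2 * (\<mu> $ l - \<mu> $ k) - of_int \<bar>m $ l - m $ k\<bar> \<noteq> 2 * of_int q" for q
    using assms unfolding generic_def by blast
  obtain r where r: "of_int \<bar>m $ l - m $ k\<bar> = (of_int \<bar>m $ l\<bar> - of_int \<bar>m $ k\<bar> :: complex) + 2 * of_int r"
    using abs_int_shift by blast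
  show "\<mu> $ l - \<mu> $ k - (of_int \<bar>m $ l\<bar> - of_int \<bar>m $ k\<bar>) / 2 \<notin> \<int>"
  proof
    assume "\<mu> $ l - \<mu> $ k - (of_int \<bar>m $ l\<bar> - of_int \<bar>m $ k\<bar>) / 2 \<in> \<int>"
    then obtain q where "\<mu> $ l - \<mu> $ k - (of_int \<bar>m $ l\<bar> - of_int \<bar>m $ k\<bar>) / 2 = of_int q" by (auto elim: Ints_cases)
    then show False using g[of "q - r"] r by (simp add: field_simps)
  qed
  have c: "(of_int \<bar>m $ l - m $ k\<bar> :: complex) = of_int (m $ l - m $ k) \<or> (of_int \<bar>m $ l - m $ k\<bar> :: complex) = - of_int (m $ l - m $ k)"
    by (cases "m $ l - m $ k \<ge> 0") auto
  show "\<mu> $ l - \<mu> $ k - of_int (m $ l - m $ k) / 2 \<notin> \<int>"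
  proof
    assume "\<mu> $ l - \<mu> $ k - of_int (m $ l - m $ k) / 2 \<in> \<int>"
    then obtain q where "\<mu> $ l - \<mu> $ k = of_int (m $ l - m $ k) / 2 + of_int q" by (auto elim!: Ints_cases simp: algebra_simps)
    then have "2 * (\<mu> $ l - \<mu> $ k) = of_int (m $ l - m $ k) + 2 * of_int q" by simp
    then show False using c g[of q] g[of "q + (m $ l - m $ k)"] by auto
  qed
qed

text \<open>Genericity makes \<open>pole_at\<close> injective, so the sum over a half-plane splits
  into finite sums over l. The assumed unordered summability identifies their limits; it is supplied
  later by the product of the two Bessel series.\<close>

lemma bessel_j_generic:
  fixes \<mu> :: "complex ^ 'n"
  assumes sum0: "(\<Sum>l\<in>UNIV. \<mu> $ l) = 0" and x: "x > 0" and gen: "generic \<mu> m"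
    and summ: "\<And>l. (\<lambda>a. residue (integrand \<mu> m x) (pole_at \<mu> m l a)) summable_on UNIV"
  shows "bessel_j \<mu> m x = (\<Sum>l\<in>UNIV. \<Sum>\<^sub>\<infinity>a\<in>UNIV. residue (integrand \<mu> m x) (pole_at \<mu> m l a))"
proof -
  let ?R = "\<lambda>l a. residue (integrand \<mu> m x) (pole_at \<mu> m l a)"
  obtain c where c: "(\<lambda>M. \<Sum>w\<in>poles \<mu> m \<inter> {s. Re s > c - real M}. residue (integrand \<mu> m x) w) \<longlonglongrightarrow> bessel_j \<mu> m x"
    by (rule residue_sums_tendsto[OF sum0 x])
  define A where "A M l = {a. Re (pole_at \<mu> m l a) > c - real M}" for M l
  have fA: "finite (A M l)" for M l
  proof (rule finite_subset)
    show "A M l \<subseteq> {..nat \<lceil>Re (pole_at \<mu> m l 0) - c + real M\<rceil>}"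
    proof
      fix a assume "a \<in> A M l"
      then have "real a < Re (pole_at \<mu> m l 0) - c + real M" by (simp add: A_def pole_at_def)
      then show "a \<in> {..nat \<lceil>Re (pole_at \<mu> m l 0) - c + real M\<rceil>}" by simp linarith
    qed
  qed auto
  have inj: "l = k \<and> a = b" if "pole_at \<mu> m l a = pole_at \<mu> m k b" for l k a b
  proof -
    have "l = k"
    proof (rule ccontr)
      assume "l \<noteq> k"
      moreover have "\<mu> $ l - \<mu> $ k - (of_int \<bar>m $ l\<bar> - of_int \<bar>m $ k\<bar>) / 2 = of_int (int a - int b)"
        using that by (simp add: pole_at_def algebra_simps diff_divide_distrib)
      ultimately show False using generic_not_int(1)[OF gen, of l k] by simp
    qed
    then show ?thesis using that by (simp add: pole_at_def)
  qed
  have "(\<Sum>w\<in>poles \<mu> m \<inter> {s. Re s > c - real M}. residue (integrand \<mu> m x) w) = (\<Sum>l\<in>UNIV. \<Sum>a\<in>A M l. ?R l a)" for M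
  proof -
    have "(\<Sum>l\<in>UNIV. \<Sum>a\<in>A M l. ?R l a) = (\<Sum>(l, a)\<in>Sigma UNIV (A M). ?R l a)"
      by (rule sum.Sigma) (auto simp: fA)
    also have "\<dots> = (\<Sum>w\<in>(\<lambda>(l, a). pole_at \<mu> m l a) ` Sigma UNIV (A M). residue (integrand \<mu> m x) w)"
      by (subst sum.reindex) (auto simp: inj_on_def case_prod_unfold dest: inj)
    also have "(\<lambda>(l, a). pole_at \<mu> m l a) ` Sigma UNIV (A M) = poles \<mu> m \<inter> {s. Re s > c - real M}"
      by (force simp: A_def poles_def pole_at_def)
    finally show ?thesis ..
  qed
  with c have "(\<lambda>M. \<Sum>l\<in>UNIV. \<Sum>a\<in>A M l. ?R l a) \<longlonglongrightarrow> bessel_j \<mu> m x" by simp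
  moreover have "(\<lambda>M. \<Sum>l\<in>UNIV. \<Sum>a\<in>A M l. ?R l a) \<longlonglongrightarrow> (\<Sum>l\<in>UNIV. \<Sum>\<^sub>\<infinity>a\<in>UNIV. ?R l a)"
  proof (intro tendsto_sum)
    fix l :: 'n
    have "(?R l has_sum (\<Sum>\<^sub>\<infinity>a\<in>UNIV. ?R l a)) UNIV" by (intro has_sum_infsum summ)
    \<comment> \<open>The index sets cut out by the half-planes exhaust the natural numbers, so they
      form a cofinal family of finite sets.\<close>
    moreover have "filterlim (\<lambda>M. A M l) (finite_subsets_at_top UNIV) sequentially"
      unfolding filterlim_finite_subsets_at_top
    proof (intro allI impI)
      fix X :: "nat set" assume X: "finite X \<and> X \<subseteq> UNIV"
      have "\<forall>\<^sub>F M in sequentially. Re (pole_at \<mu> m l a) > c - real M" for a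
      proof -
        have "\<forall>\<^sub>F M in sequentially. real M > c - Re (pole_at \<mu> m l a)"
          using filterlim_real_sequentially by (simp add: filterlim_at_top_dense)
        then show ?thesis by eventually_elim simp
      qed
      then have "\<forall>\<^sub>F M in sequentially. \<forall>a\<in>X. Re (pole_at \<mu> m l a) > c - real M"
        using X by (intro eventually_ball_finite) auto
      then show "\<forall>\<^sub>F M in sequentially. finite (A M l) \<and> X \<subseteq> A M l \<and> A M l \<subseteq> UNIV"
        by eventually_elim (use fA in \<open>auto simp: A_def\<close>)
    qed
    ultimately show "(\<lambda>M. \<Sum>a\<in>A M l. ?R l a) \<longlonglongrightarrow> (\<Sum>\<^sub>\<infinity>a\<in>UNIV. ?R l a)"
      unfolding has_sum_def by (rule filterlim_compose)
  qed
  ultimately show ?thesis by (rule LIMSEQ_unique)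
qed

section \<open>Reflection formula, signs and the residue of a single factor\<close>

lemma sin_half_shift:
  fixes y :: complex and d :: int
  shows "sin (of_real pi * (y + of_int d / 2)) = (- 1) powi d * sin (of_real pi * (y - of_int d / 2))"
proof -
  have "of_real pi * (y + of_int d / 2) = of_real pi * (y - of_int d / 2) + of_real (pi * of_int d)"
    by (simp add: algebra_simps)
  moreover have "sin (complex_of_real (pi * of_int d)) = 0" "cos (complex_of_real (pi * of_int d)) = (- 1) powi d"
    unfolding sin_of_real cos_of_real by (auto simp: power_int_minus_left)
  ultimately show ?thesis by (simp only: sin_add) simp
qed

text \<open>
  The left-hand side depends on \<open>p\<close> only through its absolute value, so for negative \<open>p\<close> the reflection
  formula is applied at \<open>u - p / 2\<close> instead of \<open>u + p / 2\<close>.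
\<close>

lemma Gamma_quotient_reflection:
  fixes u :: complex and p :: int
  assumes "u + of_int p / 2 \<notin> \<int>"
  shows "\<i> ^ nat \<bar>p\<bar> * (Gamma (u + of_int \<bar>p\<bar> / 2) * rGamma (1 - u + of_int \<bar>p\<bar> / 2)) =
    of_real pi * (\<i> powi p / sin (of_real pi * (u + of_int p / 2))) *
      (rGamma (1 - u - of_int p / 2) * rGamma (1 - u + of_int p / 2))"
proof -
  have refl: "Gamma w = of_real pi / sin (of_real pi * w) * rGamma (1 - w)" if "w \<notin> \<int>" for w :: complex
  proof -
    have "1 - w \<notin> \<int>" using that by (metis Ints_1 Ints_diff diff_diff_eq2 add_diff_cancel_left')
    then have "Gamma (1 - w) \<noteq> 0" by (auto simp: Gamma_eq_zero_iff elim: nonpos_Ints_cases)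
    then have "Gamma w = of_real pi / sin (of_real pi * w) / Gamma (1 - w)"
      by (metis Gamma_reflection_complex nonzero_mult_div_cancel_right)
    then show ?thesis by (simp add: rGamma_inverse_Gamma divide_inverse)
  qed
  have arg: "1 - (u + of_int p / 2) = 1 - u - of_int p / 2" "1 - (u - of_int p / 2) = 1 - u + of_int p / 2" by simp_all
  show ?thesis
  proof (cases "p \<ge> 0")
    case True
    then have "\<bar>p\<bar> = p" "\<i> ^ nat \<bar>p\<bar> = \<i> powi p" by (auto simp: power_int_def)
    then show ?thesis using refl[OF assms] unfolding arg by simp
  next
    case False
    then have p: "\<bar>p\<bar> = - p" "\<i> ^ nat (- p) = \<i> powi (- p)" by (auto simp: power_int_def)
    have eq: "u - of_int p / 2 = (u + of_int p / 2) - of_int p" by simp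
    have n: "u - of_int p / 2 \<notin> \<int>" unfolding eq using assms by (metis Ints_add Ints_of_int diff_add_cancel)
    note sin_half_shift[of u p]
    \<comment> \<open>The power of \<i> and the sine acquire the same sign (-1)^p when p is replaced
      by -p, so their quotient is unchanged.\<close>
    moreover have "\<i> powi p = (- 1) powi p * \<i> powi (- p)"
    proof -
      have "(- 1) powi p = (\<i> * \<i>) powi p" by simp
      also have "\<dots> = \<i> powi p * \<i> powi p" by (rule power_int_mult_distrib)
      finally show ?thesis by (simp add: power_int_minus)
    qed
    ultimately have "\<i> powi p / sin (of_real pi * (u + of_int p / 2)) = \<i> powi (- p) / sin (of_real pi * (u - of_int p / 2))"
      by simp
    then show ?thesis using refl[OF n] unfolding arg p by simp
  qed
qed

text \<open>Changing \<epsilon> multiplies the power of \<i> and the sine by the same sign, (-1) to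
  the power m_l - m_k. Where a sine vanishes, both quotients have the default value 0.\<close>

lemma S_coeff_sign:
  fixes \<mu> :: "complex ^ 'n"
  shows "S_coeff 1 \<mu> m l = S_coeff (- 1) \<mu> m l"
  unfolding S_coeff_def
proof (intro prod.cong refl)
  fix k
  let ?d = "m $ l - m $ k" and ?y = "\<mu> $ l - \<mu> $ k"
  have "sin (of_real pi * (?y + 1 * (of_int ?d / 2))) = (- 1) powi ?d * sin (of_real pi * (?y + - 1 * (of_int ?d / 2)))"
    using sin_half_shift[of ?y ?d] by (simp only: mult_1_left mult_minus1 diff_conv_add_uminus)
  moreover have "(1 * \<i>) powi ?d = (- 1) powi ?d * (- 1 * \<i>) powi ?d"
    using power_int_mult_distrib[of "- 1" "- 1 * \<i>" ?d] by simp
  ultimately show "(1 * \<i>) powi ?d / sin (of_real pi * (?y + 1 * (of_int ?d / 2))) =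
      (- 1 * \<i>) powi ?d / sin (of_real pi * (?y + - 1 * (of_int ?d / 2)))" by simp
qed

text \<open>The pole \<open>- (\<alpha> + \<beta>) / 2\<close> is \<open>- \<bar>p\<bar> / 2 - min \<alpha> \<beta>\<close>.\<close>

lemma gamma_factor1_residue:
  fixes \<alpha> \<beta> :: nat
  defines "p \<equiv> int \<alpha> - int \<beta>"
  shows "((\<lambda>u. gamma_factor1 p u * (u + of_nat (\<alpha> + \<beta>) / 2)) \<longlongrightarrow>
     \<i> ^ (\<alpha> + \<beta>) * of_real (2 * pi) powr (1 + of_nat (\<alpha> + \<beta>)) * (rGamma (of_nat \<alpha> + 1) * rGamma (of_nat \<beta> + 1)))
     (at (- of_nat (\<alpha> + \<beta>) / 2))"
proof -
  define a where "a = min \<alpha> \<beta>"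
  define q where "q = nat \<bar>p\<bar>"
  define u0 where "u0 = - of_nat (\<alpha> + \<beta>) / (2 :: complex)"
  have q: "of_int \<bar>p\<bar> = (of_nat q :: complex)" unfolding q_def by (subst of_nat_nat) (rule abs_ge_zero refl)+
  have qa: "\<alpha> + \<beta> = q + 2 * a" by (auto simp: q_def p_def a_def min_def)
  have u0: "u0 + of_nat q / 2 = - of_nat a" "1 - u0 + of_nat q / 2 = of_nat (q + a) + 1"
    unfolding u0_def qa by (simp_all add: field_simps)
  have "((\<lambda>z. Gamma z * (z + of_nat a)) \<longlongrightarrow> (- 1) ^ a / fact a) (at (- of_nat a))" by (rule Gamma_residues)
  moreover have "filterlim (\<lambda>u. u + of_nat q / 2) (at (- of_nat a)) (at u0)"
    unfolding filterlim_at u0(1)[symmetric] by (intro conjI tendsto_intros) (auto simp: eventually_at_filter)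
  ultimately have g: "((\<lambda>u. Gamma (u + of_nat q / 2) * (u + of_nat q / 2 + of_nat a)) \<longlongrightarrow> (- 1) ^ a / fact a) (at u0)"
    by (rule filterlim_compose)
  have twopi: "complex_of_real (2 * pi) \<notin> \<real>\<^sub>\<le>\<^sub>0" by (subst nonpos_Reals_of_real_iff) (simp add: not_le)
  have r: "((\<lambda>u. rGamma (1 - u + of_nat q / 2)) \<longlongrightarrow> rGamma (1 - u0 + of_nat q / 2)) (at u0)"
    by (rule isCont_tendsto_compose[OF isCont_rGamma[OF continuous_ident]]) (intro tendsto_intros)
  have "((\<lambda>u. \<i> ^ q * of_real (2 * pi) powr (1 - 2 * u) * (Gamma (u + of_nat q / 2) * (u + of_nat q / 2 + of_nat a)) *
      rGamma (1 - u + of_nat q / 2)) \<longlongrightarrow>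
     \<i> ^ q * of_real (2 * pi) powr (1 - 2 * u0) * ((- 1) ^ a / fact a) * rGamma (1 - u0 + of_nat q / 2)) (at u0)"
    by (intro tendsto_mult tendsto_const tendsto_powr_complex g r tendsto_diff tendsto_ident_at twopi)
  moreover have "(\<lambda>u. \<i> ^ q * of_real (2 * pi) powr (1 - 2 * u) * (Gamma (u + of_nat q / 2) * (u + of_nat q / 2 + of_nat a)) *
      rGamma (1 - u + of_nat q / 2)) = (\<lambda>u. gamma_factor1 p u * (u + of_nat (\<alpha> + \<beta>) / 2))"
  proof
    fix u :: complex
    have "u + of_nat (\<alpha> + \<beta>) / 2 = u + of_nat q / 2 + of_nat a" unfolding qa by (simp add: add_divide_distrib)
    then show "\<i> ^ q * of_real (2 * pi) powr (1 - 2 * u) * (Gamma (u + of_nat q / 2) * (u + of_nat q / 2 + of_nat a)) *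
      rGamma (1 - u + of_nat q / 2) = gamma_factor1 p u * (u + of_nat (\<alpha> + \<beta>) / 2)"
      unfolding gamma_factor1_def divide_Gamma_eq q q_def[symmetric] by (simp only: mult_ac)
  qed
  moreover have "\<i> ^ q * of_real (2 * pi) powr (1 - 2 * u0) * ((- 1) ^ a / fact a) * rGamma (1 - u0 + of_nat q / 2) =
     \<i> ^ (\<alpha> + \<beta>) * of_real (2 * pi) powr (1 + of_nat (\<alpha> + \<beta>)) * (rGamma (of_nat \<alpha> + 1) * rGamma (of_nat \<beta> + 1))"
  proof -
    \<comment> \<open>The sign (-1)^a in the residue of Gamma is \<i>^(2 a) and merges with \<i>^q,
      where q + 2 a = \<alpha> + \<beta>.\<close>
    have "\<i> ^ q * (- 1) ^ a = \<i> ^ (\<alpha> + \<beta>)" unfolding qa by (simp add: power_add power_mult)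
    moreover have "1 - 2 * u0 = 1 + of_nat (\<alpha> + \<beta>)" by (simp add: u0_def del: of_nat_add)
    moreover have "rGamma (of_nat (q + a) + 1) / fact a = (rGamma (of_nat \<alpha> + 1) * rGamma (of_nat \<beta> + 1) :: complex)"
    proof -
      have f: "rGamma (of_nat j + 1) = (1 / fact j :: complex)" for j
        by (subst add.commute) (simp add: rGamma_inverse_Gamma Gamma_fact inverse_eq_divide)
      have "q + a = max \<alpha> \<beta>" by (auto simp: q_def p_def a_def)
      then show ?thesis unfolding f by (auto simp: a_def max_def min_def)
    qed
    moreover have "A * P * (B / C) * R = (A * B) * P * (R / C)" for A P B C R :: complex by simp
    ultimately show ?thesis unfolding u0(2) by (simp only:)
  qed
  ultimately show ?thesis unfolding u0_def by simp
qed

section \<open>Double series and absolute convergence of the Bessel series\<close>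

lemma has_sum_finite_sum:
  fixes g :: "'b \<Rightarrow> 'a \<Rightarrow> 'c :: topological_comm_monoid_add"
  assumes "\<And>l. l \<in> L \<Longrightarrow> (g l has_sum s l) A"
  shows "((\<lambda>x. \<Sum>l\<in>L. g l x) has_sum (\<Sum>l\<in>L. s l)) A"
proof -
  have "((\<lambda>X. \<Sum>l\<in>L. \<Sum>x\<in>X. g l x) \<longlongrightarrow> (\<Sum>l\<in>L. s l)) (finite_subsets_at_top A)"
    by (intro tendsto_sum) (use assms in \<open>auto simp: has_sum_def\<close>)
  moreover have "sum (\<lambda>x. \<Sum>l\<in>L. g l x) = (\<lambda>X. \<Sum>l\<in>L. \<Sum>x\<in>X. g l x)"
    by (rule ext) (rule sum.swap)
  ultimately show ?thesis unfolding has_sum_def by (simp only:)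
qed

text \<open>Absolute convergence makes the product an unordered sum over pairs, which may then be
  reindexed by frequency and pole.\<close>

lemma has_sum_product_series:
  fixes f g :: "nat \<Rightarrow> complex"
  assumes f: "summable (\<lambda>n. norm (f n))" and g: "summable (\<lambda>n. norm (g n))"
  shows "((\<lambda>(i, j). f i * g j) has_sum (suminf f * suminf g)) UNIV"
proof -
  have hf: "(f has_sum suminf f) UNIV" and hg: "(g has_sum suminf g) UNIV"
    by (rule norm_summable_imp_has_sum[OF f summable_sums[OF summable_norm_cancel[OF f]]])
      (rule norm_summable_imp_has_sum[OF g summable_sums[OF summable_norm_cancel[OF g]]])
  have hn: "((\<lambda>n. norm (h n)) has_sum (\<Sum>n. norm (h n))) UNIV" if h: "summable (\<lambda>n. norm (h n))" for h :: "nat \<Rightarrow> complex"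
  proof (rule norm_summable_imp_has_sum[OF _ summable_sums[OF h]])
    show "summable (\<lambda>n. norm (norm (h n)))" unfolding real_norm_def abs_norm_cancel by (rule h)
  qed
  note hnf = hn[OF f] and hng = hn[OF g]
  have "(\<lambda>(i, j). norm (f i) * norm (g j)) summable_on Sigma UNIV (\<lambda>_. UNIV)"
  proof (rule summable_on_SigmaI)
    show "((\<lambda>j. case (i, j) of (i, j) \<Rightarrow> norm (f i) * norm (g j)) has_sum (norm (f i) * (\<Sum>n. norm (g n)))) UNIV" for i
      using has_sum_cmult_right[OF hng] by simp
    show "(\<lambda>i. norm (f i) * (\<Sum>n. norm (g n))) summable_on UNIV"
      using has_sum_cmult_left[OF hnf] by (auto simp: summable_on_def)
  qed auto
  then have "(\<lambda>p. norm ((\<lambda>(i, j). f i * g j) p)) summable_on Sigma UNIV (\<lambda>_. UNIV)"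
    by (simp add: case_prod_unfold norm_mult)
  then have s: "(\<lambda>(i, j). f i * g j) summable_on Sigma UNIV (\<lambda>_. UNIV)"
    by (rule Infinite_Sum.abs_summable_summable)
  have "((\<lambda>(i, j). f i * g j) has_sum (suminf f * suminf g)) (Sigma UNIV (\<lambda>_. UNIV))"
    by (rule has_sum_SigmaI[OF _ has_sum_cmult_left[OF hf] s]) (use has_sum_cmult_right[OF hg] in simp)
  then show ?thesis by simp
qed

lemma uc_power_add: "uc_power \<zeta> (a + b) = uc_power \<zeta> a * uc_power \<zeta> b"
  by (simp add: uc_power_def distrib_right exp_add)

definition bessel_term :: "'n \<Rightarrow> ucover \<Rightarrow> complex ^ 'n \<Rightarrow> nat \<Rightarrow> complex" where
  "bessel_term l \<zeta> lam j = (\<i> ^ CARD('n)) ^ j * uc_power \<zeta> (of_nat CARD('n) * (- (lam $ l) + of_nat j)) *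
      (\<Prod>k\<in>UNIV. rGamma (lam $ k - lam $ l + of_nat j + 1))"

lemma bessel_first_eq: "bessel_first l \<zeta> lam = suminf (bessel_term l \<zeta> lam)"
  for lam :: "complex ^ 'n"
  unfolding bessel_first_def
  by (rule arg_cong[where f = suminf])
    (simp add: fun_eq_iff bessel_term_def rGamma_inverse_Gamma inverse_eq_divide prod_dividef)

text \<open>Ratio test: consecutive terms differ by the constant \<open>q\<close> divided by a
  product of n linear factors in j, all of which become large.\<close>

lemma summable_norm_bessel_term:
  fixes lam :: "complex ^ 'n"
  shows "summable (\<lambda>j. norm (bessel_term l \<zeta> lam j))"
proof -
  define q where "q = \<i> ^ CARD('n) * uc_power \<zeta> (of_nat CARD('n))"
  define N where "N = (\<Sum>k\<in>UNIV. norm (lam $ k - lam $ l))"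
  have Nk: "norm (lam $ k - lam $ l) \<le> N" for k
    unfolding N_def by (rule member_le_sum) auto
  \<comment> \<open>Each linear factor has modulus at least Q \<ge> 1 for large j, so their product
    is at least Q, which exceeds 2 |q|.\<close>
  define Q where "Q = 1 + 2 * norm q"
  have Q: "Q \<ge> 1" by (simp add: Q_def)
  show ?thesis
  proof (rule summable_ratio_test[of "1 / 2" "nat \<lceil>N + Q\<rceil>"])
    fix j assume "j \<ge> nat \<lceil>N + Q\<rceil>"
    then have j: "real j \<ge> N + Q" by linarith
    define w where "w k = lam $ k - lam $ l + of_nat j + 1" for k
    have w: "norm (w k) \<ge> Q" for k
    proof -
      have "real j + 1 = norm (of_nat (Suc j) :: complex)" unfolding norm_of_nat by simp
      also have "\<dots> = norm (w k - (lam $ k - lam $ l))" by (rule arg_cong[of _ _ norm]) (simp add: w_def)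
      also have "\<dots> \<le> norm (w k) + norm (lam $ k - lam $ l)" by (rule norm_triangle_ineq4)
      finally show ?thesis using Nk[of k] j by linarith
    qed
    have w0: "w k \<noteq> 0" for k using w[of k] Q by auto
    have r: "rGamma (lam $ k - lam $ l + of_nat (Suc j) + 1) = rGamma (w k) / w k" for k
    proof -
      have "lam $ k - lam $ l + of_nat (Suc j) + 1 = w k + 1" by (simp add: w_def)
      then show ?thesis using rGamma_plus1[of "w k"] w0[of k] by (metis nonzero_mult_div_cancel_left)
    qed
    have u: "uc_power \<zeta> (of_nat CARD('n) * (- (lam $ l) + of_nat (Suc j))) =
       uc_power \<zeta> (of_nat CARD('n) * (- (lam $ l) + of_nat j)) * uc_power \<zeta> (of_nat CARD('n))"
    proof -
      have "of_nat CARD('n) * (- (lam $ l) + of_nat (Suc j)) =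
          of_nat CARD('n) * (- (lam $ l) + of_nat j) + (of_nat CARD('n) :: complex)"
        by (simp add: algebra_simps)
      then show ?thesis by (simp only: uc_power_add)
    qed
    have "bessel_term l \<zeta> lam (Suc j) = bessel_term l \<zeta> lam j * (q / (\<Prod>k\<in>UNIV. w k))"
      unfolding bessel_term_def r u by (simp add: q_def prod_dividef w_def mult_ac)
    then have "norm (bessel_term l \<zeta> lam (Suc j)) = norm (bessel_term l \<zeta> lam j) * (norm q / norm (\<Prod>k\<in>UNIV. w k))"
      by (simp add: norm_mult norm_divide)
    also have "\<dots> \<le> norm (bessel_term l \<zeta> lam j) * (1 / 2)"
    proof (rule mult_left_mono)
      have "2 * norm q \<le> Q ^ 1" by (simp add: Q_def)
      also have "\<dots> \<le> Q ^ CARD('n)" using Q by (intro power_increasing) (auto simp: Suc_le_eq)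
      also have "\<dots> = (\<Prod>k\<in>(UNIV :: 'n set). Q)" by simp
      also have "\<dots> \<le> (\<Prod>k\<in>UNIV. norm (w k))" using w Q by (intro prod_mono) auto
      finally have "2 * norm q \<le> norm (\<Prod>k\<in>UNIV. w k)" by (simp add: prod_norm)
      moreover have "norm (\<Prod>k\<in>UNIV. w k) > 0" using w0 by simp
      ultimately show "norm q / norm (\<Prod>k\<in>UNIV. w k) \<le> 1 / 2" by (simp add: field_simps)
    qed auto
    finally show "norm (norm (bessel_term l \<zeta> lam (Suc j))) \<le> 1 / 2 * norm (norm (bessel_term l \<zeta> lam j))" by simp
  qed simp
qed

section \<open>Residues of the integrand in terms of the two series indices\<close>

lemma pole_at_min:
  fixes \<mu> :: "complex ^ 'n" and m :: "int ^ 'n"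
  assumes "m $ l = int \<alpha> - int \<beta>"
  shows "pole_at \<mu> m l (min \<alpha> \<beta>) = \<mu> $ l - of_nat (\<alpha> + \<beta>) / 2"
proof -
  have "int (\<alpha> + \<beta>) = \<bar>m $ l\<bar> + 2 * int (min \<alpha> \<beta>)" unfolding assms by (auto simp: min_def)
  then have "(of_int (int (\<alpha> + \<beta>)) :: complex) = of_int (\<bar>m $ l\<bar> + 2 * int (min \<alpha> \<beta>))" by (rule arg_cong)
  then have "(of_nat (\<alpha> + \<beta>) :: complex) = of_int \<bar>m $ l\<bar> + 2 * of_nat (min \<alpha> \<beta>)"
    by (simp only: of_int_of_nat_eq of_int_add of_int_mult of_int_numeral)
  then show ?thesis unfolding pole_at_def by (simp only:) (simp add: field_simps)
qed

text \<open>By genericity only the factor with index l is singular at \<open>s0\<close>, where it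
  has a simple pole. The residue is the limit from \<open>gamma_factor1_residue\<close> times the
  values of the other factors.\<close>

lemma residue_integrand:
  fixes \<mu> :: "complex ^ 'n" and m :: "int ^ 'n"
  assumes x: "x > 0" and gen: "generic \<mu> m" and m: "m $ l = int \<alpha> - int \<beta>"
  defines "s0 \<equiv> \<mu> $ l - of_nat (\<alpha> + \<beta>) / 2"
  shows "residue (integrand \<mu> m x) s0 =
     (\<i> ^ (\<alpha> + \<beta>) * of_real (2 * pi) powr (1 + of_nat (\<alpha> + \<beta>)) * (rGamma (of_nat \<alpha> + 1) * rGamma (of_nat \<beta> + 1))) *
     (\<Prod>j\<in>UNIV - {l}. gamma_factor1 (m $ j) (s0 - \<mu> $ j)) * of_real x powr (- 2 * s0)"
proof -
  have s0: "s0 = pole_at \<mu> m l (min \<alpha> \<beta>)" unfolding s0_def pole_at_min[OF m] ..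
  \<comment> \<open>Only finitely many other poles lie in the half-plane around \<open>s0\<close>;
    removing them leaves an open set with \<open>s0\<close> as its only singularity.\<close>
  define P where "P = poles \<mu> m \<inter> {s. Re s > Re s0 - 1} - {s0}"
  define S where "S = {s. Re s > Re s0 - 1} - P"
  show ?thesis
  proof (rule residue_simple'[of S])
    show "open S" unfolding S_def P_def
      by (intro open_Diff finite_imp_closed open_halfspace_Re_gt finite_Diff finite_poles_right)
    show "s0 \<in> S" by (simp add: S_def P_def)
    show "integrand \<mu> m x holomorphic_on S - {s0}"
      by (rule holomorphic_on_subset[OF integrand_holomorphic[OF x, of \<mu> m]]) (auto simp: S_def P_def)
    have t: "((\<lambda>w. w - \<mu> $ j) \<longlongrightarrow> s0 - \<mu> $ j) (at s0)" for j by (intro tendsto_intros)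
    have lim: "filterlim (\<lambda>w. w - \<mu> $ l) (at (- of_nat (\<alpha> + \<beta>) / 2)) (at s0)"
    proof -
      have "- of_nat (\<alpha> + \<beta>) / 2 = s0 - \<mu> $ l" by (simp add: s0_def del: of_nat_add)
      note eq = this
      show ?thesis unfolding eq filterlim_at using t[of l] by (auto simp: eventually_at_filter)
    qed
    have g: "((\<lambda>w. gamma_factor1 (m $ l) (w - \<mu> $ l) * (w - s0)) \<longlongrightarrow>
       \<i> ^ (\<alpha> + \<beta>) * of_real (2 * pi) powr (1 + of_nat (\<alpha> + \<beta>)) * (rGamma (of_nat \<alpha> + 1) * rGamma (of_nat \<beta> + 1))) (at s0)"
    proof -
      have "w - \<mu> $ l + of_nat (\<alpha> + \<beta>) / 2 = w - s0" for w by (simp add: s0_def)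
      then show ?thesis using filterlim_compose[OF gamma_factor1_residue[of \<alpha> \<beta>] lim] by (simp only: m)
    qed
    have h: "((\<lambda>w. gamma_factor1 (m $ j) (w - \<mu> $ j)) \<longlongrightarrow> gamma_factor1 (m $ j) (s0 - \<mu> $ j)) (at s0)" if "j \<noteq> l" for j
    proof -
      have "s0 - \<mu> $ j + of_int \<bar>m $ j\<bar> / 2 \<notin> \<int>"
      proof
        assume a: "s0 - \<mu> $ j + of_int \<bar>m $ j\<bar> / 2 \<in> \<int>"
        have "\<mu> $ l - \<mu> $ j - (of_int \<bar>m $ l\<bar> - of_int \<bar>m $ j\<bar>) / 2 =
           (s0 - \<mu> $ j + of_int \<bar>m $ j\<bar> / 2) + of_nat (min \<alpha> \<beta>)"
          unfolding s0 pole_at_def by (simp add: field_simps)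
        also have "\<dots> \<in> \<int>" by (rule Ints_add[OF a Ints_of_nat])
        finally show False using generic_not_int(1)[OF gen, of l j] that by simp
      qed
      then have "s0 - \<mu> $ j + of_int \<bar>m $ j\<bar> / 2 \<notin> \<int>\<^sub>\<le>\<^sub>0" by (auto elim: nonpos_Ints_cases)
      then have tg: "((\<lambda>w. Gamma (w - \<mu> $ j + of_int \<bar>m $ j\<bar> / 2)) \<longlongrightarrow> Gamma (s0 - \<mu> $ j + of_int \<bar>m $ j\<bar> / 2)) (at s0)"
        by (intro tendsto_intros t)
      have tr: "((\<lambda>w. rGamma (1 - (w - \<mu> $ j) + of_int \<bar>m $ j\<bar> / 2)) \<longlongrightarrow> rGamma (1 - (s0 - \<mu> $ j) + of_int \<bar>m $ j\<bar> / 2)) (at s0)"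
        by (rule isCont_tendsto_compose[OF isCont_rGamma[OF continuous_ident]]) (intro tendsto_intros)
      have tp: "complex_of_real (2 * pi) \<notin> \<real>\<^sub>\<le>\<^sub>0" by (subst nonpos_Reals_of_real_iff) (simp add: not_le)
      show ?thesis unfolding gamma_factor1_def divide_Gamma_eq
        by (intro tendsto_mult tendsto_const tendsto_powr_complex tendsto_diff t tg tr tp)
    qed
    have "complex_of_real x \<notin> \<real>\<^sub>\<le>\<^sub>0" using x by (subst nonpos_Reals_of_real_iff) (simp add: not_le)
    then have "((\<lambda>w. (gamma_factor1 (m $ l) (w - \<mu> $ l) * (w - s0)) * (\<Prod>j\<in>UNIV - {l}. gamma_factor1 (m $ j) (w - \<mu> $ j)) *
        of_real x powr (- 2 * w)) \<longlongrightarrow>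
      (\<i> ^ (\<alpha> + \<beta>) * of_real (2 * pi) powr (1 + of_nat (\<alpha> + \<beta>)) * (rGamma (of_nat \<alpha> + 1) * rGamma (of_nat \<beta> + 1))) *
      (\<Prod>j\<in>UNIV - {l}. gamma_factor1 (m $ j) (s0 - \<mu> $ j)) * of_real x powr (- 2 * s0)) (at s0)"
      by (intro tendsto_mult g tendsto_prod h tendsto_powr_complex tendsto_const tendsto_ident_at) auto
    moreover have "(gamma_factor1 (m $ l) (w - \<mu> $ l) * (w - s0)) * (\<Prod>j\<in>UNIV - {l}. gamma_factor1 (m $ j) (w - \<mu> $ j)) *
        of_real x powr (- 2 * w) = integrand \<mu> m x w * (w - s0)" for w
    proof -
      have "(\<Prod>j\<in>UNIV. gamma_factor1 (m $ j) (w - \<mu> $ j)) =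
          gamma_factor1 (m $ l) (w - \<mu> $ l) * (\<Prod>j\<in>UNIV - {l}. gamma_factor1 (m $ j) (w - \<mu> $ j))"
        by (rule prod.remove) auto
      then show ?thesis unfolding integrand_def gamma_factor_def by (simp only: mult_ac)
    qed
    ultimately show "((\<lambda>w. integrand \<mu> m x w * (w - s0)) \<longlongrightarrow>
      (\<i> ^ (\<alpha> + \<beta>) * of_real (2 * pi) powr (1 + of_nat (\<alpha> + \<beta>)) * (rGamma (of_nat \<alpha> + 1) * rGamma (of_nat \<beta> + 1))) *
      (\<Prod>j\<in>UNIV - {l}. gamma_factor1 (m $ j) (s0 - \<mu> $ j)) * of_real x powr (- 2 * s0)) (at s0)"
      by (simp only:)
  qed
qed

text \<open>The reflection formula at u = s0 - \<mu>_j. There u + m_j / 2 is \<mu>_l - \<mu>_j -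
  (m_l - m_j) / 2 - \<beta>, so the sine depends on \<beta> only through a sign. What remains is
  \<i>^(\<alpha> + \<beta>), a factor of \<open>S_coeff\<close> with \<epsilon> = -1, and one
  reciprocal Gamma for each Bessel series.\<close>

lemma gamma_factor1_at_pole:
  fixes \<mu> :: "complex ^ 'n" and m :: "int ^ 'n"
  assumes gen: "generic \<mu> m" and m: "m $ l = int \<alpha> - int \<beta>" and jl: "j \<noteq> l"
  defines "s0 \<equiv> \<mu> $ l - of_nat (\<alpha> + \<beta>) / 2"
  shows "gamma_factor1 (m $ j) (s0 - \<mu> $ j) = \<i> ^ (\<alpha> + \<beta>) * of_real (2 * pi) powr (1 - 2 * (s0 - \<mu> $ j)) *
     (of_real pi * ((- 1 * \<i>) powi (m $ l - m $ j) /
        sin (of_real pi * (\<mu> $ l - \<mu> $ j + - 1 * (of_int (m $ l - m $ j) / 2)))) *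
     (rGamma (\<mu> $ j - \<mu> $ l + of_int (m $ j - m $ l) / 2 + of_nat \<alpha> + 1) *
      rGamma (\<mu> $ j - \<mu> $ l - of_int (m $ j - m $ l) / 2 + of_nat \<beta> + 1)))"
proof -
  define D where "D = m $ l - m $ j"
  define y where "y = \<mu> $ l - \<mu> $ j"
  define u where "u = s0 - \<mu> $ j"
  have mj: "m $ j = int \<alpha> - int \<beta> - D" by (simp add: D_def m)
  have mjc: "(of_int (m $ j) :: complex) = of_nat \<alpha> - of_nat \<beta> - of_int D" by (simp add: mj)
  have u1: "u + of_int (m $ j) / 2 = y - of_int D / 2 - of_nat \<beta>"
    unfolding u_def s0_def y_def mjc by (simp add: field_simps)
  have u2: "u - of_int (m $ j) / 2 = y + of_int D / 2 - of_nat \<alpha>"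
    unfolding u_def s0_def y_def mjc by (simp add: field_simps)
  have "y - of_int D / 2 \<notin> \<int>" using generic_not_int(2)[OF gen, of l j] jl by (simp add: y_def D_def)
  then have n: "u + of_int (m $ j) / 2 \<notin> \<int>" unfolding u1 using Ints_add[OF _ Ints_of_nat[of \<beta>], of "y - of_int D / 2 - of_nat \<beta>"] by auto
  have "\<i> powi (m $ j) / sin (of_real pi * (u + of_int (m $ j) / 2)) =
     \<i> ^ (\<alpha> + \<beta>) * ((- 1 * \<i>) powi D / sin (of_real pi * (y + - 1 * (of_int D / 2))))"
  proof -
    have EE: "(- 1) ^ \<beta> * (- 1) ^ \<beta> = (1 :: complex)" by (cases "even \<beta>") auto
    have "sin (of_real pi * (y - of_int D / 2 - of_nat \<beta>)) = (- 1) ^ \<beta> * sin (of_real pi * (y - of_int D / 2))"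
    proof -
      have e3: "(y - of_int D / 2 - of_nat \<beta> / 2) + of_nat \<beta> / 2 = y - of_int D / 2" by simp
      have e4: "(y - of_int D / 2 - of_nat \<beta> / 2) - of_nat \<beta> / 2 = y - of_int D / 2 - of_nat \<beta>" by (simp add: field_simps)
      have "sin (of_real pi * ((y - of_int D / 2 - of_nat \<beta> / 2) + of_int (int \<beta>) / 2)) =
         (- 1) powi (int \<beta>) * sin (of_real pi * ((y - of_int D / 2 - of_nat \<beta> / 2) - of_int (int \<beta>) / 2))"
        by (rule sin_half_shift)
      then have "sin (of_real pi * (y - of_int D / 2)) = (- 1) ^ \<beta> * sin (of_real pi * (y - of_int D / 2 - of_nat \<beta>))"
        by (simp only: of_int_of_nat_eq e3 e4 power_int_of_nat)
      then have "(- 1) ^ \<beta> * sin (of_real pi * (y - of_int D / 2)) =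
         ((- 1) ^ \<beta> * (- 1) ^ \<beta>) * sin (of_real pi * (y - of_int D / 2 - of_nat \<beta>))" by (simp only: mult.assoc)
      then show ?thesis unfolding EE by simp
    qed
    \<comment> \<open>Uses m_j = (\<alpha> + \<beta>) - 2 \<beta> - D; the middle term yields the
      sign that cancels the one from the sine.\<close>
    moreover have "\<i> powi (m $ j) = \<i> ^ (\<alpha> + \<beta>) * (- 1) ^ \<beta> * (- 1 * \<i>) powi D"
    proof -
      have "- 1 * \<i> = inverse \<i>" by simp
      then have i: "(- 1 * \<i>) powi D = inverse (\<i> powi D)" by (simp only: power_int_inverse)
      have "\<i> powi (m $ j) = \<i> powi (int (\<alpha> + \<beta>) - int (2 * \<beta>) - D)" by (simp add: mj)
      also have "\<dots> = \<i> powi (int (\<alpha> + \<beta>)) / \<i> powi (int (2 * \<beta>)) / \<i> powi D"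
        by (subst power_int_diff, simp, subst power_int_diff) simp_all
      also have "\<i> powi (int (2 * \<beta>)) = (- 1) ^ \<beta>" unfolding power_int_of_nat power_mult by simp
      finally show ?thesis unfolding i power_int_of_nat divide_inverse inverse_unique[OF EE] .
    qed
    moreover have "(N * E * P) / (E * S) = N * (P / S)" if "E * E = 1" for N E P S :: complex
    proof -
      have "E \<noteq> 0" using that by auto
      then show ?thesis by simp
    qed
    moreover have "y + - 1 * (of_int D / 2) = y - of_int D / 2" by simp
    ultimately show ?thesis using EE unfolding u1 by (simp only:)
  qed
  note e1 = this
  have a1: "1 - u - of_int (m $ j) / 2 = \<mu> $ j - \<mu> $ l - of_int (m $ j - m $ l) / 2 + of_nat \<beta> + 1"
  proof -
    have "1 - u - of_int (m $ j) / 2 = 1 - (u + of_int (m $ j) / 2)" by simp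
    then show ?thesis unfolding u1 y_def D_def by (simp add: field_simps)
  qed
  have a2: "1 - u + of_int (m $ j) / 2 = \<mu> $ j - \<mu> $ l + of_int (m $ j - m $ l) / 2 + of_nat \<alpha> + 1"
  proof -
    have "1 - u + of_int (m $ j) / 2 = 1 - (u - of_int (m $ j) / 2)" by simp
    then show ?thesis unfolding u2 y_def D_def by (simp add: field_simps)
  qed
  have "gamma_factor1 (m $ j) u = of_real (2 * pi) powr (1 - 2 * u) *
     (\<i> ^ nat \<bar>m $ j\<bar> * (Gamma (u + of_int \<bar>m $ j\<bar> / 2) * rGamma (1 - u + of_int \<bar>m $ j\<bar> / 2)))"
    unfolding gamma_factor1_def divide_Gamma_eq by (simp only: mult_ac)
  also have "\<dots> = of_real (2 * pi) powr (1 - 2 * u) * (of_real pi * (\<i> ^ (\<alpha> + \<beta>) * ((- 1 * \<i>) powi D / sin (of_real pi * (y + - 1 * (of_int D / 2))))) *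
      (rGamma (\<mu> $ j - \<mu> $ l - of_int (m $ j - m $ l) / 2 + of_nat \<beta> + 1) * rGamma (\<mu> $ j - \<mu> $ l + of_int (m $ j - m $ l) / 2 + of_nat \<alpha> + 1)))"
    unfolding Gamma_quotient_reflection[OF n] e1 a1 a2 ..
  finally show ?thesis unfolding u_def D_def y_def by (simp only: mult_ac)
qed

subsection \<open>The Bessel kernel\<close>

text \<open>One residue is one product of terms of the two Bessel series. The powers of 2 pi give (2
  pi)^n times a part that enters the powers on the universal cover. The n - 1 reflections give
  pi^(n-1), and (2 pi)^n pi^(n-1) / (2 pi) = (2 pi^2)^(n-1).\<close>

lemma residue_term:
  fixes \<mu> :: "complex ^ 'n" and m :: "int ^ 'n" and x \<phi> :: real and \<alpha> \<beta> :: nat and l :: 'n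
  assumes sum0: "(\<Sum>l\<in>UNIV. \<mu> $ l) = 0" and x: "x > 0" and gen: "generic \<mu> m"
  defines "k \<equiv> int \<alpha> - int \<beta> - m $ l"
  shows "1 / (2 * of_real pi) * residue (integrand \<mu> (m + vec k) x) (pole_at \<mu> (m + vec k) l (min \<alpha> \<beta>)) *
      exp (\<i> * of_int k * of_real \<phi>) =
    of_real (2 * pi\<^sup>2) ^ (CARD('n) - 1) * (S_coeff (- 1) \<mu> m l *
        bessel_term l (2 * pi * x powr (1 / real CARD('n)), \<phi> / real CARD('n))
          (\<chi> k. \<mu> $ k + of_int (m $ k) / 2) \<alpha> *
        bessel_term l (2 * pi * x powr (1 / real CARD('n)), - \<phi> / real CARD('n))
          (\<chi> k. \<mu> $ k - of_int (m $ k) / 2) \<beta>)"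
proof -
  define n where "n = CARD('n)"
  have n: "n > 0" by (simp add: n_def)
  define M where "M = m + vec k"
  have Ml: "M $ l = int \<alpha> - int \<beta>" by (simp add: M_def k_def)
  have Md: "M $ i - M $ j = m $ i - m $ j" for i j by (simp add: M_def)
  have genM: "generic \<mu> M" using gen by (simp add: M_def generic_add_vec)
  define s0 where "s0 = \<mu> $ l - of_nat (\<alpha> + \<beta>) / 2"
  define I where "I = \<i> ^ (\<alpha> + \<beta>)"
  define L where "L = complex_of_real (ln (2 * pi))"
  define X where "X = complex_of_real (ln x)"
  define P where "P j = of_real (2 * pi) powr (1 - 2 * (s0 - \<mu> $ j))" for j
  define S where "S j = (- 1 * \<i>) powi (m $ l - m $ j) /
        sin (of_real pi * (\<mu> $ l - \<mu> $ j + - 1 * (of_int (m $ l - m $ j) / 2)))" for j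
  define r1 where "r1 j = rGamma (\<mu> $ j - \<mu> $ l + of_int (m $ j - m $ l) / 2 + of_nat \<alpha> + 1)" for j
  define r2 where "r2 j = rGamma (\<mu> $ j - \<mu> $ l - of_int (m $ j - m $ l) / 2 + of_nat \<beta> + 1)" for j
  have Sc: "S_coeff (- 1) \<mu> m l = (\<Prod>j\<in>UNIV - {l}. S j)" unfolding S_coeff_def S_def ..
  have Pexp: "P j = exp ((1 - 2 * (s0 - \<mu> $ j)) * L)" for j
    using pi_gt_zero by (simp add: P_def L_def powr_def Ln_of_real' del: of_real_mult)
  have "residue (integrand \<mu> M x) s0 = (I * P l * (r1 l * r2 l)) *
     (\<Prod>j\<in>UNIV - {l}. gamma_factor1 (M $ j) (s0 - \<mu> $ j)) * of_real x powr (- 2 * s0)"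
  proof -
    have Pl: "P l = of_real (2 * pi) powr (1 + of_nat (\<alpha> + \<beta>))"
      unfolding P_def by (rule arg_cong[where f = "\<lambda>w. of_real (2 * pi) powr w"]) (simp add: s0_def del: of_nat_add)
    have rl: "r1 l = rGamma (of_nat \<alpha> + 1)" "r2 l = rGamma (of_nat \<beta> + 1)" by (simp_all add: r1_def r2_def)
    show ?thesis
      unfolding I_def rl Pl s0_def by (rule residue_integrand[OF x genM Ml])
  qed
  also have "(\<Prod>j\<in>UNIV - {l}. gamma_factor1 (M $ j) (s0 - \<mu> $ j)) =
     (\<Prod>j\<in>UNIV - {l}. I * P j * (of_real pi * S j * (r1 j * r2 j)))"
    by (intro prod.cong refl)
      (simp only: s0_def gamma_factor1_at_pole[OF genM Ml] Md I_def P_def S_def r1_def r2_def DiffD2 singleton_iff Diff_iff simp_thms)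
  also have "\<dots> = I ^ (n - 1) * (\<Prod>j\<in>UNIV - {l}. P j) * (of_real pi ^ (n - 1) * S_coeff (- 1) \<mu> m l *
      ((\<Prod>j\<in>UNIV - {l}. r1 j) * (\<Prod>j\<in>UNIV - {l}. r2 j)))"
    unfolding Sc by (simp add: prod.distrib n_def card_Diff_singleton)
  finally have res: "residue (integrand \<mu> M x) s0 = I ^ n * (\<Prod>j\<in>UNIV. P j) * (of_real pi ^ (n - 1) * S_coeff (- 1) \<mu> m l *
      ((\<Prod>j\<in>UNIV. r1 j) * (\<Prod>j\<in>UNIV. r2 j))) * of_real x powr (- 2 * s0)"
    using n unfolding prod.remove[where A = UNIV and x = l, OF finite UNIV_I]
    by (simp add: power_eq_if[of I n] mult_ac)
  have pole: "pole_at \<mu> M l (min \<alpha> \<beta>) = s0" unfolding s0_def by (rule pole_at_min[OF Ml])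
  have "(\<Prod>j\<in>UNIV. P j) = exp (\<Sum>j\<in>UNIV. (1 - 2 * (s0 - \<mu> $ j)) * L)" by (simp add: Pexp exp_sum)
  also have "(\<Sum>j\<in>UNIV. (1 - 2 * (s0 - \<mu> $ j)) * L) = of_nat n * L + of_nat n * L * (- 2 * s0)"
  proof -
    have "(\<Sum>j\<in>UNIV. 1 - 2 * (s0 - \<mu> $ j)) = of_nat n - 2 * of_nat n * s0"
      using sum0 by (simp add: sum_subtractf n_def flip: sum_distrib_left)
    note s = this
    show ?thesis unfolding sum_distrib_right[symmetric] s by (simp add: algebra_simps)
  qed
  finally have prodP: "(\<Prod>j\<in>UNIV. P j) = exp (of_nat n * L + of_nat n * L * (- 2 * s0))" .
  have xp: "of_real x powr (- 2 * s0) = exp (X * (- 2 * s0))"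
    using x by (simp add: powr_def X_def Ln_of_real' mult_ac)
  have expL: "exp (of_nat n * L) = of_real (2 * pi) ^ n"
    unfolding L_def exp_of_nat_mult exp_of_real by simp
  define \<zeta>1 where "\<zeta>1 = (2 * pi * x powr (1 / real n), \<phi> / real n)"
  define \<zeta>2 where "\<zeta>2 = (2 * pi * x powr (1 / real n), - \<phi> / real n)"
  \<comment> \<open>The n-th root in the modulus is undone by the factor n in the exponents of the
    Bessel series.\<close>
  have lnz: "of_nat n * complex_of_real (ln (2 * pi * x powr (1 / real n))) = of_nat n * L + X"
  proof -
    have "ln (2 * pi * x powr (1 / real n)) = ln (2 * pi) + ln x / real n"
      using x by (subst ln_mult) (auto simp: ln_powr)
    then have "real n * ln (2 * pi * x powr (1 / real n)) = real n * ln (2 * pi) + ln x"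
      using n by (simp add: field_simps)
    then have "complex_of_real (real n * ln (2 * pi * x powr (1 / real n))) = complex_of_real (real n * ln (2 * pi) + ln x)"
      by (rule arg_cong)
    then show ?thesis unfolding L_def X_def by simp
  qed
  have u1: "uc_power \<zeta>1 (of_nat n * w) = exp (w * (of_nat n * L + X) + \<i> * \<phi> * w)"
    and u2: "uc_power \<zeta>2 (of_nat n * w) = exp (w * (of_nat n * L + X) - \<i> * \<phi> * w)" for w
  proof -
    have h: "of_nat n * w * (Z + \<i> * (p / of_nat n)) = w * (of_nat n * Z) + \<i> * p * w" for Z p :: complex
      using n by (simp add: field_simps)
    show "uc_power \<zeta>1 (of_nat n * w) = exp (w * (of_nat n * L + X) + \<i> * \<phi> * w)"
      unfolding uc_power_def \<zeta>1_def lnz[symmetric] fst_conv snd_conv of_real_divide of_real_of_nat_eq h ..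
    show "uc_power \<zeta>2 (of_nat n * w) = exp (w * (of_nat n * L + X) - \<i> * \<phi> * w)"
      unfolding uc_power_def \<zeta>2_def lnz[symmetric] fst_conv snd_conv of_real_divide of_real_of_nat_eq h by simp
  qed
  \<comment> \<open>The two exponents add up to -2 s0, which carries the modulus, and their
    difference is \<alpha> - \<beta> - m_l = k, which carries the angle.\<close>
  have uu: "uc_power \<zeta>1 (of_nat n * (- (\<mu> $ l + of_int (m $ l) / 2) + of_nat \<alpha>)) *
      uc_power \<zeta>2 (of_nat n * (- (\<mu> $ l - of_int (m $ l) / 2) + of_nat \<beta>)) =
      exp ((of_nat n * L + X) * (- 2 * s0)) * exp (\<i> * of_int k * of_real \<phi>)"
    unfolding u1 u2 exp_add[symmetric]
    by (rule arg_cong[where f = exp]) (simp add: s0_def k_def field_simps)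
  have b1: "bessel_term l \<zeta>1 (\<chi> k. \<mu> $ k + of_int (m $ k) / 2) \<alpha> = (\<i> ^ n) ^ \<alpha> *
      uc_power \<zeta>1 (of_nat n * (- (\<mu> $ l + of_int (m $ l) / 2) + of_nat \<alpha>)) * (\<Prod>j\<in>UNIV. r1 j)"
  proof -
    have "\<mu> $ j + of_int (m $ j) / 2 - (\<mu> $ l + of_int (m $ l) / 2) = \<mu> $ j - \<mu> $ l + of_int (m $ j - m $ l) / 2" for j
      by (simp add: field_simps)
    then show ?thesis unfolding bessel_term_def r1_def n_def vec_lambda_beta by (simp only:)
  qed
  have b2: "bessel_term l \<zeta>2 (\<chi> k. \<mu> $ k - of_int (m $ k) / 2) \<beta> = (\<i> ^ n) ^ \<beta> *
      uc_power \<zeta>2 (of_nat n * (- (\<mu> $ l - of_int (m $ l) / 2) + of_nat \<beta>)) * (\<Prod>j\<in>UNIV. r2 j)"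
  proof -
    have "\<mu> $ j - of_int (m $ j) / 2 - (\<mu> $ l - of_int (m $ l) / 2) = \<mu> $ j - \<mu> $ l - of_int (m $ j - m $ l) / 2" for j
      by (simp add: field_simps)
    then show ?thesis unfolding bessel_term_def r2_def n_def vec_lambda_beta by (simp only:)
  qed
  have In: "(\<i> ^ n) ^ \<alpha> * (\<i> ^ n) ^ \<beta> = I ^ n"
    unfolding I_def power_mult[symmetric] power_add[symmetric]
    by (rule arg_cong[where f = "(^) \<i>"]) (simp add: algebra_simps)
  have const: "1 / (2 * of_real pi) * of_real (2 * pi) ^ n * of_real pi ^ (n - 1) = complex_of_real (2 * pi\<^sup>2) ^ (n - 1)"
  proof -
    obtain q where q: "n = Suc q" using n by (cases n) auto
    show ?thesis unfolding q by (simp add: power2_eq_square power_mult_distrib)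
  qed
  define E where "E = exp ((of_nat n * L + X) * (- 2 * s0)) * exp (\<i> * of_int k * of_real \<phi>)"
  define R where "R = (\<Prod>j\<in>UNIV. r1 j) * (\<Prod>j\<in>UNIV. r2 j)"
  have PX: "(\<Prod>j\<in>UNIV. P j) * of_real x powr (- 2 * s0) * exp (\<i> * of_int k * of_real \<phi>) = of_real (2 * pi) ^ n * E"
    unfolding prodP xp E_def expL[symmetric] exp_add[symmetric] mult.assoc
    by (rule arg_cong[where f = exp]) (simp add: algebra_simps)
  have "1 / (2 * of_real pi) * residue (integrand \<mu> M x) s0 * exp (\<i> * of_int k * of_real \<phi>) =
    (1 / (2 * of_real pi) * ((\<Prod>j\<in>UNIV. P j) * of_real x powr (- 2 * s0) * exp (\<i> * of_int k * of_real \<phi>)) * of_real pi ^ (n - 1)) *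
      (S_coeff (- 1) \<mu> m l * I ^ n * R)"
    unfolding res R_def by (simp only: mult_ac)
  also have "\<dots> = (1 / (2 * of_real pi) * of_real (2 * pi) ^ n * of_real pi ^ (n - 1)) * (S_coeff (- 1) \<mu> m l * (I ^ n * E * R))"
    unfolding PX by (simp only: mult_ac)
  also have "\<dots> = complex_of_real (2 * pi\<^sup>2) ^ (n - 1) * (S_coeff (- 1) \<mu> m l * (I ^ n * E * R))"
    unfolding const ..
  also have "I ^ n * E * R = bessel_term l \<zeta>1 (\<chi> k. \<mu> $ k + of_int (m $ k) / 2) \<alpha> *
      bessel_term l \<zeta>2 (\<chi> k. \<mu> $ k - of_int (m $ k) / 2) \<beta>"
    unfolding b1 b2 E_def uu[symmetric] In[symmetric] R_def by (simp only: mult_ac)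
  finally show ?thesis unfolding M_def[symmetric] pole \<zeta>1_def \<zeta>2_def n_def by (simp only: mult.assoc)
qed

text \<open>
  The double series of residues, indexed by the frequency \<open>k\<close> and the number \<open>a\<close> of the pole, is the
  product of the two Bessel series, indexed by \<open>\<alpha>\<close> and \<open>\<beta>\<close>, where \<open>\<alpha> - \<beta> = k + m $ l\<close> and
  \<open>a = min \<alpha> \<beta>\<close>.
\<close>

lemma bessel_kernel_generic:
  fixes \<mu> :: "complex ^ 'n" and m :: "int ^ 'n" and z :: complex and x \<phi> :: real
  assumes sum0: "(\<Sum>l\<in>UNIV. \<mu> $ l) = 0" and x: "x > 0" and z: "z = of_real x * exp (\<i> * of_real \<phi>)"
    and gen: "generic \<mu> m"
  shows "bessel_kernel \<mu> m z = bessel_combination (- 1) \<mu> m x \<phi>"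
proof -
  define \<zeta>1 where "\<zeta>1 = (2 * pi * x powr (1 / real CARD('n)), \<phi> / real CARD('n))"
  define \<zeta>2 where "\<zeta>2 = (2 * pi * x powr (1 / real CARD('n)), - \<phi> / real CARD('n))"
  define lam1 where "lam1 = (\<chi> k. \<mu> $ k + of_int (m $ k) / 2)"
  define lam2 where "lam2 = (\<chi> k. \<mu> $ k - of_int (m $ k) / 2)"
  define e where "e k = exp (\<i> * of_int k * of_real \<phi>)" for k :: int
  define c where "c l = of_real (2 * pi\<^sup>2) ^ (CARD('n) - 1) * (S_coeff (- 1) \<mu> m l *
     (bessel_first l \<zeta>1 lam1 * bessel_first l \<zeta>2 lam2))" for l
  define R where "R l k a = 1 / (2 * of_real pi) * residue (integrand \<mu> (m + vec k) x) (pole_at \<mu> (m + vec k) l a) * e k"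
    for l k and a :: nat
  have e0: "e k \<noteq> 0" for k by (simp add: e_def)
  have zx: "cmod z = x" using x by (simp add: z norm_mult norm_exp_eq_Re)
  have z0: "z \<noteq> 0" using x by (simp add: z)
  \<comment> \<open>The frequencies are integers, so \<open>Arg z\<close> may be replaced by any
    argument of z; this makes the right-hand side independent of the choice of \<phi>.\<close>
  have earg: "exp (\<i> * of_int k * of_real (Arg z)) = e k" for k
  proof -
    have "of_real x * exp (\<i> * of_real (Arg z)) = of_real x * exp (\<i> * of_real \<phi>)"
      by (rule trans[OF sym[OF Arg_eq[OF z0, unfolded zx]] z])
    then have "exp (\<i> * of_real (Arg z)) = exp (\<i> * of_real \<phi>)" using x by simp
    then have "exp (\<i> * of_real (Arg z)) powi k = exp (\<i> * of_real \<phi>) powi k" by simp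
    then show ?thesis unfolding e_def by (simp add: exp_power_int mult_ac)
  qed
  have hs: "((\<lambda>(k, a). R l k a) has_sum c l) UNIV" for l
  proof -
    have "((\<lambda>(\<alpha>, \<beta>). bessel_term l \<zeta>1 lam1 \<alpha> * bessel_term l \<zeta>2 lam2 \<beta>) has_sum
        (bessel_first l \<zeta>1 lam1 * bessel_first l \<zeta>2 lam2)) UNIV"
      unfolding bessel_first_eq by (intro has_sum_product_series summable_norm_bessel_term)
    then have "((\<lambda>p. of_real (2 * pi\<^sup>2) ^ (CARD('n) - 1) * (S_coeff (- 1) \<mu> m l *
        (case p of (\<alpha>, \<beta>) \<Rightarrow> bessel_term l \<zeta>1 lam1 \<alpha> * bessel_term l \<zeta>2 lam2 \<beta>))) has_sum c l) UNIV"
      unfolding c_def by (intro has_sum_cmult_right)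
    moreover have "of_real (2 * pi\<^sup>2) ^ (CARD('n) - 1) * (S_coeff (- 1) \<mu> m l *
        (case p of (\<alpha>, \<beta>) \<Rightarrow> bessel_term l \<zeta>1 lam1 \<alpha> * bessel_term l \<zeta>2 lam2 \<beta>)) =
        (case (\<lambda>(\<alpha>, \<beta>). (int \<alpha> - int \<beta> - m $ l, min \<alpha> \<beta>)) p of (k, a) \<Rightarrow> R l k a)" for p
      unfolding R_def e_def \<zeta>1_def \<zeta>2_def lam1_def lam2_def split_def fst_conv snd_conv
        residue_term[OF sum0 x gen] by (simp only: mult.assoc)
    ultimately have "((\<lambda>p. case (\<lambda>(\<alpha>, \<beta>). (int \<alpha> - int \<beta> - m $ l, min \<alpha> \<beta>)) p of (k, a) \<Rightarrow> R l k a) has_sum c l) UNIV"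
      by (simp only:)
    \<comment> \<open>The inverse adds a to the positive and negative parts of k + m_l: their
      difference is k + m_l and their minimum is a, since one of the parts is 0.\<close>
    moreover have "bij_betw (\<lambda>(\<alpha>, \<beta>). (int \<alpha> - int \<beta> - m $ l, min \<alpha> \<beta>)) UNIV (UNIV :: (int \<times> nat) set)"
      by (rule bij_betw_byWitness[where f' = "\<lambda>(k, a). (a + nat (k + m $ l), a + nat (- (k + m $ l)))"]) (auto simp: min_def)
    ultimately show ?thesis by (simp only: has_sum_reindex_bij_betw[where f = "\<lambda>(k, a). R l k a"])
  qed
  define g where "g l k = (\<Sum>\<^sub>\<infinity>a\<in>UNIV. R l k a)" for l k
  have Rs: "R l k summable_on UNIV" for l k
  proof -
    have "(\<lambda>(k, a). R l k a) summable_on Sigma UNIV (\<lambda>_. UNIV)" using hs[of l] by (auto simp: summable_on_def)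
    then show ?thesis by (rule summable_on_SigmaD1) simp
  qed
  have "(g l has_sum c l) UNIV" for l
  proof (rule has_sum_SigmaD[where f = "\<lambda>(k, a). R l k a"])
    show "((\<lambda>(k, a). R l k a) has_sum c l) (Sigma UNIV (\<lambda>_. UNIV))" using hs[of l] by simp
    show "((\<lambda>a. case (k, a) of (k, a) \<Rightarrow> R l k a) has_sum g l k) UNIV" for k
      using has_sum_infsum[OF Rs[of l k]] by (simp add: g_def)
  qed
  then have "((\<lambda>k. \<Sum>l\<in>UNIV. g l k) has_sum (\<Sum>l\<in>UNIV. c l)) UNIV"
    by (intro has_sum_finite_sum)
  moreover have "(\<Sum>l\<in>UNIV. g l k) = 1 / (2 * of_real pi) * (bessel_j \<mu> (m + vec k) x * e k)" for k
  proof -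
    \<comment> \<open>The summability required by \<open>bessel_j_generic\<close> comes from a row
      of the double series, divided by its nonzero constant.\<close>
    have rs: "(\<lambda>a. residue (integrand \<mu> (m + vec k) x) (pole_at \<mu> (m + vec k) l a)) summable_on UNIV" for l
    proof -
      have "(\<lambda>a. (2 * of_real pi / e k) * R l k a) summable_on UNIV" by (rule summable_on_cmult_right[OF Rs])
      moreover have "(2 * of_real pi / e k) * R l k a = residue (integrand \<mu> (m + vec k) x) (pole_at \<mu> (m + vec k) l a)" for a
        using e0[of k] by (simp add: R_def)
      ultimately show ?thesis by simp
    qed
    have "g l k = 1 / (2 * of_real pi) * (\<Sum>\<^sub>\<infinity>a\<in>UNIV. residue (integrand \<mu> (m + vec k) x) (pole_at \<mu> (m + vec k) l a)) * e k" for l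
    proof -
      have "((\<lambda>a. R l k a) has_sum 1 / (2 * of_real pi) * (\<Sum>\<^sub>\<infinity>a\<in>UNIV. residue (integrand \<mu> (m + vec k) x) (pole_at \<mu> (m + vec k) l a)) * e k) UNIV"
        unfolding R_def by (intro has_sum_cmult_left has_sum_cmult_right has_sum_infsum rs)
      then show ?thesis unfolding g_def by (rule infsumI)
    qed
    then show ?thesis
      using bessel_j_generic[OF sum0 x, of "m + vec k"] gen rs
      by (simp add: generic_add_vec sum_distrib_right sum_divide_distrib)
  qed
  ultimately have "((\<lambda>k. 1 / (2 * of_real pi) * (bessel_j \<mu> (m + vec k) x * e k)) has_sum (\<Sum>l\<in>UNIV. c l)) UNIV"
    by simp
  then have "(\<Sum>\<^sub>\<infinity>k. 1 / (2 * of_real pi) * (bessel_j \<mu> (m + vec k) x * e k)) = (\<Sum>l\<in>UNIV. c l)" by (rule infsumI)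
  then have "bessel_kernel \<mu> m z = (\<Sum>l\<in>UNIV. c l)"
    unfolding bessel_kernel_def zx earg by (subst (asm) infsum_cmult_right') simp
  also have "\<dots> = bessel_combination (- 1) \<mu> m x \<phi>"
    unfolding bessel_combination_def c_def \<zeta>1_def \<zeta>2_def lam1_def lam2_def sum_distrib_left by (simp only: mult.assoc)
  finally show ?thesis .
qed

theorem theorem15p1:
  fixes \<mu> :: "complex ^ 'n" and m :: "int ^ 'n" and z :: complex and x \<phi> :: real
  assumes "(\<Sum>l\<in>UNIV. \<mu> $ l) = 0"
    and "x > 0" and "z = of_real x * exp (\<i> * of_real \<phi>)"
  shows "(generic \<mu> m \<longrightarrow>
            (\<forall>l. S_coeff 1 \<mu> m l = S_coeff (- 1) \<mu> m l) \<and>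
            (\<forall>\<epsilon>\<in>{1, - 1}. bessel_kernel \<mu> m z = bessel_combination \<epsilon> \<mu> m x \<phi>)) \<and>
         (\<not> generic \<mu> m \<longrightarrow>
            (\<forall>\<epsilon>\<in>{1, - 1}.
               ((\<lambda>\<mu>'. bessel_combination \<epsilon> \<mu>' m x \<phi>) \<longlongrightarrow> bessel_kernel \<mu> m z)
                 (at \<mu> within {\<mu>'. (\<Sum>l\<in>UNIV. \<mu>' $ l) = 0 \<and> generic \<mu>' m})))"
proof -
  \<comment> \<open>The residue computation produces \<epsilon> = -1; \<open>S_coeff_sign\<close>
    transfers the identity to \<epsilon> = 1.\<close>
  have comb: "bessel_kernel \<mu>' m z = bessel_combination \<epsilon> \<mu>' m x \<phi>"
    if "\<epsilon> \<in> {1, - 1}" "(\<Sum>l\<in>UNIV. \<mu>' $ l) = 0" "generic \<mu>' m" for \<epsilon> and \<mu>' :: "complex ^ 'n"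
    using bessel_kernel_generic[OF that(2) assms(2,3) that(3)] that(1) S_coeff_sign[of \<mu>' m]
    by (auto simp: bessel_combination_def)
  define N where "N = {\<mu>' :: complex ^ 'n. (\<Sum>l\<in>UNIV. \<mu>' $ l) = 0 \<and> generic \<mu>' m}"
  have "((\<lambda>\<mu>'. bessel_kernel \<mu>' m z) \<longlongrightarrow> bessel_kernel \<mu> m z) (at \<mu> within N)"
  proof -
    obtain c \<eta> where c: "c < - norm \<mu> - 3" "clear_line \<mu> \<eta> c" by (rule exists_clear_line)
    have \<eta>: "\<eta> > 0" using c(2) by (simp add: clear_line_def)
    have c3: "c \<le> Re (\<mu> $ l) - 3" for l
      using c(1) Finite_Cartesian_Product.norm_nth_le[of \<mu> l] abs_le_D2[OF abs_Re_le_cmod[of "\<mu> $ l"]] by linarith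
    have "z \<noteq> 0" using assms by simp
    from continuous_on_bessel_kernel[OF this c(2) c3, of m]
    have "((\<lambda>\<mu>'. bessel_kernel \<mu>' m z) \<longlongrightarrow> bessel_kernel \<mu> m z)
        (at \<mu> within cball \<mu> \<eta> \<inter> {\<mu>'. (\<Sum>l\<in>UNIV. \<mu>' $ l) = 0})"
      using \<eta> assms(1) unfolding continuous_on_def by simp
    then have "((\<lambda>\<mu>'. bessel_kernel \<mu>' m z) \<longlongrightarrow> bessel_kernel \<mu> m z) (at \<mu> within N \<inter> ball \<mu> \<eta>)"
      by (rule tendsto_within_subset) (auto simp: N_def)
    moreover have "at \<mu> within N \<inter> ball \<mu> \<eta> = at \<mu> within N"
      by (rule at_within_nhd[of _ "ball \<mu> \<eta>"]) (use \<eta> in auto)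
    ultimately show ?thesis by simp
  qed
  \<comment> \<open>At every approaching parameter the combination equals the kernel, so it inherits
    the limit even if its single summands diverge.\<close>
  then have "((\<lambda>\<mu>'. bessel_combination \<epsilon> \<mu>' m x \<phi>) \<longlongrightarrow> bessel_kernel \<mu> m z) (at \<mu> within N)" if "\<epsilon> \<in> {1, - 1}" for \<epsilon>
    by (rule Lim_transform_eventually) (use comb[OF that] in \<open>auto simp: eventually_at_filter N_def\<close>)
  then show ?thesis using comb assms(1) S_coeff_sign unfolding N_def by blast
qed

end
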